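(* Let $R\in(0,+\infty)$, $u_*\in\mathbb{H}^{\infty}_{\Sigma 0}$ and $N\in\{0,1,2,\dots\}$. (i) Let $u_0,\dots,u_N\in C^\infty([0,+\infty),\mathbb{H}^\infty_{\Sigma 0})$ be arbitrary and put $u^N(t):=\sum_{j=0}^N R^j u_j(t)$ for $t\in[0,+\infty)$. Then $$\frac{d u^N}{dt}-\Delta u^N-R\,\mathscr{P}(u^N,u^N)=\Big(\frac{du_0}{dt}-\Delta u_0\Big)+\sum_{j=1}^{N}R^j\Big[\frac{du_j}{dt}-\Delta u_j-\sum_{\ell=0}^{j-1}\mathscr{P}(u_\ell,u_{j-\ell-1})\Big]-\sum_{j=N+1}^{2N+1}R^j\sum_{\ell=j-N-1}^{N}\mathscr{P}(u_\ell,u_{j-\ell-1}).$$ (ii) One can define recursively a family of functions $u_j\in C^\infty([0,+\infty),\mathbb{H}^\infty_{\Sigma 0})$ ($j=0,\dots,N$) by prescribing, for $t\in[0,+\infty)$, $$u_0(t):=e^{t\Delta}u_*,\qquad u_j(t):=\sum_{\ell=0}^{j-1}\int_0^t ds\,e^{(t-s)\Delta}\mathscr{P}(u_\ell(s),u_{j-\ell-1}(s))\quad(j=1,\dots,N).$$ With this choice $u_0(0)=u_*$, $u_j(0)=0$ for $j=1,\dots,N$, and the coefficients of $R^0,R^1,\dots,R^N$ in the right-hand side of the identity in (i) vanish, so that, with $u^N:=\sum_{j=0}^N R^j u_j$, $$u^N(0)=u_*,\qquad \frac{du^N}{dt}-\Delta u^N-R\,\mathscr{P}(u^N,u^N)=-\sum_{j=N+1}^{2N+1}R^j\sum_{\ell=j-N-1}^{N}\mathscr{P}(u_\ell,u_{j-\ell-1}).$$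 (iii) Let $u_0,\dots,u_N$ and $u^N$ be as in (ii). For any real $n>d/2$ and all $t\in[0,+\infty)$, $$\Big\|\Big(\frac{du^N}{dt}-\Delta u^N-R\,\mathscr{P}(u^N,u^N)\Big)(t)\Big\|_n\leq K_n\sum_{j=N+1}^{2N+1}R^j\sum_{\ell=j-N-1}^{N}\|u_\ell(t)\|_n\,\|u_{j-\ell-1}(t)\|_{n+1}.$$ More generally, for all real $p\geq n>d/2$ and all $t\in[0,+\infty)$, $$\Big\|\Big(\frac{du^N}{dt}-\Delta u^N-R\,\mathscr{P}(u^N,u^N)\Big)(t)\Big\|_p\leq\frac12K_{pn}\sum_{j=N+1}^{2N+1}R^j\sum_{\ell=j-N-1}^{N}\big(\|u_\ell(t)\|_p\|u_{j-\ell-1}(t)\|_{n+1}+\|u_\ell(t)\|_n\|u_{j-\ell-1}(t)\|_{p+1}\big).$$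
   Context: Let $d\ge 2$ be the space dimension (typically $d=3$) and $\mathbf{T}^d:=(\mathbf{R}/2\pi\mathbf{Z})^d$. An $\mathbf{R}^d$-valued distribution $v$ on $\mathbf{T}^d$ has Fourier expansion $v=\sum_{k\in\mathbf{Z}^d}v_ke_k$, $e_k(x):=e^{ik\cdot x}$, with $v_k\in\mathbf{C}^d$, $\overline{v_k}=v_{-k}$. The Laplacian and its semigroup act by $(\Delta v)_k=-|k|^2v_k$ and $(e^{t\Delta}v)_k=e^{-t|k|^2}v_k$, $t\ge0$. For $n\in\mathbf{R}$, $\mathbb{H}^n_{\Sigma 0}$ is the Hilbert space of $\mathbf{R}^d$-valued distributions $v$ on $\mathbf{T}^d$ that are divergence free ($k\cdot v_k=0$ for all $k$), have zero mean ($v_0=0$) and satisfy $\sum_{k\ne0}|k|^{2n}|v_k|^2<+\infty$, with inner product $\langle v|w\rangle_n:=(2\pi)^d\sum_{k\neq0}|k|^{2n}\overline{v_k}\cdot w_k$ (where $a\cdot b:=\sum_r a_rb_r$) and norm $\|v\|_n:=\sqrt{\langle v|v\rangle_n}$. $\mathbb{H}^\infty_{\Sigma 0}:=\bigcap_{n\in\mathbf{R}}\mathbb{H}^n_{\Sigma 0}$ is a Fréchet space with the topology of the family of norms $(\|\cdot\|_n)_{n\in\mathbf{R}}$; it coincides with the space of $C^\infty$ divergence free, zero mean vector fields on $\mathbf{T}^d$. The bilinear map $\mathscr{P}$ is $\mathscr{P}(v,w):=-\mathfrak{L}(v\cdot\partial w)$, where $(v\cdot\partial w)_r:=\sum_{s=1}^d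 v_s\partial_sw_r$ and $\mathfrak{L}$ is the Leray projection onto divergence free vector fields (on Fourier coefficients, $\mathfrak{L}$ acts as the orthogonal projection onto the orthogonal complement of $k$). It is known that $\mathscr{P}$ maps $\mathbb{H}^\infty_{\Sigma 0}\times\mathbb{H}^\infty_{\Sigma 0}$ continuously into $\mathbb{H}^\infty_{\Sigma 0}$ and that, for real $p\ge n>d/2$, there are constants $K_n$, $K_{pn}$ (depending also on $d$) with $$\|\mathscr{P}(v,w)\|_n\le K_n\|v\|_n\|w\|_{n+1}\quad(v\in\mathbb{H}^n_{\Sigma 0},\,w\in\mathbb{H}^{n+1}_{\Sigma 0}),$$ $$\|\mathscr{P}(v,w)\|_p\le\tfrac12K_{pn}(\|v\|_p\|w\|_{n+1}+\|v\|_n\|w\|_{p+1})\quad(v\in\mathbb{H}^p_{\Sigma 0},\,w\in\mathbb{H}^{p+1}_{\Sigma 0}).$$ Throughout, $K_n$, $K_{pn}$ denote any fixed constants fulfilling these inequalities. *)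

theory Defs
  imports "HOL-Analysis.Analysis"
begin

text \<open>Frequencies are the vectors of integers; \<open>freq k\<close> is \<open>k\<close> seen in Euclidean space, so that
  \<open>\<bar>k\<bar> = norm (freq k)\<close> and \<open>k \<cdot> x = freq k \<bullet> x\<close>.\<close>

definition freq :: "int ^ 'd \<Rightarrow> real ^ 'd::finite" where
  "freq k = (\<chi> r. of_int (k $ r))"

definition cdot :: "complex ^ 'd \<Rightarrow> complex ^ 'd \<Rightarrow> complex" where
  "cdot a b = (\<Sum>r\<in>UNIV. a $ r * b $ r)"

definition cfreq :: "int ^ 'd \<Rightarrow> complex ^ 'd::finite" where
  "cfreq k = (\<chi> r. of_int (k $ r))"

definition vcnj :: "complex ^ 'd \<Rightarrow> complex ^ 'd::finite" where
  "vcnj a = (\<chi> r. cnj (a $ r))"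

definition slow_growth :: "(int ^ 'd::finite \<Rightarrow> complex ^ 'd) \<Rightarrow> bool" where
  "slow_growth v \<longleftrightarrow> (\<exists>C m. \<forall>k. norm (v k) \<le> C * (1 + norm (freq k)) ^ m)"

text \<open>An \<open>\<real>\<^sup>d\<close>-valued distribution on the torus is represented by its family of Fourier
  coefficients: such families are exactly the families of polynomial growth
  with \<open>v\<^sub>-\<^sub>k\<close> conjugate to \<open>v\<^sub>k\<close>.\<close>

typedef (overloaded) 'd tdist =
  "{v :: int ^ 'd::finite \<Rightarrow> complex ^ 'd. slow_growth v \<and> (\<forall>k. v (- k) = vcnj (v k))}"
  morphisms fcoeff Tdist
proof
  show "(\<lambda>_. 0) \<in> {v :: int ^ 'd::finite \<Rightarrow> complex ^ 'd. slow_growth v \<and> (\<forall>k. v (- k) = vcnj (v k))}"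
    by (auto simp: slow_growth_def vcnj_def vec_eq_iff intro!: exI[of _ 0])
qed

setup_lifting type_definition_tdist

lemma freq_uminus: "freq (- k) = - freq k"
  by (simp add: freq_def vec_eq_iff)

lemma cfreq_uminus: "cfreq (- k) = - cfreq k"
  by (simp add: cfreq_def vec_eq_iff)

lemma norm_cfreq: "norm (cfreq k) = norm (freq k)"
  by (simp add: cfreq_def freq_def norm_vec_def)

lemma slow_growth_add:
  assumes "slow_growth v" "slow_growth w"
  shows "slow_growth (\<lambda>k. v k + w k)"
proof -
  obtain C m where v: "\<And>k. norm (v k) \<le> C * (1 + norm (freq k)) ^ m"
    using assms(1) unfolding slow_growth_def by blast
  obtain D n where w: "\<And>k. norm (w k) \<le> D * (1 + norm (freq k)) ^ n"
    using assms(2) unfolding slow_growth_def by blast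
  have "norm (v k + w k) \<le> (\<bar>C\<bar> + \<bar>D\<bar>) * (1 + norm (freq k)) ^ (m + n)" for k
  proof -
    have "C * (1 + norm (freq k)) ^ m \<le> \<bar>C\<bar> * (1 + norm (freq k)) ^ (m + n)"
      by (intro mult_mono power_increasing) auto
    moreover have "D * (1 + norm (freq k)) ^ n \<le> \<bar>D\<bar> * (1 + norm (freq k)) ^ (m + n)"
      by (intro mult_mono power_increasing) auto
    ultimately show ?thesis
      using v[of k] w[of k] norm_triangle_ineq[of "v k" "w k"] by (simp add: distrib_right)
  qed
  then show ?thesis unfolding slow_growth_def by blast
qed

lemma slow_growth_dominated:
  assumes "slow_growth v" and le: "\<And>k. norm (w k) \<le> B * (1 + norm (freq k)) ^ p * norm (v k)"
  shows "slow_growth w"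
proof -
  obtain C m where v: "\<And>k. norm (v k) \<le> C * (1 + norm (freq k)) ^ m"
    using assms(1) unfolding slow_growth_def by blast
  have "norm (w k) \<le> (\<bar>B\<bar> * C) * (1 + norm (freq k)) ^ (p + m)" for k
  proof -
    have "norm (w k) \<le> B * (1 + norm (freq k)) ^ p * norm (v k)" by (rule le)
    also have "\<dots> \<le> \<bar>B\<bar> * (1 + norm (freq k)) ^ p * norm (v k)"
      by (intro mult_right_mono) auto
    also have "\<dots> \<le> \<bar>B\<bar> * (1 + norm (freq k)) ^ p * (C * (1 + norm (freq k)) ^ m)"
      by (intro mult_left_mono v) auto
    finally show ?thesis by (simp add: power_add algebra_simps)
  qed
  then show ?thesis unfolding slow_growth_def by blast
qed

instantiation tdist :: (finite) real_vector
begin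

lift_definition zero_tdist :: "'a tdist" is "\<lambda>_. 0"
  by (auto simp: slow_growth_def vcnj_def vec_eq_iff intro!: exI[of _ 0])

lift_definition plus_tdist :: "'a tdist \<Rightarrow> 'a tdist \<Rightarrow> 'a tdist" is "\<lambda>v w k. v k + w k"
  by (auto simp: vcnj_def vec_eq_iff intro!: slow_growth_add)

lift_definition uminus_tdist :: "'a tdist \<Rightarrow> 'a tdist" is "\<lambda>v k. - v k"
  by (auto simp: vcnj_def vec_eq_iff slow_growth_def)

definition minus_tdist :: "'a tdist \<Rightarrow> 'a tdist \<Rightarrow> 'a tdist" where
  "minus_tdist v w = v + - w"

lift_definition scaleR_tdist :: "real \<Rightarrow> 'a tdist \<Rightarrow> 'a tdist" is "\<lambda>c v k. c *\<^sub>R v k"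
  subgoal for c v
    using slow_growth_dominated[of v "\<lambda>k. c *\<^sub>R v k" "\<bar>c\<bar>" 0]
    by (auto simp: vcnj_def vec_eq_iff)
  done

instance
proof
  fix u v w :: "'a tdist" and c d :: real
  show "u + v + w = u + (v + w)" by transfer (simp add: add.assoc)
  show "u + v = v + u" by transfer (simp add: add.commute)
  show "0 + u = u" by transfer simp
  show "- u + u = 0" by transfer simp
  show "u - v = u + - v" by (rule minus_tdist_def)
  show "c *\<^sub>R (u + v) = c *\<^sub>R u + c *\<^sub>R v" by transfer (simp add: scaleR_add_right)
  show "(c + d) *\<^sub>R u = c *\<^sub>R u + d *\<^sub>R u" by transfer (simp add: scaleR_add_left)
  show "c *\<^sub>R d *\<^sub>R u = (c * d) *\<^sub>R u" by transfer simp
  show "1 *\<^sub>R u = u" by transfer simp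
qed

end

lift_definition laplacian :: "'d::finite tdist \<Rightarrow> 'd tdist"
  is "\<lambda>v k. - ((norm (freq k))\<^sup>2 *\<^sub>R v k)"
  subgoal for v
  proof -
    have "norm (- ((norm (freq k))\<^sup>2 *\<^sub>R v k)) \<le> 1 * (1 + norm (freq k)) ^ 2 * norm (v k)" for k
      by (auto intro!: mult_right_mono power_mono)
    then show "slow_growth v \<and> (\<forall>k. v (- k) = vcnj (v k)) \<Longrightarrow> ?thesis"
      using slow_growth_dominated[of v "\<lambda>k. - ((norm (freq k))\<^sup>2 *\<^sub>R v k)" 1 2]
      by (auto simp: vcnj_def vec_eq_iff freq_uminus)
  qed
  done

text \<open>The heat semigroup; meaningful for \<open>t \<ge> 0\<close> only.\<close>

definition heat :: "real \<Rightarrow> 'd::finite tdist \<Rightarrow> 'd tdist" where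
  "heat t v = Tdist (\<lambda>k. exp (- t * (norm (freq k))\<^sup>2) *\<^sub>R fcoeff v k)"

lift_definition partial_deriv :: "'d::finite \<Rightarrow> 'd tdist \<Rightarrow> 'd tdist"
  is "\<lambda>s v k. \<chi> r. \<i> * of_int (k $ s) * v k $ r"
  subgoal for s v
  proof -
    have "norm (\<chi> r. \<i> * of_int (k $ s) * v k $ r) \<le> 1 * (1 + norm (freq k)) ^ 1 * norm (v k)" for k
    proof -
      have "norm (\<chi> r. \<i> * of_int (k $ s) * v k $ r) = \<bar>of_int (k $ s)\<bar> * norm (v k)"
        by (simp add: norm_vec_def norm_mult L2_set_right_distrib)
      moreover have "\<bar>of_int (k $ s)\<bar> \<le> norm (freq k)"
        using component_le_norm_cart[of "freq k" s] by (simp add: freq_def)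
      ultimately show ?thesis by (auto intro!: mult_right_mono)
    qed
    then show "slow_growth v \<and> (\<forall>k. v (- k) = vcnj (v k)) \<Longrightarrow> ?thesis"
      using slow_growth_dominated[of v "\<lambda>k. \<chi> r. \<i> * of_int (k $ s) * v k $ r" 1 1]
      by (auto simp: vcnj_def vec_eq_iff)
  qed
  done

lemma norm_vec_scale: "norm (c *s (x :: complex ^ 'd::finite)) = norm c * norm x"
  by (simp add: norm_vec_def norm_mult L2_set_right_distrib)

lemma norm_cdot_le: "norm (cdot a b) \<le> norm a * norm (b :: complex ^ 'd::finite)"
proof -
  have "norm (cdot a b) \<le> (\<Sum>r\<in>UNIV. \<bar>norm (a $ r)\<bar> * \<bar>norm (b $ r)\<bar>)"
    unfolding cdot_def by (rule order_trans[OF norm_sum]) (simp add: norm_mult)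
  also have "\<dots> \<le> norm a * norm b"
    unfolding norm_vec_def by (rule L2_set_mult_ineq)
  finally show ?thesis .
qed

text \<open>The orthogonal projection onto the complement of \<open>k\<close>; division by zero makes it the
  identity for \<open>k = 0\<close>.\<close>

lift_definition leray :: "'d::finite tdist \<Rightarrow> 'd tdist"
  is "\<lambda>v k. v k - (cdot (cfreq k) (v k) / of_real ((norm (freq k))\<^sup>2)) *s cfreq k"
  subgoal for v
  proof -
    let ?L = "\<lambda>k. v k - (cdot (cfreq k) (v k) / of_real ((norm (freq k))\<^sup>2)) *s cfreq k"
    assume v: "slow_growth v \<and> (\<forall>k. v (- k) = vcnj (v k))"
    have "norm (?L k) \<le> 2 * (1 + norm (freq k)) ^ 0 * norm (v k)" for k
    proof (cases "freq k = 0")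
      case True
      then have "cfreq k = 0" using norm_cfreq[of k] by simp
      then show ?thesis by simp
    next
      case False
      have "norm ((cdot (cfreq k) (v k) / of_real ((norm (freq k))\<^sup>2)) *s cfreq k)
          = norm (cdot (cfreq k) (v k)) / norm (freq k)"
        using False by (simp add: norm_vec_scale norm_divide norm_cfreq power2_eq_square norm_mult)
      also have "\<dots> \<le> norm (v k)"
        using False norm_cdot_le[of "cfreq k" "v k"] by (simp add: norm_cfreq field_simps)
      finally show ?thesis
        using norm_triangle_ineq4[of "v k"
          "(cdot (cfreq k) (v k) / of_real ((norm (freq k))\<^sup>2)) *s cfreq k"] by simp
    qed
    then have "slow_growth ?L" using slow_growth_dominated[of v ?L 2 0] v by blast
    moreover have "cdot (- cfreq k) (vcnj (v k)) = - cnj (cdot (cfreq k) (v k))" for k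
      by (simp add: cdot_def cfreq_def vcnj_def sum_negf)
    then have "?L (- k) = vcnj (?L k)" for k
      using v by (simp add: freq_uminus cfreq_uminus)
        (simp add: vcnj_def vec_eq_iff cfreq_def)
    ultimately show ?thesis by blast
  qed
  done

definition wave :: "int ^ 'd \<Rightarrow> real ^ 'd::finite \<Rightarrow> complex" where
  "wave k x = cis (freq k \<bullet> x)"

text \<open>Pointwise values of the distributions with absolutely summable Fourier series; this covers
  all elements of the Sobolev spaces of order \<open>n > d/2\<close>.\<close>

definition value_at :: "'d::finite tdist \<Rightarrow> real ^ 'd \<Rightarrow> complex ^ 'd" where
  "value_at v x = (\<Sum>\<^sub>\<infinity>k. wave k x *s fcoeff v k)"

definition tdist_of_fun :: "(real ^ 'd::finite \<Rightarrow> complex ^ 'd) \<Rightarrow> 'd tdist" where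
  "tdist_of_fun f = Tdist (\<lambda>k. (1 / (2 * pi) ^ CARD('d)) *\<^sub>R
     integral (cbox 0 (\<chi> r. 2 * pi)) (\<lambda>x. wave (- k) x *s f x))"

text \<open>The field \<open>v \<cdot> \<partial>w\<close> as a product of functions, for \<open>v\<close> and the first derivatives
  of \<open>w\<close> with absolutely summable Fourier series.\<close>

definition advection :: "'d::finite tdist \<Rightarrow> 'd tdist \<Rightarrow> 'd tdist" where
  "advection v w = tdist_of_fun
     (\<lambda>x. \<chi> r. \<Sum>s\<in>UNIV. value_at v x $ s * value_at (partial_deriv s w) x $ r)"

definition ns_bilinear :: "'d::finite tdist \<Rightarrow> 'd tdist \<Rightarrow> 'd tdist" where
  "ns_bilinear v w = - leray (advection v w)"

definition sobolev_space :: "real \<Rightarrow> 'd::finite tdist set" where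
  "sobolev_space n = {v. (\<forall>k. cdot (cfreq k) (fcoeff v k) = 0) \<and> fcoeff v 0 = 0 \<and>
     (\<lambda>k. norm (freq k) powr (2 * n) * (norm (fcoeff v k))\<^sup>2) summable_on - {0}}"

text \<open>The series is real because \<open>v\<^sub>-\<^sub>k\<close> is conjugate to \<open>v\<^sub>k\<close>; \<open>Re\<close> only changes the type.\<close>

definition sobolev_inner :: "real \<Rightarrow> 'd::finite tdist \<Rightarrow> 'd tdist \<Rightarrow> real" where
  "sobolev_inner n v w = (2 * pi) ^ CARD('d) * Re (\<Sum>\<^sub>\<infinity>k\<in>- {0}.
     of_real (norm (freq k) powr (2 * n)) * cdot (vcnj (fcoeff v k)) (fcoeff w k))"

definition sobolev_norm :: "real \<Rightarrow> 'd::finite tdist \<Rightarrow> real" where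
  "sobolev_norm n v = sqrt (sobolev_inner n v v)"

definition smooth_space :: "'d::finite tdist set" where
  "smooth_space = (\<Inter>n. sobolev_space n)"

definition smooth_topology :: "'d::finite tdist topology" where
  "smooth_topology = topology_generated_by
     {{w \<in> smooth_space. sobolev_norm n (w - v) < e} | n v e. v \<in> smooth_space \<and> e > 0}"

text \<open>Derivatives on \<open>[0, \<infinity>)\<close>, one-sided at \<open>0\<close>, and integrals, both with respect to the
  Frechet topology. The integral is the limit of Riemann sums used by the library for
  integrals in normed spaces.\<close>

definition has_time_deriv :: "(real \<Rightarrow> 'd::finite tdist) \<Rightarrow> 'd tdist \<Rightarrow> real \<Rightarrow> bool" where
  "has_time_deriv u u' t \<longleftrightarrow>
     limitin smooth_topology (\<lambda>s. (1 / (s - t)) *\<^sub>R (u s - u t)) u' (at t within {0..})"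

definition time_deriv :: "(real \<Rightarrow> 'd::finite tdist) \<Rightarrow> real \<Rightarrow> 'd tdist" where
  "time_deriv u t = (THE u'. has_time_deriv u u' t)"

text \<open>Smooth maps from \<open>[0, \<infinity>)\<close> to the Frechet space: \<open>D m\<close> is the derivative of order \<open>m\<close>.
  Values at negative times are irrelevant.\<close>

definition smooth_curve :: "(real \<Rightarrow> 'd::finite tdist) \<Rightarrow> bool" where
  "smooth_curve u \<longleftrightarrow> (\<exists>D :: nat \<Rightarrow> real \<Rightarrow> 'd tdist. (\<forall>t\<ge>0. D 0 t = u t) \<and>
     (\<forall>m. \<forall>t\<ge>0. D m t \<in> smooth_space \<and> has_time_deriv (D m) (D (Suc m) t) t))"

definition has_time_integral :: "(real \<Rightarrow> 'd::finite tdist) \<Rightarrow> 'd tdist \<Rightarrow> real \<Rightarrow> real \<Rightarrow> bool" where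
  "has_time_integral f I a b \<longleftrightarrow>
     limitin smooth_topology (\<lambda>p. \<Sum>(s, J)\<in>p. measure lborel J *\<^sub>R f s) I (division_filter {a..b})"

definition time_integral :: "real \<Rightarrow> real \<Rightarrow> (real \<Rightarrow> 'd::finite tdist) \<Rightarrow> 'd tdist" where
  "time_integral a b f = (THE I. has_time_integral f I a b)"

definition approx_sol :: "real \<Rightarrow> nat \<Rightarrow> (nat \<Rightarrow> real \<Rightarrow> 'd::finite tdist) \<Rightarrow> real \<Rightarrow> 'd tdist" where
  "approx_sol R N u t = (\<Sum>j=0..N. R ^ j *\<^sub>R u j t)"

definition ns_residual :: "real \<Rightarrow> (real \<Rightarrow> 'd::finite tdist) \<Rightarrow> real \<Rightarrow> 'd tdist" where
  "ns_residual R u t = time_deriv u t - laplacian (u t) - R *\<^sub>R ns_bilinear (u t) (u t)"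

definition reynolds_integrand ::
    "(nat \<Rightarrow> real \<Rightarrow> 'd::finite tdist) \<Rightarrow> nat \<Rightarrow> nat \<Rightarrow> real \<Rightarrow> real \<Rightarrow> 'd tdist" where
  "reynolds_integrand u j l t s = heat (t - s) (ns_bilinear (u l s) (u (j - l - 1) s))"

definition reynolds_recursion ::
    "'d::finite tdist \<Rightarrow> nat \<Rightarrow> (nat \<Rightarrow> real \<Rightarrow> 'd tdist) \<Rightarrow> bool" where
  "reynolds_recursion ustar N u \<longleftrightarrow>
     (\<forall>t\<ge>0. u 0 t = heat t ustar) \<and>
     (\<forall>j\<in>{1..N}. \<forall>t\<ge>0. u j t = (\<Sum>l=0..j-1. time_integral 0 t (reynolds_integrand u j l t)))"

text \<open>The admissible values of the constants \<open>K\<^sub>n\<close> and \<open>K\<^sub>p\<^sub>n\<close> in the inequalities for the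
  bilinear map. The norms in them are meaningful because for \<open>n > d/2\<close> the bilinear map sends
  these pairs into the Sobolev space of order \<open>n\<close>, respectively \<open>p\<close>.\<close>

definition bilinear_const :: "'d::finite itself \<Rightarrow> real \<Rightarrow> real \<Rightarrow> bool" where
  "bilinear_const _ n K \<longleftrightarrow> (\<forall>v \<in> sobolev_space n. \<forall>w \<in> sobolev_space (n + 1) :: 'd tdist set.
     sobolev_norm n (ns_bilinear v w) \<le> K * sobolev_norm n v * sobolev_norm (n + 1) w)"

definition tame_const :: "'d::finite itself \<Rightarrow> real \<Rightarrow> real \<Rightarrow> real \<Rightarrow> bool" where
  "tame_const _ p n K \<longleftrightarrow> (\<forall>v \<in> sobolev_space p. \<forall>w \<in> sobolev_space (p + 1) :: 'd tdist set.
     sobolev_norm p (ns_bilinear v w) \<le> 1 / 2 * K *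
       (sobolev_norm p v * sobolev_norm (n + 1) w + sobolev_norm n v * sobolev_norm (p + 1) w))"

end

theory Submission
  imports Defs
begin

text \<open>The algebraic identity is bookkeeping: \<open>ns_bilinear\<close> is bilinear, so \<open>R\<close> times its value at
\<open>\<Sum>R\<^sup>j u\<^sub>j\<close> is a double sum over a square of index pairs, and collecting the pairs on each
antidiagonal gives the coefficient of each power of \<open>R\<close>. The recursion is solved because Duhamel's
integral \<open>\<integral>\<^sub>0\<^sup>t e\<^bsup>(t-s)\<Delta>\<^esup> f(s) ds\<close> of a smooth curve \<open>f\<close> is a smooth curve that solves
\<open>u' = \<Delta>u + f\<close> with \<open>u(0) = 0\<close>; so the coefficients of \<open>R\<^sup>0, \<dots>, R\<^sup>N\<close> cancel, and the estimates are
the triangle inequality applied to what is left. The work is in the analysis of the Frechet space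
of smooth fields and of its curves, which is done on Fourier coefficients.

A divergence free field of zero mean is smooth exactly when its coefficients decay faster than every
power of \<open>1 + \<bar>k\<bar>\<close>
(\<open>smooth_space_iff\<close>). The topology given by the Sobolev norms has the property of Montel: a family
that is bounded for every weight and whose coefficients converge one by one converges in the
topology (\<open>limitin_smooth_of_fcoeff_bounded\<close>). Hence Riemann sums and difference quotients need
only be studied one coefficient at a time, together with a bound that is uniform in the frequency;
the mean value theorem provides the bound for difference quotients (\<open>has_time_deriv_of_fcoeff\<close>),
the length of the interval the one for Riemann sums (\<open>has_time_integral_of_bounded\<close>). In
particular no integration theory in Frechet spaces is involved: each coefficient of Duhamel's
integral is an ordinary integral.

The bilinear map is treated by the convolution formula for the coefficients of a product
(\<open>has_sum_advection\<close>), which follows from the orthogonality of the waves. It gives continuity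
(\<open>limitin_ns_bilinear\<close>), hence the product rule. Smoothness of curves is then a coinductive
matter: in a class of curves closed under differentiation every curve is smooth. The class used is
the one generated from some curves by sums, Laplacians and the bilinear map
(\<open>smooth_curve_algebra\<close>). A solution of \<open>u' = \<Delta>u + f\<close> has its derivative in the class generated by
\<open>u\<close> and the smooth curves, and this is all the regularity theory that the recursion needs.\<close>

section \<open>Lattice sums\<close>

definition weight :: "int ^ 'd::finite \<Rightarrow> real" where
  "weight k = 1 + norm (freq k)"

lemma weight_ge_1: "1 \<le> weight k"
  by (simp add: weight_def)

lemma weight_pos [simp]: "0 < weight k" "0 \<le> weight k" "weight k \<noteq> 0"
  using weight_ge_1[of k] by linarith+

lemma freq_add: "freq (k + h) = freq k + freq h"
  by (simp add: freq_def vec_eq_iff)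

lemma freq_diff: "freq (k - h) = freq k - freq h"
  by (simp add: freq_def vec_eq_iff)

lemma freq_zero [simp]: "freq 0 = 0"
  by (simp add: freq_def vec_eq_iff)

lemma freq_eq_0_iff [simp]: "freq k = 0 \<longleftrightarrow> k = 0"
  by (simp add: freq_def vec_eq_iff)

text \<open>Peetre's inequality: it distributes a weight over the two factors of a convolution.\<close>

lemma weight_submult: "weight k \<le> weight h * weight (k - h)"
proof -
  have "norm (freq k) \<le> norm (freq h) + norm (freq (k - h))"
    using norm_triangle_ineq[of "freq h" "freq (k - h)"] by (simp add: freq_diff)
  moreover have "0 \<le> norm (freq h) * norm (freq (k - h))" by simp
  ultimately show ?thesis unfolding weight_def distrib_left distrib_right mult_1_left mult_1_right
    by linarith
qed

lemma abs_component_le_freq: "\<bar>of_int (k $ r)\<bar> \<le> norm (freq k)"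
  using component_le_norm_cart[of "freq k" r] by (simp add: freq_def)

lemma norm_freq_ge_1:
  assumes "k \<noteq> 0" shows "1 \<le> norm (freq k)"
proof -
  obtain r where "k $ r \<noteq> 0" using assms by (auto simp: vec_eq_iff)
  then have "1 \<le> \<bar>real_of_int (k $ r)\<bar>" by linarith
  then show ?thesis using abs_component_le_freq[of k r] by linarith
qed

text \<open>The components of such a \<open>k\<close> are bounded by \<open>c\<close>, so the set lies in a finite box.\<close>

lemma finite_weight_le: "finite {k :: int ^ 'd::finite. weight k \<le> c}"
proof -
  let ?B = "{- \<lceil>c\<rceil>..\<lceil>c\<rceil>}"
  have "k \<in> vec_lambda ` (\<Pi>\<^sub>E r\<in>UNIV. ?B)" if "weight k \<le> c" for k :: "int ^ 'd"
  proof (rule image_eqI)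
    show "k = vec_lambda (vec_nth k)" by simp
    have "k $ r \<in> ?B" for r
      using abs_component_le_freq[of k r] that unfolding weight_def by (simp add: abs_le_iff) linarith
    then show "vec_nth k \<in> (\<Pi>\<^sub>E r\<in>UNIV. ?B)" by auto
  qed
  then have "{k :: int ^ 'd. weight k \<le> c} \<subseteq> vec_lambda ` (\<Pi>\<^sub>E r\<in>UNIV. ?B)" by blast
  moreover have "finite (vec_lambda ` (\<Pi>\<^sub>E r\<in>(UNIV :: 'd set). ?B))"
    by (intro finite_imageI finite_PiE) auto
  ultimately show ?thesis by (rule finite_subset)
qed

lemma summable_on_int_inverse_square: "(\<lambda>j::int. inverse ((1 + \<bar>of_int j\<bar>) ^ 2) :: real) summable_on UNIV"
proof -
  let ?g = "\<lambda>j::int. inverse ((1 + \<bar>of_int j\<bar>) ^ 2) :: real"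
  have *: "(\<lambda>n::nat. inverse (real (Suc n) ^ 2)) summable_on UNIV"
  proof (subst summable_on_UNIV_nonneg_real_iff)
    have "summable (\<lambda>n. inverse (real n ^ 2))"
      using inverse_power_summable[of 2, where 'a = real] by simp
    then show "summable (\<lambda>n. inverse (real (Suc n) ^ 2))"
      by (rule summable_Suc_iff[THEN iffD2])
  qed simp
  have "?g summable_on (int ` UNIV)"
    using * by (subst summable_on_reindex) (auto simp: o_def)
  moreover have "?g summable_on ((\<lambda>n. - int n) ` UNIV)"
    using * by (subst summable_on_reindex) (auto simp: o_def inj_on_def)
  ultimately have "?g summable_on (int ` UNIV \<union> (\<lambda>n. - int n) ` UNIV)"
    by (rule summable_on_union)
  also have "int ` UNIV \<union> (\<lambda>n. - int n) ` UNIV = UNIV"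
    by (auto simp: image_iff) (metis int_cases2)
  finally show ?thesis .
qed

text \<open>The summand is at most the product over the components of \<open>(1 + \<bar>k\<^sub>r\<bar>)\<^bsup>-2\<^esup>\<close>, because the
weight dominates each factor \<open>1 + \<bar>k\<^sub>r\<bar>\<close>. A finite set of frequencies lies in the product of its
coordinate projections, where the sum of the products is the product of one-dimensional sums.\<close>

lemma summable_on_weight:
  "(\<lambda>k :: int ^ 'd::finite. inverse (weight k ^ (2 * CARD('d)))) summable_on UNIV"
proof (rule nonneg_bdd_above_summable_on)
  show "0 \<le> inverse (weight k ^ (2 * CARD('d)))" for k :: "int ^ 'd" by simp
  let ?g = "\<lambda>j::int. inverse ((1 + \<bar>of_int j\<bar>) ^ 2) :: real"
  let ?C = "\<Sum>\<^sub>\<infinity>j. ?g j"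
  have le: "inverse (weight k ^ (2 * CARD('d))) \<le> (\<Prod>r\<in>UNIV. ?g (k $ r))" for k :: "int ^ 'd"
  proof -
    have "(\<Prod>r\<in>UNIV. (1 + \<bar>real_of_int (k $ r)\<bar>) ^ 2) \<le> (\<Prod>r\<in>(UNIV::'d set). weight k ^ 2)"
      using abs_component_le_freq[of k]
      by (intro prod_mono) (auto simp: weight_def intro!: power_mono)
    also have "\<dots> = weight k ^ (2 * CARD('d))" by (simp add: power_mult)
    finally have "inverse (weight k ^ (2 * CARD('d))) \<le> inverse (\<Prod>r\<in>UNIV. (1 + \<bar>real_of_int (k $ r)\<bar>) ^ 2)"
      by (rule le_imp_inverse_le) (auto intro!: prod_pos zero_less_power simp: add_pos_nonneg)
    also have "\<dots> = (\<Prod>r\<in>UNIV. ?g (k $ r))" by (rule prod_inversef[symmetric, unfolded o_def])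
    finally show ?thesis .
  qed
  have "sum (\<lambda>k. inverse (weight k ^ (2 * CARD('d)))) F \<le> ?C ^ CARD('d)"
    if F: "finite F" for F :: "(int ^ 'd) set"
  proof -
    let ?P = "\<lambda>r::'d. (\<lambda>k. k $ r) ` F"
    have sub: "F \<subseteq> vec_lambda ` (\<Pi>\<^sub>E r\<in>UNIV. ?P r)"
    proof
      fix k assume "k \<in> F"
      then show "k \<in> vec_lambda ` (\<Pi>\<^sub>E r\<in>UNIV. ?P r)"
        by (intro image_eqI[of _ _ "vec_nth k"]) auto
    qed
    have "sum (\<lambda>k. inverse (weight k ^ (2 * CARD('d)))) F \<le> (\<Sum>k\<in>F. \<Prod>r\<in>UNIV. ?g (k $ r))"
      by (intro sum_mono le)
    also have "\<dots> \<le> (\<Sum>k\<in>vec_lambda ` (\<Pi>\<^sub>E r\<in>UNIV. ?P r). \<Prod>r\<in>UNIV. ?g (k $ r))"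
      using F by (intro sum_mono2 sub finite_imageI finite_PiE prod_nonneg) auto
    also have "\<dots> = (\<Sum>f\<in>(\<Pi>\<^sub>E r\<in>UNIV. ?P r). \<Prod>r\<in>UNIV. ?g (f r))"
      by (subst sum.reindex) (auto simp: inj_on_def vec_lambda_inject)
    also have "\<dots> = (\<Prod>r\<in>UNIV. \<Sum>j\<in>?P r. ?g j)"
      using F by (subst prod_sum_PiE) auto
    also have "\<dots> \<le> (\<Prod>r\<in>(UNIV::'d set). ?C)"
      using F summable_on_int_inverse_square
      by (intro prod_mono conjI sum_nonneg finite_sum_le_infsum) auto
    finally show ?thesis by simp
  qed
  then show "bdd_above (sum (\<lambda>k :: int ^ 'd. inverse (weight k ^ (2 * CARD('d)))) ` {F. F \<subseteq> UNIV \<and> finite F})"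
    by (intro bdd_aboveI2[of _ _ "?C ^ CARD('d)"]) auto
qed

section \<open>Sobolev norms and decay of Fourier coefficients\<close>

lemma fcoeff_simps [simp]:
  "fcoeff (v + w) k = fcoeff v k + fcoeff w k"
  "fcoeff (v - w) k = fcoeff v k - fcoeff w k"
  "fcoeff (- v) k = - fcoeff v k"
  "fcoeff (c *\<^sub>R v) k = c *\<^sub>R fcoeff v k"
  "fcoeff 0 k = 0"
  by (simp_all add: plus_tdist.rep_eq uminus_tdist.rep_eq scaleR_tdist.rep_eq zero_tdist.rep_eq
      minus_tdist_def[of v w] del: add_uminus_conv_diff)

lemma tdist_eqI: "(\<And>k. fcoeff v k = fcoeff w k) \<Longrightarrow> v = w"
  using fcoeff_inject[of v w] by blast

lemma fcoeff_uminus_freq: "fcoeff v (- k) = vcnj (fcoeff v k)"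
  using fcoeff[of v] by simp

text \<open>Divergence free and with zero mean: the part of the membership in a Sobolev space that does
not depend on the order.\<close>

definition solenoidal :: "'d::finite tdist \<Rightarrow> bool" where
  "solenoidal v \<longleftrightarrow> (\<forall>k. cdot (cfreq k) (fcoeff v k) = 0) \<and> fcoeff v 0 = 0"

lemma cdot_linear:
  "cdot a (b + b') = cdot a b + cdot a b'"
  "cdot a (b - b') = cdot a b - cdot a b'"
  "cdot a (- b) = - cdot a b"
  "cdot a (c *\<^sub>R b) = c *\<^sub>R cdot a b"
  "cdot a (z *s b) = z * cdot a b"
  "cdot a 0 = 0"
  unfolding cdot_def
  by (simp_all add: distrib_left right_diff_distrib sum.distrib sum_subtractf sum_negf)
    (simp_all add: scaleR_sum_right sum_distrib_left mult.left_commute)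

lemma solenoidal_intros [intro]:
  "solenoidal v \<Longrightarrow> solenoidal w \<Longrightarrow> solenoidal (v + w)"
  "solenoidal v \<Longrightarrow> solenoidal w \<Longrightarrow> solenoidal (v - w)"
  "solenoidal v \<Longrightarrow> solenoidal (- v)"
  "solenoidal v \<Longrightarrow> solenoidal (c *\<^sub>R v)"
  "solenoidal 0"
  by (simp_all add: solenoidal_def cdot_linear)

lemma solenoidal_sobolev: "v \<in> sobolev_space n \<Longrightarrow> solenoidal v"
  by (simp add: sobolev_space_def solenoidal_def)

abbreviation torus_factor :: "'d::finite itself \<Rightarrow> real" where
  "torus_factor _ \<equiv> sqrt ((2 * pi) ^ CARD('d))"

lemma torus_factor_ge_1: "1 \<le> torus_factor TYPE('d::finite)"
proof -
  have "1 \<le> 2 * pi" using pi_gt3 by linarith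
  then show ?thesis using one_le_power[of "2 * pi" "CARD('d)"] by simp
qed

lemma cdot_vcnj_self: "cdot (vcnj a) a = of_real ((norm a)\<^sup>2)"
proof -
  have "cdot (vcnj a) a = (\<Sum>r\<in>UNIV. of_real ((norm (a $ r))\<^sup>2))"
  proof -
    have "vcnj a $ r * a $ r = of_real ((norm (a $ r))\<^sup>2)" for r
      using complex_norm_square[of "a $ r"] unfolding vcnj_def by (simp only: vec_lambda_beta mult.commute)
    then show ?thesis unfolding cdot_def by (simp only:)
  qed
  also have "\<dots> = of_real (\<Sum>r\<in>UNIV. (norm (a $ r))\<^sup>2)" by (simp only: of_real_sum)
  also have "(\<Sum>r\<in>UNIV. (norm (a $ r))\<^sup>2) = (norm a)\<^sup>2"
    by (simp add: norm_vec_def L2_set_def sum_nonneg)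
  finally show ?thesis .
qed

text \<open>Up to the constant \<open>torus_factor\<close>, the Sobolev norm of order \<open>n\<close> is the \<open>\<ell>\<^sup>2\<close> norm of this
family over the nonzero frequencies.\<close>

definition sobolev_coeff :: "real \<Rightarrow> 'd::finite tdist \<Rightarrow> int ^ 'd \<Rightarrow> real" where
  "sobolev_coeff n v k = norm (freq k) powr n * norm (fcoeff v k)"

lemma sobolev_coeff_nonneg [simp]: "0 \<le> sobolev_coeff n v k"
  by (simp add: sobolev_coeff_def)

lemma sobolev_coeff_square: "(sobolev_coeff n v k)\<^sup>2 = norm (freq k) powr (2 * n) * (norm (fcoeff v k))\<^sup>2"
  by (simp add: sobolev_coeff_def power_mult_distrib power2_eq_square[of "_ powr _"] powr_add[symmetric])

lemma sobolev_space_iff: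
  "v \<in> sobolev_space n \<longleftrightarrow> solenoidal v \<and> (\<lambda>k. (sobolev_coeff n v k)\<^sup>2) summable_on - {0}"
  by (auto simp: sobolev_space_def solenoidal_def sobolev_coeff_square)

lemma sobolev_norm_eq:
  assumes "v \<in> sobolev_space n"
  shows "sobolev_norm n v = torus_factor TYPE('d) * sqrt (\<Sum>\<^sub>\<infinity>k\<in>- {0}. (sobolev_coeff n (v :: 'd::finite tdist) k)\<^sup>2)"
proof -
  have "(\<lambda>k. (sobolev_coeff n v k)\<^sup>2) summable_on - {0}"
    using assms by (simp add: sobolev_space_iff)
  then have "((\<lambda>k. complex_of_real ((sobolev_coeff n v k)\<^sup>2)) has_sum
      of_real (\<Sum>\<^sub>\<infinity>k\<in>- {0}. (sobolev_coeff n v k)\<^sup>2)) (- {0})"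
    by (intro has_sum_of_real has_sum_infsum)
  then have "(\<Sum>\<^sub>\<infinity>k\<in>- {0}. complex_of_real ((sobolev_coeff n v k)\<^sup>2))
      = of_real (\<Sum>\<^sub>\<infinity>k\<in>- {0}. (sobolev_coeff n v k)\<^sup>2)"
    by (rule infsumI)
  moreover have "of_real (norm (freq k) powr (2 * n)) * cdot (vcnj (fcoeff v k)) (fcoeff v k)
      = complex_of_real ((sobolev_coeff n v k)\<^sup>2)" for k
    unfolding cdot_vcnj_self sobolev_coeff_square of_real_mult ..
  ultimately show ?thesis
    by (simp only: sobolev_norm_def sobolev_inner_def Re_complex_of_real real_sqrt_mult)
qed

lemma sobolev_norm_nonneg: "v \<in> sobolev_space n \<Longrightarrow> 0 \<le> sobolev_norm n v"
  by (simp add: sobolev_norm_eq infsum_nonneg)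

lemma L2_set_le_sobolev_norm:
  assumes v: "(v :: 'd::finite tdist) \<in> sobolev_space n" and F: "finite F" "0 \<notin> F"
  shows "L2_set (sobolev_coeff n v) F \<le> sobolev_norm n v / torus_factor TYPE('d)"
proof -
  have "(\<Sum>k\<in>F. (sobolev_coeff n v k)\<^sup>2) \<le> (\<Sum>\<^sub>\<infinity>k\<in>- {0}. (sobolev_coeff n v k)\<^sup>2)"
    using v F by (intro finite_sum_le_infsum) (auto simp: sobolev_space_iff)
  then show ?thesis
    using torus_factor_ge_1[where 'd = 'd] by (simp add: sobolev_norm_eq[OF v] L2_set_def)
qed

text \<open>Sobolev norms are controlled through finite sets of frequencies, where the inequalities for
\<open>L2_set\<close> apply; membership in the space comes along with the bound.\<close>

lemma sobolev_normI:
  assumes v: "solenoidal (v :: 'd::finite tdist)"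
    and le: "\<And>F. finite F \<Longrightarrow> 0 \<notin> F \<Longrightarrow> L2_set (sobolev_coeff n v) F \<le> B"
  shows "v \<in> sobolev_space n \<and> sobolev_norm n v \<le> torus_factor TYPE('d) * B"
proof -
  have B: "0 \<le> B" using le[of "{}"] by simp
  have le': "(\<Sum>k\<in>F. (sobolev_coeff n v k)\<^sup>2) \<le> B\<^sup>2" if "finite F" "F \<subseteq> - {0}" for F
    using le[of F] that by (auto simp: L2_set_def dest: sqrt_le_D)
  have summ: "(\<lambda>k. (sobolev_coeff n v k)\<^sup>2) summable_on - {0}"
    by (rule nonneg_bdd_above_summable_on) (auto intro!: bdd_aboveI2[of _ _ "B\<^sup>2"] le')
  then have space: "v \<in> sobolev_space n" using v by (simp add: sobolev_space_iff)
  have "(\<Sum>\<^sub>\<infinity>k\<in>- {0}. (sobolev_coeff n v k)\<^sup>2) \<le> B\<^sup>2"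
    by (rule infsum_le_finite_sums[OF summ le'])
  then have "sqrt (\<Sum>\<^sub>\<infinity>k\<in>- {0}. (sobolev_coeff n v k)\<^sup>2) \<le> B"
    using B by (simp add: real_le_lsqrt infsum_nonneg)
  then show ?thesis using space by (simp add: sobolev_norm_eq)
qed

lemma sobolev_norm_triangle:
  assumes v: "(v :: 'd::finite tdist) \<in> sobolev_space n" and w: "w \<in> sobolev_space n"
  shows "v + w \<in> sobolev_space n \<and> sobolev_norm n (v + w) \<le> sobolev_norm n v + sobolev_norm n w"
proof -
  let ?c = "torus_factor TYPE('d)"
  have "v + w \<in> sobolev_space n \<and>
      sobolev_norm n (v + w) \<le> ?c * (sobolev_norm n v / ?c + sobolev_norm n w / ?c)"
  proof (rule sobolev_normI)
    show "solenoidal (v + w)" using v w by (auto dest: solenoidal_sobolev)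
    fix F :: "(int ^ 'd) set" assume F: "finite F" "0 \<notin> F"
    have "sobolev_coeff n (v + w) k \<le> sobolev_coeff n v k + sobolev_coeff n w k" for k
      unfolding sobolev_coeff_def fcoeff_simps distrib_left[symmetric]
      by (intro mult_left_mono norm_triangle_ineq) simp
    then have "L2_set (sobolev_coeff n (v + w)) F \<le> L2_set (\<lambda>k. sobolev_coeff n v k + sobolev_coeff n w k) F"
      by (intro L2_set_mono) auto
    also have "\<dots> \<le> L2_set (sobolev_coeff n v) F + L2_set (sobolev_coeff n w) F"
      by (rule L2_set_triangle_ineq)
    also have "\<dots> \<le> sobolev_norm n v / ?c + sobolev_norm n w / ?c"
      using v w F by (intro add_mono L2_set_le_sobolev_norm)
    finally show "L2_set (sobolev_coeff n (v + w)) F \<le> sobolev_norm n v / ?c + sobolev_norm n w / ?c" .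
  qed
  moreover have "?c * (sobolev_norm n v / ?c + sobolev_norm n w / ?c) = sobolev_norm n v + sobolev_norm n w"
    using torus_factor_ge_1[where 'd = 'd] by (simp add: field_simps)
  ultimately show ?thesis by metis
qed

lemma sobolev_norm_scaleR:
  assumes v: "(v :: 'd::finite tdist) \<in> sobolev_space n"
  shows "a *\<^sub>R v \<in> sobolev_space n \<and> sobolev_norm n (a *\<^sub>R v) \<le> \<bar>a\<bar> * sobolev_norm n v"
proof -
  let ?c = "torus_factor TYPE('d)"
  have "a *\<^sub>R v \<in> sobolev_space n \<and> sobolev_norm n (a *\<^sub>R v) \<le> ?c * (\<bar>a\<bar> * (sobolev_norm n v / ?c))"
  proof (rule sobolev_normI)
    show "solenoidal (a *\<^sub>R v)" using v by (auto dest: solenoidal_sobolev)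
    fix F :: "(int ^ 'd) set" assume F: "finite F" "0 \<notin> F"
    have "L2_set (sobolev_coeff n (a *\<^sub>R v)) F = L2_set (\<lambda>k. \<bar>a\<bar> * sobolev_coeff n v k) F"
      by (intro L2_set_cong) (auto simp: sobolev_coeff_def)
    also have "\<dots> = \<bar>a\<bar> * L2_set (sobolev_coeff n v) F"
      by (rule L2_set_right_distrib[symmetric]) simp
    also have "\<dots> \<le> \<bar>a\<bar> * (sobolev_norm n v / ?c)"
      using v F by (intro mult_left_mono L2_set_le_sobolev_norm) auto
    finally show "L2_set (sobolev_coeff n (a *\<^sub>R v)) F \<le> \<bar>a\<bar> * (sobolev_norm n v / ?c)" .
  qed
  moreover have "?c * (\<bar>a\<bar> * (sobolev_norm n v / ?c)) = \<bar>a\<bar> * sobolev_norm n v"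
    using torus_factor_ge_1[where 'd = 'd] by (simp add: field_simps)
  ultimately show ?thesis by metis
qed

lemma sobolev_space_0: "(0 :: 'd::finite tdist) \<in> sobolev_space n"
  and sobolev_norm_0: "sobolev_norm n (0 :: 'd::finite tdist) = 0"
proof -
  have "(0 :: 'd tdist) \<in> sobolev_space n \<and> sobolev_norm n (0 :: 'd tdist) \<le> torus_factor TYPE('d) * 0"
    by (rule sobolev_normI) (auto simp: sobolev_coeff_def L2_set_def)
  then show "(0 :: 'd::finite tdist) \<in> sobolev_space n" "sobolev_norm n (0 :: 'd tdist) = 0"
    using sobolev_norm_nonneg[of "0 :: 'd tdist" n] by force+
qed

lemma sobolev_norm_uminus:
  "v \<in> sobolev_space n \<Longrightarrow> - v \<in> sobolev_space n \<and> sobolev_norm n (- v) \<le> sobolev_norm n v"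
  using sobolev_norm_scaleR[of v n "- 1"] by simp

lemma sobolev_norm_sum:
  assumes "\<And>i. i \<in> A \<Longrightarrow> f i \<in> sobolev_space n"
  shows "sum f A \<in> sobolev_space n \<and> sobolev_norm n (sum f A) \<le> (\<Sum>i\<in>A. sobolev_norm n (f i))"
  using assms
proof (induction A rule: infinite_finite_induct)
  case (insert i A)
  then show ?case using sobolev_norm_triangle[of "f i" n "sum f A"] by force
qed (auto simp: sobolev_space_0 sobolev_norm_0)

text \<open>Weighted sup norms, in the form of a predicate. They are equivalent to the Sobolev norms up
to a shift of the order (\<open>decays_sobolev\<close>, \<open>sobolev_decays\<close>) and are better suited to
convolutions.\<close>

definition decays :: "nat \<Rightarrow> real \<Rightarrow> 'd::finite tdist \<Rightarrow> bool" where
  "decays m M v \<longleftrightarrow> (\<forall>k. norm (fcoeff v k) * weight k ^ m \<le> M)"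

lemma sobolev_coeff_le_norm:
  assumes v: "v \<in> sobolev_space n"
  shows "sobolev_coeff n v k \<le> sobolev_norm n v"
proof (cases "k = 0")
  case True
  then show ?thesis
    using v sobolev_norm_nonneg[OF v] by (auto simp: sobolev_coeff_def)
next
  case False
  have "sobolev_coeff n v k = L2_set (sobolev_coeff n v) {k}" by (simp add: L2_set_def)
  also have "\<dots> \<le> sobolev_norm n v / torus_factor TYPE('a)"
    using False by (intro L2_set_le_sobolev_norm v) auto
  also have "\<dots> \<le> sobolev_norm n v"
    using torus_factor_ge_1[where 'd = 'a] sobolev_norm_nonneg[OF v]
    by (intro divide_le_eq[THEN iffD2]) (auto simp: mult_le_cancel_left1)
  finally show ?thesis .
qed

text \<open>A single term of a convergent series is at most the sum; the factor \<open>2\<^sup>m\<close> pays for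
\<open>1 + \<bar>k\<bar> \<le> 2 \<bar>k\<bar>\<close> at nonzero frequencies.\<close>

lemma decays_sobolev:
  assumes v: "v \<in> sobolev_space (real m)"
  shows "decays m (2 ^ m * sobolev_norm (real m) v) v"
  unfolding decays_def
proof
  fix k
  show "norm (fcoeff v k) * weight k ^ m \<le> 2 ^ m * sobolev_norm (real m) v"
  proof (cases "k = 0")
    case True
    then show ?thesis using solenoidal_sobolev[OF v] sobolev_norm_nonneg[OF v] by (simp add: solenoidal_def)
  next
    case False
    have "weight k \<le> 2 * norm (freq k)"
      using norm_freq_ge_1[OF False] by (simp add: weight_def)
    then have "weight k ^ m \<le> 2 ^ m * norm (freq k) ^ m"
      by (metis power_mono power_mult_distrib weight_pos(2))
    then have "norm (fcoeff v k) * weight k ^ m \<le> 2 ^ m * sobolev_coeff (real m) v k"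
      using False mult_left_mono[of "weight k ^ m" "2 ^ m * norm (freq k) ^ m" "norm (fcoeff v k)"]
      by (simp add: sobolev_coeff_def powr_realpow algebra_simps)
    also have "\<dots> \<le> 2 ^ m * sobolev_norm (real m) v"
      by (intro mult_left_mono sobolev_coeff_le_norm v) simp
    finally show ?thesis .
  qed
qed

abbreviation lattice_sum :: "'d::finite itself \<Rightarrow> real" where
  "lattice_sum _ \<equiv> \<Sum>\<^sub>\<infinity>k :: int ^ 'd. inverse (weight k ^ (2 * CARD('d)))"

lemma lattice_sum_nonneg: "0 \<le> lattice_sum TYPE('d::finite)"
  by (intro infsum_nonneg) simp

text \<open>The surplus \<open>CARD('d)\<close> in the exponent leaves the factor \<open>inverse (weight k ^ CARD('d))\<close> in
each coefficient, which is square summable over the lattice by \<open>summable_on_weight\<close>.\<close>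

lemma sobolev_decays:
  assumes v: "solenoidal (v :: 'd::finite tdist)" and dec: "decays (N + CARD('d)) M v" and n: "n \<le> real N"
  shows "v \<in> sobolev_space n \<and>
    sobolev_norm n v \<le> torus_factor TYPE('d) * (M * sqrt (lattice_sum TYPE('d)))"
proof (rule sobolev_normI[OF v])
  let ?q = "CARD('d)"
  have M: "0 \<le> M" using dec unfolding decays_def
    by (meson mult_nonneg_nonneg norm_ge_zero order_trans weight_pos(2) zero_le_power)
  fix F :: "(int ^ 'd) set" assume F: "finite F" "0 \<notin> F"
  have "sobolev_coeff n v k \<le> M * inverse (weight k ^ ?q)" if "k \<in> F" for k
  proof -
    have k: "1 \<le> norm (freq k)" using that F norm_freq_ge_1[of k] by blast
    have "norm (freq k) powr n \<le> norm (freq k) powr real N"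
      using k n by (intro powr_mono) auto
    also have "\<dots> = norm (freq k) ^ N" using k by (intro powr_realpow) linarith
    also have "\<dots> \<le> weight k ^ N" by (intro power_mono) (auto simp: weight_def)
    finally have "sobolev_coeff n v k \<le> weight k ^ N * norm (fcoeff v k)"
      unfolding sobolev_coeff_def by (intro mult_right_mono) auto
    also have "\<dots> = norm (fcoeff v k) * weight k ^ (N + ?q) * inverse (weight k ^ ?q)"
      by (simp add: power_add)
    also have "\<dots> \<le> M * inverse (weight k ^ ?q)"
      using dec by (intro mult_right_mono) (auto simp: decays_def)
    finally show ?thesis .
  qed
  then have "L2_set (sobolev_coeff n v) F \<le> L2_set (\<lambda>k. M * inverse (weight k ^ ?q)) F"
    by (intro L2_set_mono) auto
  also have "\<dots> = M * L2_set (\<lambda>k. inverse (weight k ^ ?q)) F"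
    using M by (rule L2_set_right_distrib[symmetric])
  also have "L2_set (\<lambda>k. inverse (weight k ^ ?q)) F \<le> sqrt (lattice_sum TYPE('d))"
  proof -
    have "(\<Sum>k\<in>F. (inverse (weight k ^ ?q))\<^sup>2) = (\<Sum>k\<in>F. inverse (weight k ^ (2 * ?q)))"
      by (intro sum.cong) (auto simp: power_inverse power_mult[symmetric] mult.commute)
    also have "\<dots> \<le> lattice_sum TYPE('d)"
      using F by (intro finite_sum_le_infsum summable_on_weight) auto
    finally show ?thesis by (simp add: L2_set_def)
  qed
  finally show "L2_set (sobolev_coeff n v) F \<le> M * sqrt (lattice_sum TYPE('d))"
    using M by (simp add: mult_left_mono)
qed

lemma smooth_space_iff: "v \<in> smooth_space \<longleftrightarrow> solenoidal v \<and> (\<forall>m. \<exists>M. decays m M v)"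
proof safe
  assume v: "v \<in> smooth_space"
  then have "v \<in> sobolev_space 0" by (simp add: smooth_space_def)
  then show "solenoidal v" by (rule solenoidal_sobolev)
  show "\<exists>M. decays m M v" for m
    using v by (auto simp: smooth_space_def intro!: exI decays_sobolev)
next
  assume v: "solenoidal v" "\<forall>m. \<exists>M. decays m M v"
  show "v \<in> smooth_space"
    unfolding smooth_space_def
  proof
    fix n :: real
    obtain N where "n \<le> real N" using real_arch_simple by blast
    then show "v \<in> sobolev_space n" using sobolev_decays v by metis
  qed
qed

lemma smooth_sobolev: "v \<in> smooth_space \<Longrightarrow> v \<in> sobolev_space n"
  by (simp add: smooth_space_def)

lemma smooth_solenoidal: "v \<in> smooth_space \<Longrightarrow> solenoidal v"
  by (simp add: smooth_space_iff)

lemma smooth_space_intros [intro]: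
  "v \<in> smooth_space \<Longrightarrow> w \<in> smooth_space \<Longrightarrow> v + w \<in> smooth_space"
  "v \<in> smooth_space \<Longrightarrow> w \<in> smooth_space \<Longrightarrow> v - w \<in> smooth_space"
  "v \<in> smooth_space \<Longrightarrow> - v \<in> smooth_space"
  "v \<in> smooth_space \<Longrightarrow> c *\<^sub>R v \<in> smooth_space"
  "0 \<in> smooth_space"
proof -
  show *: "v \<in> smooth_space \<Longrightarrow> w \<in> smooth_space \<Longrightarrow> v + w \<in> smooth_space"
    and **: "v \<in> smooth_space \<Longrightarrow> c *\<^sub>R v \<in> smooth_space" for c and v w :: "'a tdist"
    by (simp_all add: smooth_space_def sobolev_norm_triangle sobolev_norm_scaleR)
  show ***: "v \<in> smooth_space \<Longrightarrow> - v \<in> smooth_space" for v :: "'a tdist"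
    using **[of v "- 1"] by simp
  show "v \<in> smooth_space \<Longrightarrow> w \<in> smooth_space \<Longrightarrow> v - w \<in> smooth_space"
    unfolding minus_tdist_def by (intro * ***)
  show "0 \<in> smooth_space" by (simp add: smooth_space_def sobolev_space_0)
qed

lemma smooth_space_sum: "(\<And>i. i \<in> A \<Longrightarrow> f i \<in> smooth_space) \<Longrightarrow> sum f A \<in> smooth_space"
  by (simp add: smooth_space_def sobolev_norm_sum)

section \<open>Fourier series on the torus\<close>

abbreviation torus_box :: "(real ^ 'd::finite) set" where
  "torus_box \<equiv> cbox 0 (\<chi> r. 2 * pi)"

lemma norm_wave [simp]: "norm (wave k x) = 1"
  by (simp add: wave_def)

lemma wave_add: "wave (k + h) x = wave k x * wave h x"
  by (simp add: wave_def freq_add inner_add_left cis_mult)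

lemma continuous_on_wave [continuous_intros]: "continuous_on A (wave k)"
  unfolding wave_def by (intro continuous_intros)

lemma integral_cis_period:
  "integral {0..2 * pi} (\<lambda>t. cis (of_int m * t)) = (if m = 0 then of_real (2 * pi) else 0)"
proof (cases "m = 0")
  case True
  then show ?thesis by (simp add: scaleR_conv_of_real)
next
  case False
  let ?F = "\<lambda>t. cis (of_int m * t) / (\<i> * of_int m)"
  have "(?F has_vector_derivative cis (of_int m * t)) (at t within {0..2 * pi})" for t
  proof -
    have "((\<lambda>z. exp (\<i> * of_int m * z) / (\<i> * of_int m)) has_field_derivative
        exp (\<i> * of_int m * of_real t)) (at (of_real t))"
      using False by (auto intro!: derivative_eq_intros)
    from has_vector_derivative_real_field[OF this] show ?thesis
      by (simp add: cis_conv_exp mult.assoc)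
  qed
  then have "((\<lambda>t. cis (of_int m * t)) has_integral (?F (2 * pi) - ?F 0)) {0..2 * pi}"
    by (intro fundamental_theorem_of_calculus) auto
  moreover have "?F (2 * pi) = ?F 0"
  proof -
    have "cis (of_int m * (2 * pi)) = 1"
      using cis_multiple_2pi[of "of_int m"] by (simp add: mult.commute mult.left_commute)
    then show ?thesis by simp
  qed
  ultimately show ?thesis using False by (simp add: integral_unique)
qed

lemma set_integral_cis_period:
  "integral\<^sup>L lborel (\<lambda>t. indicator {0..2 * pi} t *\<^sub>R cis (of_int m * t)) =
     (if m = 0 then of_real (2 * pi) else 0)"
proof -
  have "set_integrable lborel {0..2 * pi} (\<lambda>t. cis (of_int m * t))"
    by (intro borel_integrable_atLeastAtMost' continuous_intros)
  then show ?thesis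
    using set_borel_integral_eq_integral(2)[of "{0..2 * pi}" "\<lambda>t. cis (of_int m * t)"]
    by (simp add: set_lebesgue_integral_def integral_cis_period)
qed

text \<open>The wave is a product of functions of one coordinate each, and Lebesgue measure is a product
measure, so the integral is a product of integrals over one period.\<close>

lemma integral_wave:
  "integral torus_box (wave (k :: int ^ 'd::finite)) = (if k = 0 then of_real ((2 * pi) ^ CARD('d)) else 0)"
proof -
  let ?g = "\<lambda>(b :: real ^ 'd) (t :: real). indicator {0..2 * pi} t *\<^sub>R cis (freq k \<bullet> b * t)"
  have inner_Basis: "x \<bullet> (\<Sum>b\<in>Basis. f b *\<^sub>R b) = (\<Sum>b\<in>Basis. (x \<bullet> b) * f b)"
    for x :: "real ^ 'd" and f
    by (simp add: inner_sum_right mult.commute)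
  have ind: "indicator torus_box (\<Sum>b\<in>Basis. f b *\<^sub>R b :: real ^ 'd) =
      (\<Prod>b\<in>Basis. indicator {0..2 * pi} (f b) :: real)" for f
  proof -
    have "(\<Sum>b\<in>Basis. f b *\<^sub>R b) \<in> (torus_box :: (real ^ 'd) set) \<longleftrightarrow> (\<forall>b\<in>Basis. f b \<in> {0..2 * pi})"
    proof -
      have "(\<chi> r. 2 * pi) \<bullet> b = 2 * pi" if "b \<in> Basis" for b :: "real ^ 'd"
        using that by (auto simp: Basis_vec_def inner_axis)
      then show ?thesis by (auto simp: mem_box)
    qed
    then show ?thesis
      by (auto simp: indicator_def prod_zero_iff)
  qed
  have wave_prod: "wave k (\<Sum>b\<in>Basis. f b *\<^sub>R b) = (\<Prod>b\<in>Basis. cis (freq k \<bullet> b * f b))" for f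
    unfolding wave_def inner_Basis by (simp add: cis_conv_exp sum_distrib_left exp_sum)
  have "integral torus_box (wave k) = (LINT x:torus_box|lborel. wave k x)"
    by (rule set_borel_integral_eq_integral(2)[symmetric])
      (unfold set_integrable_def, intro borel_integrable_compact continuous_intros compact_cbox)
  also have "\<dots> = (\<integral>x. (\<Prod>b\<in>Basis. ?g b (x b)) \<partial>(\<Pi>\<^sub>M b\<in>Basis. lborel))"
    unfolding set_lebesgue_integral_def
    apply (subst lborel_eq)
    apply (subst integral_distr)
      apply measurable
     apply (intro borel_measurable_scaleR borel_measurable_indicator borel_measurable_continuous_onI continuous_intros)
    by (simp only: ind wave_prod) (simp add: prod.distrib scaleR_conv_of_real)
  also have "\<dots> = (\<Prod>b\<in>Basis. integral\<^sup>L lborel (?g b))"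
  proof -
    interpret product_sigma_finite "\<lambda>_ :: real ^ 'd. lborel :: real measure" ..
    have "set_integrable lborel {0..2 * pi} (\<lambda>t. cis (freq k \<bullet> b * t))" for b
      by (intro borel_integrable_atLeastAtMost' continuous_intros)
    then show ?thesis
      by (intro product_integral_prod) (auto simp: set_integrable_def)
  qed
  also have "\<dots> = (\<Prod>r\<in>UNIV. integral\<^sup>L lborel (?g (axis r 1)))"
  proof -
    have basis: "(Basis :: (real ^ 'd) set) = (\<lambda>r. axis r 1) ` UNIV" by (auto simp: Basis_vec_def)
    have inj: "inj (\<lambda>r :: 'd. axis r (1 :: real))" by (simp add: inj_on_def axis_eq_axis)
    show ?thesis unfolding basis prod.reindex[OF inj] o_def ..
  qed
  also have "\<dots> = (\<Prod>r\<in>(UNIV :: 'd set). if k $ r = 0 then of_real (2 * pi) else 0)"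
    by (intro prod.cong) (simp_all add: inner_axis freq_def set_integral_cis_period)
  also have "\<dots> = (if k = 0 then of_real ((2 * pi) ^ CARD('d)) else 0)"
    by (auto simp: vec_eq_iff)
  finally show ?thesis .
qed

text \<open>The M-test makes the partial sums converge uniformly, along the filter of finite sets of
frequencies; so the sum is continuous and may be integrated termwise.\<close>

lemma
  fixes c :: "int ^ 'd::finite \<Rightarrow> complex"
  assumes c: "(\<lambda>h. norm (c h)) summable_on UNIV"
  shows continuous_on_wave_series: "continuous_on torus_box (\<lambda>x. \<Sum>\<^sub>\<infinity>h. wave h x * c h)" (is ?cont)
    and has_sum_integral_wave_series: "continuous_on torus_box g \<Longrightarrow>
      ((\<lambda>h. c h * integral torus_box (\<lambda>x. wave h x * g x)) has_sum
        integral torus_box (\<lambda>x. (\<Sum>\<^sub>\<infinity>h. wave h x * c h) * g x)) UNIV"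
proof -
  let ?F = "finite_subsets_at_top (UNIV :: (int ^ 'd) set)"
  have "uniform_limit torus_box (\<lambda>X x. \<Sum>h\<in>X. wave h x * c h) (\<lambda>x. \<Sum>\<^sub>\<infinity>h. wave h x * c h) ?F"
    by (rule Weierstrass_m_test_general[OF _ c]) (simp add: norm_mult)
  then show ?cont
    by (rule uniform_limit_theorem[rotated]) (auto intro!: always_eventually continuous_intros)
  assume g: "continuous_on torus_box g"
  then have "bounded (g ` torus_box)"
    by (intro compact_imp_bounded compact_continuous_image compact_cbox)
  then obtain G where G: "\<And>x. x \<in> torus_box \<Longrightarrow> norm (g x) \<le> G"
    by (auto simp: bounded_iff)
  have lim: "uniform_limit torus_box (\<lambda>X x. \<Sum>h\<in>X. wave h x * c h * g x)
      (\<lambda>x. (\<Sum>\<^sub>\<infinity>h. wave h x * c h) * g x) ?F"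
    unfolding infsum_cmult_left'[symmetric]
  proof (rule Weierstrass_m_test_general)
    show "(\<lambda>h. norm (c h) * G) summable_on UNIV" by (intro summable_on_cmult_left c)
    show "norm (wave h x * c h * g x) \<le> norm (c h) * G" if "x \<in> torus_box" for h and x :: "real ^ 'd"
      using G[OF that] by (simp add: norm_mult mult_left_mono)
  qed
  obtain I J where I: "\<And>X. ((\<lambda>x. \<Sum>h\<in>X. wave h x * c h * g x) has_integral I X) torus_box"
    and J: "((\<lambda>x. (\<Sum>\<^sub>\<infinity>h. wave h x * c h) * g x) has_integral J) torus_box"
    and IJ: "(I \<longlongrightarrow> J) ?F"
  proof -
    have "continuous_on torus_box (\<lambda>x. \<Sum>h\<in>X. wave h x * c h * g x)" for X
      by (intro continuous_intros g)
    from uniform_limit_integral_cbox[OF lim this finite_subsets_at_top_neq_bot] show ?thesis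
      using that by blast
  qed
  have "I = (\<lambda>X. \<Sum>h\<in>X. c h * integral torus_box (\<lambda>x. wave h x * g x))"
  proof
    fix X
    have "((\<lambda>x. wave h x * g x) has_integral integral torus_box (\<lambda>x. wave h x * g x)) torus_box" for h
      by (intro integrable_integral integrable_continuous continuous_intros g)
    from has_integral_mult_right[OF this]
    have *: "((\<lambda>x. c h * (wave h x * g x)) has_integral c h * integral torus_box (\<lambda>x. wave h x * g x)) torus_box" for h .
    have "((\<lambda>x. \<Sum>h\<in>X. c h * (wave h x * g x)) has_integral
        (\<Sum>h\<in>X. c h * integral torus_box (\<lambda>x. wave h x * g x))) torus_box"
    proof (cases "finite X")
      case True
      then show ?thesis using * by (intro has_integral_sum) auto
    qed simp
    then have "((\<lambda>x. \<Sum>h\<in>X. wave h x * c h * g x) has_integral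
        (\<Sum>h\<in>X. c h * integral torus_box (\<lambda>x. wave h x * g x))) torus_box"
      by (simp add: mult_ac)
    then show "I X = (\<Sum>h\<in>X. c h * integral torus_box (\<lambda>x. wave h x * g x))"
      by (rule has_integral_unique[OF I])
  qed
  then show "((\<lambda>h. c h * integral torus_box (\<lambda>x. wave h x * g x)) has_sum
        integral torus_box (\<lambda>x. (\<Sum>\<^sub>\<infinity>h. wave h x * c h) * g x)) UNIV"
    using IJ integral_unique[OF J] unfolding has_sum_def by simp
qed

lemma has_sum_single:
  fixes f :: "'a \<Rightarrow> 'b :: {comm_monoid_add, topological_space}"
  assumes "\<And>x. x \<noteq> a \<Longrightarrow> f x = 0"
  shows "(f has_sum f a) UNIV"
proof -
  have "(f has_sum f a) {a}" by (intro has_sum_finiteI) auto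
  then show ?thesis
    by (rule has_sum_cong_neutral[THEN iffD1, rotated -1]) (use assms in auto)
qed

text \<open>The Fourier coefficients of a product are the convolution of the coefficients. Both series
are integrated termwise, one after the other; for a fixed term of the first one, orthogonality
leaves the single term \<open>b (k - h)\<close> of the second one.\<close>

lemma has_sum_fourier_coeff_product:
  fixes a b :: "int ^ 'd::finite \<Rightarrow> complex"
  assumes a: "(\<lambda>h. norm (a h)) summable_on UNIV" and b: "(\<lambda>h. norm (b h)) summable_on UNIV"
  shows "((\<lambda>h. a h * b (k - h)) has_sum
    (1 / (2 * pi) ^ CARD('d)) *\<^sub>R integral torus_box (\<lambda>x. wave (- k) x *
      ((\<Sum>\<^sub>\<infinity>h. wave h x * a h) * (\<Sum>\<^sub>\<infinity>h. wave h x * b h)))) UNIV"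
proof -
  let ?A = "\<lambda>x. \<Sum>\<^sub>\<infinity>h. wave h x * a h" and ?B = "\<lambda>x. \<Sum>\<^sub>\<infinity>h. wave h x * b h"
  let ?V = "(2 * pi) ^ CARD('d) :: real"
  have coeff: "integral torus_box (\<lambda>x. wave h x * (wave (- k) x * ?B x)) = ?V *\<^sub>R b (k - h)" for h
  proof -
    have int: "integral torus_box (\<lambda>x. wave l x * wave (h - k) x) = (if l = k - h then of_real ?V else 0)" for l
    proof -
      have "integral torus_box (\<lambda>x. wave l x * wave (h - k) x) = integral torus_box (wave (l + (h - k)))"
        by (intro integral_cong) (simp add: wave_add)
      also have "\<dots> = (if l + (h - k) = 0 then of_real ?V else 0)" by (rule integral_wave)
      finally show ?thesis by (simp add: algebra_simps)
    qed
    have "((\<lambda>l. b l * integral torus_box (\<lambda>x. wave l x * wave (h - k) x)) has_sum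
        integral torus_box (\<lambda>x. ?B x * wave (h - k) x)) UNIV"
      by (intro has_sum_integral_wave_series b continuous_intros)
    moreover have "((\<lambda>l. b l * integral torus_box (\<lambda>x. wave l x * wave (h - k) x)) has_sum
        b (k - h) * integral torus_box (\<lambda>x. wave (k - h) x * wave (h - k) x)) UNIV"
      by (rule has_sum_single) (simp add: int)
    ultimately have "integral torus_box (\<lambda>x. ?B x * wave (h - k) x) =
        b (k - h) * integral torus_box (\<lambda>x. wave (k - h) x * wave (h - k) x)"
      by (rule has_sum_unique)
    also have "\<dots> = ?V *\<^sub>R b (k - h)" by (simp add: int scaleR_conv_of_real)
    also have "integral torus_box (\<lambda>x. ?B x * wave (h - k) x) =
        integral torus_box (\<lambda>x. wave h x * (wave (- k) x * ?B x))"
      by (intro integral_cong) (simp add: mult_ac flip: wave_add)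
    finally show ?thesis .
  qed
  have "continuous_on torus_box (\<lambda>x. wave (- k) x * ?B x)"
    by (intro continuous_intros continuous_on_wave_series b)
  from has_sum_integral_wave_series[OF a this]
  have "((\<lambda>h. a h * (?V *\<^sub>R b (k - h))) has_sum
      integral torus_box (\<lambda>x. ?A x * (wave (- k) x * ?B x))) UNIV"
    by (simp only: coeff)
  then have "((\<lambda>h. (1 / ?V) *\<^sub>R (a h * (?V *\<^sub>R b (k - h)))) has_sum
      (1 / ?V) *\<^sub>R integral torus_box (\<lambda>x. ?A x * (wave (- k) x * ?B x))) UNIV"
    by (rule has_sum_scaleR)
  moreover have "(1 / ?V) *\<^sub>R (a h * (?V *\<^sub>R b (k - h))) = a h * b (k - h)" for h
    by simp
  ultimately show ?thesis by (simp add: mult_ac)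
qed

section \<open>Convergence in the smooth topology\<close>

lemma topspace_smooth_topology: "topspace smooth_topology = smooth_space"
proof -
  have "w \<in> {w \<in> smooth_space. sobolev_norm 0 (w - w') < 1}" if "w \<in> smooth_space" "w' = w" for w w' :: "'a tdist"
    using that by (simp add: sobolev_norm_0)
  then have "w \<in> \<Union> {{w \<in> smooth_space. sobolev_norm n (w - v) < e} | n v e. v \<in> smooth_space \<and> e > 0}"
    if "w \<in> smooth_space" for w :: "'a tdist"
    using that zero_less_one by blast
  then show ?thesis
    unfolding smooth_topology_def topology_generated_by_topspace by blast
qed

text \<open>The generating sets of the topology are balls with arbitrary centres; by the triangle
inequality every one of them that contains \<open>l\<close> contains a ball around \<open>l\<close>.\<close>

lemma limitin_smooth_iff:
  "limitin smooth_topology f l F \<longleftrightarrow> l \<in> smooth_space \<and> (\<forall>\<^sub>F x in F. f x \<in> smooth_space) \<and>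
     (\<forall>n. ((\<lambda>x. sobolev_norm n (f x - l)) \<longlongrightarrow> 0) F)"
proof (intro iffI conjI allI; (elim conjE)?)
  assume lim: "limitin smooth_topology f l F"
  then show l: "l \<in> smooth_space"
    by (simp add: limitin_def topspace_smooth_topology)
  show ev: "\<forall>\<^sub>F x in F. f x \<in> smooth_space"
    using limitinD[OF lim openin_topspace] l by (simp add: topspace_smooth_topology)
  show "((\<lambda>x. sobolev_norm n (f x - l)) \<longlongrightarrow> 0) F" for n
  proof (rule tendstoI)
    fix e :: real assume e: "e > 0"
    have "openin smooth_topology {w \<in> smooth_space. sobolev_norm n (w - l) < e}"
      unfolding smooth_topology_def using l e by (intro topology_generated_by_Basis) blast
    from limitinD[OF lim this] have "\<forall>\<^sub>F x in F. f x \<in> smooth_space \<and> sobolev_norm n (f x - l) < e"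
      using l e by (simp add: sobolev_norm_0)
    then show "\<forall>\<^sub>F x in F. dist (sobolev_norm n (f x - l)) 0 < e"
    proof eventually_elim
      case (elim x)
      then have "0 \<le> sobolev_norm n (f x - l)"
        using l by (intro sobolev_norm_nonneg smooth_sobolev) blast
      with elim show ?case by simp
    qed
  qed
next
  assume l: "l \<in> smooth_space" and ev: "\<forall>\<^sub>F x in F. f x \<in> smooth_space"
    and lim: "\<forall>n. ((\<lambda>x. sobolev_norm n (f x - l)) \<longlongrightarrow> 0) F"
  have "\<forall>\<^sub>F x in F. f x \<in> U"
    if "generate_topology_on {{w \<in> smooth_space. sobolev_norm n (w - v) < e} | n v e. v \<in> smooth_space \<and> e > 0} U"
      "l \<in> U" for U
    using that
  proof (induction rule: generate_topology_on.induct)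
    case (Int a b)
    then show ?case by (auto simp: eventually_conj_iff)
  next
    case (UN K)
    then obtain k where "k \<in> K" "l \<in> k" by blast
    with UN have "\<forall>\<^sub>F x in F. f x \<in> k" by blast
    then show ?case by eventually_elim (use \<open>k \<in> K\<close> in blast)
  next
    case (Basis s)
    then obtain n v e where s: "s = {w \<in> smooth_space. sobolev_norm n (w - v) < e}" and v: "v \<in> smooth_space"
      by blast
    have "sobolev_norm n (l - v) < e" using Basis s by simp
    then have "\<forall>\<^sub>F x in F. sobolev_norm n (f x - l) < e - sobolev_norm n (l - v)"
      using lim by (intro order_tendstoD(2)[where y = 0]) auto
    with ev show ?case
    proof eventually_elim
      case (elim x)
      have "sobolev_norm n ((f x - l) + (l - v)) \<le> sobolev_norm n (f x - l) + sobolev_norm n (l - v)"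
        using sobolev_norm_triangle[of "f x - l" n "l - v"] elim l v by (blast intro: smooth_sobolev)
      then show ?case using elim s by simp
    qed
  qed simp
  then show "limitin smooth_topology f l F"
    unfolding limitin_def topspace_smooth_topology using l
    by (simp add: smooth_topology_def openin_topology_generated_by_iff)
qed

lemma limitin_smoothI:
  assumes "l \<in> smooth_space" and "\<forall>\<^sub>F x in F. f x \<in> smooth_space"
    and bound: "\<And>n. \<exists>g. (\<forall>\<^sub>F x in F. sobolev_norm n (f x - l) \<le> g x) \<and> (g \<longlongrightarrow> 0) F"
  shows "limitin smooth_topology f l F"
  unfolding limitin_smooth_iff
proof (intro conjI allI assms)
  fix n
  obtain g where g: "\<forall>\<^sub>F x in F. sobolev_norm n (f x - l) \<le> g x" "(g \<longlongrightarrow> 0) F"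
    using bound by blast
  have "\<forall>\<^sub>F x in F. 0 \<le> sobolev_norm n (f x - l)"
    using assms(2) by eventually_elim (use assms(1) in \<open>auto intro!: sobolev_norm_nonneg smooth_sobolev\<close>)
  then show "((\<lambda>x. sobolev_norm n (f x - l)) \<longlongrightarrow> 0) F"
    by (rule tendsto_sandwich[OF _ g(1) tendsto_const g(2)])
qed

lemma limitin_smoothD:
  assumes "limitin smooth_topology f l F"
  shows "l \<in> smooth_space" "\<forall>\<^sub>F x in F. f x \<in> smooth_space"
    "((\<lambda>x. sobolev_norm n (f x - l)) \<longlongrightarrow> 0) F"
  using assms by (auto simp: limitin_smooth_iff)

text \<open>A coefficient is bounded by the Sobolev norm of order \<open>0\<close>. The uniqueness of limits, and
with it the meaning of \<open>time_deriv\<close> and \<open>time_integral\<close>, rests on this.\<close>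

lemma limitin_fcoeff:
  assumes lim: "limitin smooth_topology f l F"
  shows "((\<lambda>x. fcoeff (f x) k) \<longlongrightarrow> fcoeff l k) F"
proof -
  have "\<forall>\<^sub>F x in F. norm (fcoeff (f x) k - fcoeff l k) \<le> sobolev_norm 0 (f x - l)"
    using limitin_smoothD(2)[OF lim]
  proof eventually_elim
    case (elim x)
    then have sm: "f x - l \<in> smooth_space" using limitin_smoothD(1)[OF lim] by blast
    have "norm (fcoeff (f x - l) k) = sobolev_coeff 0 (f x - l) k"
      using smooth_solenoidal[OF sm] by (cases "k = 0") (simp_all only: sobolev_coeff_def solenoidal_def, simp_all)
    also have "\<dots> \<le> sobolev_norm 0 (f x - l)"
      by (intro sobolev_coeff_le_norm smooth_sobolev sm)
    finally show ?case by simp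
  qed
  then have "((\<lambda>x. fcoeff (f x) k - fcoeff l k) \<longlongrightarrow> 0) F"
    by (rule Lim_null_comparison) (rule limitin_smoothD(3)[OF lim])
  then show ?thesis by (simp add: LIM_zero_iff)
qed

lemma limitin_smooth_unique:
  assumes "F \<noteq> bot" "limitin smooth_topology f l F" "limitin smooth_topology f l' F"
  shows "l = l'"
  by (rule tdist_eqI) (rule tendsto_unique[OF assms(1) limitin_fcoeff[OF assms(2)] limitin_fcoeff[OF assms(3)]])

lemma limitin_smooth_cong:
  assumes "limitin smooth_topology f l F" "\<forall>\<^sub>F x in F. f x = g x"
  shows "limitin smooth_topology g l F"
  by (rule limitin_transform_eventually[OF assms(2,1)])

lemma limitin_smooth_add:
  assumes f: "limitin smooth_topology f l F" and g: "limitin smooth_topology g m F"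
  shows "limitin smooth_topology (\<lambda>x. f x + g x) (l + m) F"
proof (rule limitin_smoothI)
  note fD = limitin_smoothD[OF f] and gD = limitin_smoothD[OF g]
  show "l + m \<in> smooth_space" using fD(1) gD(1) by blast
  show "\<forall>\<^sub>F x in F. f x + g x \<in> smooth_space" using fD(2) gD(2) by eventually_elim blast
  fix n
  have "((\<lambda>x. sobolev_norm n (f x - l) + sobolev_norm n (g x - m)) \<longlongrightarrow> 0 + 0) F"
    by (intro tendsto_add fD(3) gD(3))
  moreover have "\<forall>\<^sub>F x in F. sobolev_norm n (f x + g x - (l + m)) \<le> sobolev_norm n (f x - l) + sobolev_norm n (g x - m)"
    using fD(2) gD(2)
  proof eventually_elim
    case (elim x)
    have "f x + g x - (l + m) = (f x - l) + (g x - m)" by simp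
    moreover have "sobolev_norm n ((f x - l) + (g x - m)) \<le> sobolev_norm n (f x - l) + sobolev_norm n (g x - m)"
    proof -
      have "f x - l \<in> sobolev_space n" "g x - m \<in> sobolev_space n"
        using elim fD(1) gD(1) by (simp_all add: smooth_sobolev smooth_space_intros(2))
      then show ?thesis by (simp only: sobolev_norm_triangle)
    qed
    ultimately show ?case by (simp only:)
  qed
  ultimately show "\<exists>h. (\<forall>\<^sub>F x in F. sobolev_norm n (f x + g x - (l + m)) \<le> h x) \<and> (h \<longlongrightarrow> 0) F"
    by (intro exI[of _ "\<lambda>x. sobolev_norm n (f x - l) + sobolev_norm n (g x - m)"]) simp
qed

lemma limitin_smooth_scaleR:
  assumes c: "(c \<longlongrightarrow> a) F" and f: "limitin smooth_topology f l F"
  shows "limitin smooth_topology (\<lambda>x. c x *\<^sub>R f x) (a *\<^sub>R l) F"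
proof (rule limitin_smoothI)
  note fD = limitin_smoothD[OF f]
  show "a *\<^sub>R l \<in> smooth_space" using fD(1) by blast
  show "\<forall>\<^sub>F x in F. c x *\<^sub>R f x \<in> smooth_space" using fD(2) by eventually_elim blast
  fix n
  have "((\<lambda>x. \<bar>c x\<bar> * sobolev_norm n (f x - l) + \<bar>c x - a\<bar> * sobolev_norm n l) \<longlongrightarrow>
      \<bar>a\<bar> * 0 + \<bar>a - a\<bar> * sobolev_norm n l) F"
    by (intro tendsto_intros c fD(3))
  moreover have "\<forall>\<^sub>F x in F. sobolev_norm n (c x *\<^sub>R f x - a *\<^sub>R l) \<le>
      \<bar>c x\<bar> * sobolev_norm n (f x - l) + \<bar>c x - a\<bar> * sobolev_norm n l"
    using fD(2)
  proof eventually_elim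
    case (elim x)
    \<comment> \<open>Only the second summand involves the change of the scalar.\<close>
    have eq: "c x *\<^sub>R f x - a *\<^sub>R l = c x *\<^sub>R (f x - l) + (c x - a) *\<^sub>R l" by (simp add: algebra_simps)
    have d: "f x - l \<in> sobolev_space n" "l \<in> sobolev_space n"
      using elim fD(1) by (simp_all add: smooth_sobolev smooth_space_intros(2))
    note s = sobolev_norm_scaleR[OF d(1), of "c x"] sobolev_norm_scaleR[OF d(2), of "c x - a"]
    show ?case
      unfolding eq using sobolev_norm_triangle[of "c x *\<^sub>R (f x - l)" n "(c x - a) *\<^sub>R l"] s by linarith
  qed
  ultimately show "\<exists>h. (\<forall>\<^sub>F x in F. sobolev_norm n (c x *\<^sub>R f x - a *\<^sub>R l) \<le> h x) \<and> (h \<longlongrightarrow> 0) F"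
    by (intro exI[of _ "\<lambda>x. \<bar>c x\<bar> * sobolev_norm n (f x - l) + \<bar>c x - a\<bar> * sobolev_norm n l"]) simp
qed

lemma limitin_smooth_const: "l \<in> smooth_space \<Longrightarrow> limitin smooth_topology (\<lambda>_. l) l F"
  by (simp add: topspace_smooth_topology)

lemma decays_mono: "decays m M v \<Longrightarrow> M \<le> M' \<Longrightarrow> decays m M' v"
  unfolding decays_def by (meson order_trans)

lemma decays_add: "decays m M v \<Longrightarrow> decays m M' w \<Longrightarrow> decays m (M + M') (v + w)"
  unfolding decays_def
proof
  fix k assume v: "\<forall>k. norm (fcoeff v k) * weight k ^ m \<le> M" and w: "\<forall>k. norm (fcoeff w k) * weight k ^ m \<le> M'"
  then have "norm (fcoeff v k) * weight k ^ m + norm (fcoeff w k) * weight k ^ m \<le> M + M'"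
    by (intro add_mono) blast+
  moreover have "norm (fcoeff (v + w) k) * weight k ^ m \<le>
      norm (fcoeff v k) * weight k ^ m + norm (fcoeff w k) * weight k ^ m"
    unfolding distrib_right[symmetric] by (intro mult_right_mono) (auto intro: norm_triangle_ineq)
  ultimately show "norm (fcoeff (v + w) k) * weight k ^ m \<le> M + M'" by linarith
qed

lemma decays_scaleR: "decays m M v \<Longrightarrow> decays m (\<bar>c\<bar> * M) (c *\<^sub>R v)"
  unfolding decays_def by (auto simp: mult.assoc intro!: mult_left_mono)

lemma decays_uminus: "decays m M v \<Longrightarrow> decays m M (- v)"
  unfolding decays_def by simp

lemma decays_nonneg: "decays m M v \<Longrightarrow> 0 \<le> M"
  unfolding decays_def by (meson mult_nonneg_nonneg norm_ge_zero order_trans weight_pos(2) zero_le_power)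

text \<open>The property of Montel. A bound for the weight of order \<open>m + 1\<close> makes the coefficients with
the weight of order \<open>m\<close> uniformly small at high frequencies, and only finitely many low
frequencies remain, where convergence of each coefficient suffices. The limit family inherits
decay, symmetry and vanishing divergence, so it belongs to a smooth field.\<close>

lemma limitin_smooth_of_fcoeff_bounded:
  fixes f :: "'a \<Rightarrow> 'd::finite tdist"
  assumes F: "F \<noteq> bot" and sm: "\<forall>\<^sub>F x in F. f x \<in> smooth_space"
    and bdd: "\<And>m. \<exists>M. \<forall>\<^sub>F x in F. decays m M (f x)"
    and lim: "\<And>k. ((\<lambda>x. fcoeff (f x) k) \<longlongrightarrow> l k) F"
  obtains v where "v \<in> smooth_space" "\<And>k. fcoeff v k = l k" "limitin smooth_topology f v F"
proof -
  have decay_l: "\<exists>M. \<forall>k. norm (l k) * weight k ^ m \<le> M" for m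
  proof -
    obtain M where "\<forall>\<^sub>F x in F. decays m M (f x)" using bdd by blast
    then have "norm (l k) * weight k ^ m \<le> M" for k
      by (intro tendsto_upperbound[OF _ _ F, of "\<lambda>x. norm (fcoeff (f x) k) * weight k ^ m"]
          tendsto_intros lim) (auto elim!: eventually_mono simp: decays_def)
    then show ?thesis by blast
  qed
  have "l (- k) = vcnj (l k)" for k
  proof (rule tendsto_unique[OF F lim])
    have "((\<lambda>x. vcnj (fcoeff (f x) k)) \<longlongrightarrow> vcnj (l k)) F"
      unfolding vcnj_def by (intro tendsto_intros lim)
    then show "((\<lambda>x. fcoeff (f x) (- k)) \<longlongrightarrow> vcnj (l k)) F" by (simp add: fcoeff_uminus_freq)
  qed
  moreover have "slow_growth l"
    using decay_l[of 0] unfolding slow_growth_def by (metis mult.right_neutral power_0)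
  ultimately have coeff: "fcoeff (Tdist l) k = l k" for k
    by (simp add: Tdist_inverse)
  have "cdot (cfreq k) (l k) = 0" for k
  proof (rule tendsto_unique[OF F])
    show "((\<lambda>x. cdot (cfreq k) (fcoeff (f x) k)) \<longlongrightarrow> cdot (cfreq k) (l k)) F"
      unfolding cdot_def by (intro tendsto_intros lim)
    show "((\<lambda>x. cdot (cfreq k) (fcoeff (f x) k)) \<longlongrightarrow> 0) F"
      using sm by (intro tendsto_eventually) (auto elim!: eventually_mono simp: smooth_space_iff solenoidal_def)
  qed
  moreover have "l 0 = 0"
  proof (rule tendsto_unique[OF F lim])
    show "((\<lambda>x. fcoeff (f x) 0) \<longlongrightarrow> 0) F"
      using sm by (intro tendsto_eventually) (auto elim!: eventually_mono simp: smooth_space_iff solenoidal_def)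
  qed
  ultimately have smooth: "Tdist l \<in> smooth_space"
    using decay_l by (simp add: smooth_space_iff solenoidal_def decays_def coeff)
  have small: "\<forall>\<^sub>F x in F. decays m e (f x - Tdist l)" if e: "e > 0" for m and e :: real
  proof -
    obtain M where M: "\<forall>\<^sub>F x in F. decays (Suc m) M (f x)" using bdd by blast
    obtain L where L: "\<And>k. norm (l k) * weight k ^ Suc m \<le> L" using decay_l by blast
    \<comment> \<open>Outside \<open>?K\<close> the bounds \<open>M\<close> and \<open>L\<close> already force the weighted difference below \<open>e\<close>.\<close>
    let ?K = "{k :: int ^ 'd. weight k \<le> (M + L) / e}"
    have "\<forall>k\<in>?K. \<forall>\<^sub>F x in F. norm (fcoeff (f x) k - l k) * weight k ^ m < e"
    proof
      fix k
      have "((\<lambda>x. norm (fcoeff (f x) k - l k) * weight k ^ m) \<longlongrightarrow> norm (l k - l k) * weight k ^ m) F"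
        by (intro tendsto_intros lim)
      then show "\<forall>\<^sub>F x in F. norm (fcoeff (f x) k - l k) * weight k ^ m < e"
        using e by (intro order_tendstoD) auto
    qed
    then have "\<forall>\<^sub>F x in F. \<forall>k\<in>?K. norm (fcoeff (f x) k - l k) * weight k ^ m < e"
      by (rule eventually_ball_finite[OF finite_weight_le])
    with M show ?thesis
    proof eventually_elim
      case (elim x)
      have "norm (fcoeff (f x) k - l k) * weight k ^ m \<le> e" for k
      proof (cases "k \<in> ?K")
        case True
        then show ?thesis using elim by (intro less_imp_le) blast
      next
        case False
        then have large: "(M + L) \<le> e * weight k" using e by (simp add: field_simps)
        have "norm (fcoeff (f x) k - l k) * weight k ^ Suc m \<le>
            norm (fcoeff (f x) k) * weight k ^ Suc m + norm (l k) * weight k ^ Suc m"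
          unfolding distrib_right[symmetric] by (intro mult_right_mono) (auto intro: norm_triangle_ineq4)
        also have "\<dots> \<le> M + L" using elim(1) L by (intro add_mono) (auto simp: decays_def)
        also note large
        finally have "(norm (fcoeff (f x) k - l k) * weight k ^ m) * weight k \<le> e * weight k"
          by (simp only: power_Suc2 mult.assoc)
        then show ?thesis by (rule mult_right_le_imp_le) simp
      qed
      then show ?case by (simp add: decays_def coeff)
    qed
  qed
  have "limitin smooth_topology f (Tdist l) F"
    unfolding limitin_smooth_iff
  proof (intro conjI allI smooth sm tendstoI)
    fix n e :: real assume e: "e > 0"
    obtain N where N: "n \<le> real N" using real_arch_simple by blast
    \<comment> \<open>Adding \<open>1\<close> makes the constant of \<open>sobolev_decays\<close> positive, so that one can divide by it.\<close>
    define C where "C = torus_factor TYPE('d) * sqrt (lattice_sum TYPE('d)) + 1"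
    have C: "C > 0" using lattice_sum_nonneg[where 'd = 'd] torus_factor_ge_1[where 'd = 'd]
      by (simp add: C_def add_nonneg_pos)
    have "\<forall>\<^sub>F x in F. decays (N + CARD('d)) (e / (2 * C)) (f x - Tdist l)"
      using e C by (intro small) simp
    with sm show "\<forall>\<^sub>F x in F. dist (sobolev_norm n (f x - Tdist l)) 0 < e"
    proof eventually_elim
      case (elim x)
      then have sol: "f x - Tdist l \<in> smooth_space" using smooth by blast
      have "sobolev_norm n (f x - Tdist l) \<le> (C - 1) * (e / (2 * C))"
        using sobolev_decays[OF smooth_solenoidal[OF sol] elim(2) N] by (simp add: C_def mult_ac)
      also have "\<dots> < e"
      proof -
        have "(C - 1) * (e / (2 * C)) < C * (e / C)"
          using e C by (intro mult_strict_mono) (auto simp: field_simps)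
        then show ?thesis using C by simp
      qed
      finally show ?case using sobolev_norm_nonneg[OF smooth_sobolev[OF sol]] by simp
    qed
  qed
  then show thesis using that smooth coeff by blast
qed

section \<open>The Navier-Stokes bilinear map on smooth fields\<close>

text \<open>The summand of the convolution: the product of \<open>\<i> (k - h) \<cdot> v\<^sub>h\<close>, which comes from the
derivative of \<open>w\<close> in the direction of \<open>v\<close>, and \<open>w\<close> at the frequency \<open>k - h\<close>.\<close>

definition advection_term :: "'d::finite tdist \<Rightarrow> 'd tdist \<Rightarrow> int ^ 'd \<Rightarrow> int ^ 'd \<Rightarrow> complex ^ 'd" where
  "advection_term v w k h = (\<i> * cdot (cfreq (k - h)) (fcoeff v h)) *s fcoeff w (k - h)"

text \<open>Enough for the Fourier series of the field and of its first derivatives to converge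
absolutely.\<close>

definition abs_summable :: "'d::finite tdist \<Rightarrow> bool" where
  "abs_summable v \<longleftrightarrow> (\<lambda>k. weight k * norm (fcoeff v k)) summable_on UNIV"

lemma abs_summable_fcoeff:
  assumes "abs_summable v"
  shows "(\<lambda>k. norm (fcoeff v k)) summable_on UNIV"
    and "(\<lambda>k. norm (fcoeff v k $ r)) summable_on UNIV"
    and "(\<lambda>k. norm (fcoeff (partial_deriv s v) k)) summable_on UNIV"
    and "(\<lambda>k. norm (fcoeff (partial_deriv s v) k $ r)) summable_on UNIV"
proof -
  note v = assms[unfolded abs_summable_def]
  show 1: "(\<lambda>k. norm (fcoeff v k)) summable_on UNIV"
  proof (rule summable_on_comparison_test[OF v])
    show "norm (fcoeff v k) \<le> weight k * norm (fcoeff v k)" for k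
      using weight_ge_1[of k] by (simp add: mult_le_cancel_right1)
  qed simp
  show 2: "(\<lambda>k. norm (fcoeff (partial_deriv s v) k)) summable_on UNIV"
  proof (rule summable_on_comparison_test[OF v])
    show "norm (fcoeff (partial_deriv s v) k) \<le> weight k * norm (fcoeff v k)" for k
    proof -
      have "fcoeff (partial_deriv s v) k = (\<i> * of_int (k $ s)) *s fcoeff v k"
        by (simp add: partial_deriv.rep_eq vec_eq_iff)
      then have "norm (fcoeff (partial_deriv s v) k) = \<bar>of_int (k $ s)\<bar> * norm (fcoeff v k)"
        by (simp add: norm_vec_scale norm_mult)
      also have "\<dots> \<le> weight k * norm (fcoeff v k)"
        using abs_component_le_freq[of k s] by (intro mult_right_mono) (auto simp: weight_def)
      finally show ?thesis .
    qed
  qed simp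
  show "(\<lambda>k. norm (fcoeff v k $ r)) summable_on UNIV"
    by (rule summable_on_comparison_test[OF 1]) (simp_all add: Finite_Cartesian_Product.norm_nth_le)
  show "(\<lambda>k. norm (fcoeff (partial_deriv s v) k $ r)) summable_on UNIV"
    by (rule summable_on_comparison_test[OF 2]) (simp_all add: Finite_Cartesian_Product.norm_nth_le)
qed

lemma value_at_component:
  assumes "(\<lambda>k. norm (fcoeff v k)) summable_on UNIV"
  shows "value_at v x $ r = (\<Sum>\<^sub>\<infinity>k. wave k x * fcoeff v k $ r)"
proof -
  have "(\<lambda>k. wave k x *s fcoeff v k) summable_on UNIV"
    by (rule abs_summable_summable) (simp add: norm_vec_scale assms)
  then have "((\<lambda>k. wave k x *s fcoeff v k) has_sum value_at v x) UNIV"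
    unfolding value_at_def by (rule has_sum_infsum)
  from has_sum_bounded_linear[OF bounded_linear_vec_nth[of r] this]
  show ?thesis by (simp add: infsumI)
qed

lemma has_sum_finite_sum:
  fixes f :: "'i \<Rightarrow> 'a \<Rightarrow> 'b :: topological_comm_monoid_add"
  assumes "\<And>i. i \<in> I \<Longrightarrow> (f i has_sum S i) A"
  shows "((\<lambda>x. \<Sum>i\<in>I. f i x) has_sum (\<Sum>i\<in>I. S i)) A"
  using assms by (induction I rule: infinite_finite_induct) (auto intro: has_sum_add)

lemma has_sum_vecI:
  fixes f :: "'a \<Rightarrow> 'b :: real_normed_vector ^ 'd::finite"
  assumes "\<And>r. ((\<lambda>x. f x $ r) has_sum S $ r) A"
  shows "(f has_sum S) A"
  using assms unfolding has_sum_def by (intro vec_tendstoI) simp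

text \<open>Componentwise this is the convolution formula for products. Since \<open>advection\<close> is given by a
family of integrals, it also has to be shown that this family has polynomial growth and is
conjugation symmetric; both are read off from the convolution, which is bounded and has conjugate
summands at \<open>(k, h)\<close> and \<open>(- k, - h)\<close>.\<close>

lemma has_sum_advection:
  fixes v w :: "'d::finite tdist"
  assumes v: "abs_summable v" and w: "abs_summable w"
  shows "(advection_term v w k has_sum fcoeff (advection v w) k) UNIV"
proof -
  define f where "f = (\<lambda>x. \<chi> r. \<Sum>s\<in>UNIV. value_at v x $ s * value_at (partial_deriv s w) x $ r)"
  define I where "I k = (1 / (2 * pi) ^ CARD('d)) *\<^sub>R integral torus_box (\<lambda>x. wave (- k) x *s f x)" for k
  note vs = abs_summable_fcoeff[OF v] and ws = abs_summable_fcoeff[OF w]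
  have cont_v: "continuous_on torus_box (\<lambda>x. value_at v x $ s)" for s
    unfolding value_at_component[OF vs(1)] by (intro continuous_on_wave_series vs)
  have cont_w: "continuous_on torus_box (\<lambda>x. value_at (partial_deriv s w) x $ r)" for s r
    unfolding value_at_component[OF ws(3)] by (intro continuous_on_wave_series ws)
  have integrable: "(\<lambda>x. wave (- k) x *s f x) integrable_on torus_box" for k
  proof (rule integrable_continuous)
    have "continuous_on torus_box (\<lambda>x. wave (- k) x * (\<Sum>s\<in>UNIV. value_at v x $ s * value_at (partial_deriv s w) x $ r))" for r
      by (intro continuous_on_mult continuous_on_wave continuous_on_sum cont_v cont_w)
    then show "continuous_on torus_box (\<lambda>x. wave (- k) x *s f x)"
      unfolding f_def vector_scalar_mult_def by (intro continuous_on_vec_lambda) simp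
  qed
  have term_I: "(advection_term v w k has_sum I k) UNIV" for k
  proof (rule has_sum_vecI)
    fix r
    have "((\<lambda>h. \<Sum>s\<in>UNIV. fcoeff v h $ s * fcoeff (partial_deriv s w) (k - h) $ r) has_sum
      (\<Sum>s\<in>UNIV. (1 / (2 * pi) ^ CARD('d)) *\<^sub>R integral torus_box (\<lambda>x. wave (- k) x *
        (value_at v x $ s * value_at (partial_deriv s w) x $ r)))) UNIV"
      unfolding value_at_component[OF vs(1)] value_at_component[OF ws(3)]
      by (intro has_sum_finite_sum has_sum_fourier_coeff_product vs ws)
    also have "(\<Sum>s\<in>UNIV. (1 / (2 * pi) ^ CARD('d)) *\<^sub>R integral torus_box (\<lambda>x. wave (- k) x *
        (value_at v x $ s * value_at (partial_deriv s w) x $ r))) = I k $ r"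
    proof -
      have "integral torus_box (\<lambda>x. wave (- k) x *s f x) $ r = integral torus_box (\<lambda>x. (wave (- k) x *s f x) $ r)"
        using integral_linear[OF integrable bounded_linear_vec_nth[of r]] by (simp add: o_def)
      also have "\<dots> = integral torus_box (\<lambda>x. \<Sum>s\<in>UNIV. wave (- k) x *
          (value_at v x $ s * value_at (partial_deriv s w) x $ r))"
        by (simp add: f_def sum_distrib_left)
      also have "\<dots> = (\<Sum>s\<in>UNIV. integral torus_box (\<lambda>x. wave (- k) x *
          (value_at v x $ s * value_at (partial_deriv s w) x $ r)))"
        by (intro integral_sum integrable_continuous continuous_intros cont_v cont_w) simp
      finally show ?thesis by (simp add: I_def scaleR_sum_right)
    qed
    also have "(\<lambda>h. \<Sum>s\<in>UNIV. fcoeff v h $ s * fcoeff (partial_deriv s w) (k - h) $ r)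
        = (\<lambda>h. advection_term v w k h $ r)"
      by (auto simp: advection_term_def partial_deriv.rep_eq cdot_def cfreq_def sum_distrib_left
          sum_distrib_right mult_ac)
    finally show "((\<lambda>h. advection_term v w k h $ r) has_sum I k $ r) UNIV" .
  qed
  have "I (- k) = vcnj (I k)" for k
  proof (rule has_sum_unique[OF term_I])
    have "((\<lambda>h. vcnj (advection_term v w k h)) has_sum vcnj (I k)) UNIV"
    proof (rule has_sum_vecI)
      fix r
      have "((\<lambda>h. advection_term v w k h $ r) has_sum I k $ r) UNIV"
        by (rule has_sum_bounded_linear[OF bounded_linear_vec_nth[of r] term_I])
      then show "((\<lambda>h. vcnj (advection_term v w k h) $ r) has_sum vcnj (I k) $ r) UNIV"
        by (simp add: vcnj_def)
    qed
    then have "((\<lambda>h. vcnj (advection_term v w k (- h))) has_sum vcnj (I k)) UNIV"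
      by (rule has_sum_reindex_bij_betw[THEN iffD2, rotated]) (auto intro!: bij_betwI[of _ _ _ uminus])
    moreover have "vcnj (advection_term v w k (- h)) = advection_term v w (- k) h" for h
    proof -
      have "fcoeff w (- k - h) = vcnj (fcoeff w (k + h))"
        using fcoeff_uminus_freq[of w "k + h"] by simp
      moreover have "cdot (cfreq (- k - h)) (fcoeff v h) = - cnj (cdot (cfreq (k + h)) (fcoeff v (- h)))"
        by (simp add: cdot_def cfreq_def fcoeff_uminus_freq vcnj_def flip: sum_negf)
          (rule sum.cong, simp_all add: algebra_simps)
      ultimately show ?thesis
        by (simp add: advection_term_def vcnj_def vec_eq_iff)
    qed
    ultimately show "(advection_term v w (- k) has_sum vcnj (I k)) UNIV"
      by simp
  qed
  moreover have "slow_growth I"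
  proof -
    let ?W = "\<Sum>\<^sub>\<infinity>l. weight l * norm (fcoeff w l)" and ?V = "\<Sum>\<^sub>\<infinity>h. norm (fcoeff v h)"
    have "norm (I k) \<le> ?V * ?W" for k
    proof -
      have "norm (advection_term v w k h) \<le> norm (fcoeff v h) * ?W" for h
      proof -
        have "norm (advection_term v w k h) = norm (cdot (cfreq (k - h)) (fcoeff v h)) * norm (fcoeff w (k - h))"
          by (simp add: advection_term_def norm_vec_scale norm_mult)
        also have "\<dots> \<le> (norm (freq (k - h)) * norm (fcoeff v h)) * norm (fcoeff w (k - h))"
          using norm_cdot_le[of "cfreq (k - h)" "fcoeff v h"] by (intro mult_right_mono) (auto simp: norm_cfreq)
        also have "\<dots> \<le> norm (fcoeff v h) * (weight (k - h) * norm (fcoeff w (k - h)))"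
          by (simp add: weight_def algebra_simps)
        also have "weight (k - h) * norm (fcoeff w (k - h)) \<le> ?W"
          using w finite_sum_le_infsum[of "\<lambda>l. weight l * norm (fcoeff w l)" UNIV "{k - h}"]
          by (simp add: abs_summable_def)
        finally show ?thesis by (simp add: mult_left_mono)
      qed
      then have "norm (I k) \<le> (\<Sum>\<^sub>\<infinity>h. norm (fcoeff v h) * ?W)"
        using norm_infsum_le[OF term_I has_sum_infsum[OF summable_on_cmult_left[OF vs(1)]]] by simp
      also have "\<dots> = ?V * ?W" by (rule infsum_cmult_left')
      finally show ?thesis .
    qed
    then show ?thesis unfolding slow_growth_def by (intro exI[of _ "?V * ?W"] exI[of _ 0]) simp
  qed
  ultimately have "fcoeff (Tdist I) = I" by (intro Tdist_inverse) blast
  moreover have "advection v w = Tdist I"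
    unfolding advection_def tdist_of_fun_def I_def f_def ..
  ultimately show ?thesis using term_I by simp
qed

lemma norm_fcoeff_le_decays: "decays m M v \<Longrightarrow> norm (fcoeff v k) \<le> M * inverse (weight k ^ m)"
  unfolding decays_def by (metis divide_inverse pos_le_divide_eq weight_pos(1) zero_less_power)

lemma abs_summable_smooth:
  assumes "(v :: 'd::finite tdist) \<in> smooth_space" shows "abs_summable v"
proof -
  obtain M where M: "decays (Suc (2 * CARD('d))) M v" using assms by (auto simp: smooth_space_iff)
  have "(\<lambda>k. M * inverse (weight k ^ (2 * CARD('d)))) summable_on (UNIV :: (int ^ 'd) set)"
    by (intro summable_on_cmult_right summable_on_weight)
  then show ?thesis
    unfolding abs_summable_def
  proof (rule summable_on_comparison_test)
    show "weight k * norm (fcoeff v k) \<le> M * inverse (weight k ^ (2 * CARD('d)))" for k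
      using mult_left_mono[OF norm_fcoeff_le_decays[OF M, of k], of "weight k"] by (simp add: field_simps)
  qed simp
qed

text \<open>By \<open>weight_submult\<close> the weight of order \<open>m\<close> is shared between \<open>v\<^sub>h\<close> and \<open>w\<^bsub>k-h\<^esub>\<close>. The
derivative costs one more order for \<open>w\<close>, and the additional order \<open>2 * CARD('d)\<close> for \<open>v\<close> makes the
sum over \<open>h\<close> finite.\<close>

lemma decays_advection:
  fixes v w :: "'d::finite tdist"
  assumes v: "v \<in> smooth_space" and w: "w \<in> smooth_space"
    and dv: "decays (m + 2 * CARD('d)) M v" and dw: "decays (Suc m) M' w"
  shows "decays m (M * M' * lattice_sum TYPE('d)) (advection v w)"
  unfolding decays_def
proof
  fix k
  let ?q = "2 * CARD('d)"
  have M: "0 \<le> M" "0 \<le> M'" using dv dw decays_nonneg by blast+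
  have bound: "norm (advection_term v w k h) \<le> M * M' * inverse (weight k ^ m) * inverse (weight h ^ ?q)" for h
  proof -
    have "norm (advection_term v w k h) = norm (cdot (cfreq (k - h)) (fcoeff v h)) * norm (fcoeff w (k - h))"
      by (simp add: advection_term_def norm_vec_scale norm_mult)
    also have "\<dots> \<le> (norm (freq (k - h)) * norm (fcoeff v h)) * norm (fcoeff w (k - h))"
      using norm_cdot_le[of "cfreq (k - h)" "fcoeff v h"] by (intro mult_right_mono) (auto simp: norm_cfreq)
    also have "\<dots> \<le> (weight (k - h) * (M * inverse (weight h ^ (m + ?q)))) * (M' * inverse (weight (k - h) ^ Suc m))"
      using M by (intro mult_mono norm_fcoeff_le_decays dv dw) (auto simp: weight_def)
    also have "\<dots> = M * M' * inverse ((weight h * weight (k - h)) ^ m) * inverse (weight h ^ ?q)"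
      by (simp add: power_add power_mult_distrib field_simps)
    also have "\<dots> \<le> M * M' * inverse (weight k ^ m) * inverse (weight h ^ ?q)"
      using M weight_submult[of k h]
      by (intro mult_mono le_imp_inverse_le power_mono) auto
    finally show ?thesis .
  qed
  have "norm (fcoeff (advection v w) k) \<le> (\<Sum>\<^sub>\<infinity>h :: int ^ 'd. M * M' * inverse (weight k ^ m) * inverse (weight h ^ ?q))"
  proof (rule norm_infsum_le)
    show "(advection_term v w k has_sum fcoeff (advection v w) k) UNIV"
      by (intro has_sum_advection abs_summable_smooth v w)
    show "((\<lambda>h. M * M' * inverse (weight k ^ m) * inverse (weight h ^ ?q)) has_sum
        (\<Sum>\<^sub>\<infinity>h :: int ^ 'd. M * M' * inverse (weight k ^ m) * inverse (weight h ^ ?q))) (UNIV :: (int ^ 'd) set)"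
      by (intro has_sum_infsum summable_on_cmult_right summable_on_weight)
  qed (rule bound)
  also have "\<dots> = M * M' * inverse (weight k ^ m) * lattice_sum TYPE('d)"
    by (rule infsum_cmult_right')
  finally show "norm (fcoeff (advection v w) k) * weight k ^ m \<le> M * M' * lattice_sum TYPE('d)"
    by (simp add: field_simps)
qed

lemma cfreq_zero: "cfreq 0 = 0"
  by (simp add: cfreq_def vec_eq_iff)

lemma fcoeff_leray:
  "fcoeff (leray v) k = fcoeff v k - (cdot (cfreq k) (fcoeff v k) / of_real ((norm (freq k))\<^sup>2)) *s cfreq k"
  by (simp add: leray.rep_eq)

lemma cdot_cfreq_self: "cdot (cfreq k) (cfreq k) = of_real ((norm (freq k))\<^sup>2)"
proof -
  have "vcnj (cfreq k) = cfreq k" by (simp add: vcnj_def cfreq_def)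
  then show ?thesis using cdot_vcnj_self[of "cfreq k"] by (simp add: norm_cfreq)
qed

text \<open>The projection has norm \<open>1\<close>; the factor \<open>2\<close> from the triangle inequality is good enough.\<close>

lemma decays_leray:
  assumes "decays m M v" shows "decays m (2 * M) (leray v)"
proof -
  have "norm (fcoeff (leray v) k) \<le> 2 * norm (fcoeff v k)" for k
  proof (cases "k = 0")
    case False
    then have "norm ((cdot (cfreq k) (fcoeff v k) / of_real ((norm (freq k))\<^sup>2)) *s cfreq k)
        = norm (cdot (cfreq k) (fcoeff v k)) / norm (freq k)"
      by (simp add: norm_vec_scale norm_divide norm_cfreq power2_eq_square norm_mult)
    also have "\<dots> \<le> norm (fcoeff v k)"
      using False norm_cdot_le[of "cfreq k" "fcoeff v k"] by (simp add: norm_cfreq field_simps)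
    finally show ?thesis
      using norm_triangle_ineq4[of "fcoeff v k"
          "(cdot (cfreq k) (fcoeff v k) / of_real ((norm (freq k))\<^sup>2)) *s cfreq k"]
      unfolding fcoeff_leray by linarith
  qed (simp add: fcoeff_leray cfreq_zero)
  then have "norm (fcoeff (leray v) k) * weight k ^ m \<le> 2 * (norm (fcoeff v k) * weight k ^ m)" for k
    using mult_right_mono[of "norm (fcoeff (leray v) k)" "2 * norm (fcoeff v k)" "weight k ^ m"] by simp
  then show ?thesis using assms unfolding decays_def by (meson mult_left_mono order_trans zero_le_numeral)
qed

lemma solenoidal_leray:
  assumes "fcoeff v 0 = 0" shows "solenoidal (leray v)"
  unfolding solenoidal_def
proof (intro conjI allI)
  show "fcoeff (leray v) 0 = 0" using assms by (simp add: fcoeff_leray cdot_linear)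
  show "cdot (cfreq k) (fcoeff (leray v) k) = 0" for k
    by (cases "k = 0") (simp_all add: fcoeff_leray cdot_linear cdot_cfreq_self assms)
qed

text \<open>At frequency \<open>0\<close> every summand contains \<open>- h \<cdot> v\<^sub>h\<close>, which vanishes because \<open>v\<close> is
divergence free. As the Leray projection is the identity there, this is what makes
\<open>ns_bilinear v w\<close> have zero mean.\<close>

lemma fcoeff_advection_0:
  assumes v: "v \<in> smooth_space" and w: "w \<in> smooth_space"
  shows "fcoeff (advection v w) 0 = 0"
proof (rule has_sum_unique)
  show "(advection_term v w 0 has_sum fcoeff (advection v w) 0) UNIV"
    by (intro has_sum_advection abs_summable_smooth v w)
  have "advection_term v w 0 h = 0" for h
  proof -
    have "cdot (cfreq (- h)) (fcoeff v h) = - cdot (cfreq h) (fcoeff v h)"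
      by (simp add: cdot_def cfreq_def sum_negf)
    also have "\<dots> = 0" using smooth_solenoidal[OF v] by (simp add: solenoidal_def)
    finally show ?thesis by (simp add: advection_term_def)
  qed
  then show "(advection_term v w 0 has_sum 0) UNIV" by (intro has_sum_0) auto
qed

lemma decays_ns_bilinear:
  fixes v w :: "'d::finite tdist"
  assumes v: "v \<in> smooth_space" and w: "w \<in> smooth_space"
    and dv: "decays (m + 2 * CARD('d)) M v" and dw: "decays (Suc m) M' w"
  shows "decays m (2 * (M * M' * lattice_sum TYPE('d))) (ns_bilinear v w)"
  unfolding ns_bilinear_def by (intro decays_uminus decays_leray decays_advection assms)

lemma ns_bilinear_smooth:
  fixes v w :: "'d::finite tdist"
  assumes v: "v \<in> smooth_space" and w: "w \<in> smooth_space"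
  shows "ns_bilinear v w \<in> smooth_space"
  unfolding smooth_space_iff
proof (intro conjI allI)
  show "solenoidal (ns_bilinear v w)"
    unfolding ns_bilinear_def by (intro solenoidal_intros solenoidal_leray fcoeff_advection_0 v w)
  fix m
  obtain M M' where "decays (m + 2 * CARD('d)) M v" "decays (Suc m) M' w"
    using v w unfolding smooth_space_iff by meson
  then show "\<exists>M. decays m M (ns_bilinear v w)" using decays_ns_bilinear[OF v w] by blast
qed

lemma leray_linear:
  "leray (v + w) = leray v + leray w" "leray (c *\<^sub>R v) = c *\<^sub>R leray v"
proof -
  show "leray (v + w) = leray v + leray w"
    by (rule tdist_eqI) (simp add: fcoeff_leray cdot_linear vec_eq_iff add_divide_distrib distrib_right)
  show "leray (c *\<^sub>R v) = c *\<^sub>R leray v"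
  proof (rule tdist_eqI)
    show "fcoeff (leray (c *\<^sub>R v)) k = fcoeff (c *\<^sub>R leray v) k" for k
    proof -
      have "(c *\<^sub>R z) / y = c *\<^sub>R (z / y)" for z y :: complex by (simp add: scaleR_conv_of_real)
      then show ?thesis by (simp add: fcoeff_leray cdot_linear vec_eq_iff scaleR_diff_right)
    qed
  qed
qed

lemma advection_linear:
  assumes "v \<in> smooth_space" "v' \<in> smooth_space" "w \<in> smooth_space" "w' \<in> smooth_space"
  shows "advection (v + v') w = advection v w + advection v' w"
    and "advection v (w + w') = advection v w + advection v w'"
    and "advection (c *\<^sub>R v) w = c *\<^sub>R advection v w"
    and "advection v (c *\<^sub>R w) = c *\<^sub>R advection v w"
proof -
  note has_sum = has_sum_advection[OF abs_summable_smooth abs_summable_smooth]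
  have terms: "advection_term (v + v') w k h = advection_term v w k h + advection_term v' w k h"
    "advection_term v (w + w') k h = advection_term v w k h + advection_term v w' k h"
    "advection_term (c *\<^sub>R v) w k h = c *\<^sub>R advection_term v w k h"
    "advection_term v (c *\<^sub>R w) k h = c *\<^sub>R advection_term v w k h" for k h
    by (simp_all add: advection_term_def cdot_linear vec_eq_iff distrib_left distrib_right)
  show "advection (v + v') w = advection v w + advection v' w"
  proof (rule tdist_eqI, rule has_sum_unique)
    show "(advection_term (v + v') w k has_sum fcoeff (advection (v + v') w) k) UNIV" for k
      by (intro has_sum smooth_space_intros assms)
    show "(advection_term (v + v') w k has_sum fcoeff (advection v w + advection v' w) k) UNIV" for k
      unfolding terms fcoeff_simps by (intro has_sum_add has_sum assms)
  qed
  show "advection v (w + w') = advection v w + advection v w'"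
  proof (rule tdist_eqI, rule has_sum_unique)
    show "(advection_term v (w + w') k has_sum fcoeff (advection v (w + w')) k) UNIV" for k
      by (intro has_sum smooth_space_intros assms)
    show "(advection_term v (w + w') k has_sum fcoeff (advection v w + advection v w') k) UNIV" for k
      unfolding terms fcoeff_simps by (intro has_sum_add has_sum assms)
  qed
  show "advection (c *\<^sub>R v) w = c *\<^sub>R advection v w"
  proof (rule tdist_eqI, rule has_sum_unique)
    show "(advection_term (c *\<^sub>R v) w k has_sum fcoeff (advection (c *\<^sub>R v) w) k) UNIV" for k
      by (intro has_sum smooth_space_intros assms)
    show "(advection_term (c *\<^sub>R v) w k has_sum fcoeff (c *\<^sub>R advection v w) k) UNIV" for k
      unfolding terms fcoeff_simps by (intro has_sum_scaleR has_sum assms)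
  qed
  show "advection v (c *\<^sub>R w) = c *\<^sub>R advection v w"
  proof (rule tdist_eqI, rule has_sum_unique)
    show "(advection_term v (c *\<^sub>R w) k has_sum fcoeff (advection v (c *\<^sub>R w)) k) UNIV" for k
      by (intro has_sum smooth_space_intros assms)
    show "(advection_term v (c *\<^sub>R w) k has_sum fcoeff (c *\<^sub>R advection v w) k) UNIV" for k
      unfolding terms fcoeff_simps by (intro has_sum_scaleR has_sum assms)
  qed
qed

lemma ns_bilinear_add_left:
  assumes "v \<in> smooth_space" "v' \<in> smooth_space" "w \<in> smooth_space"
  shows "ns_bilinear (v + v') w = ns_bilinear v w + ns_bilinear v' w"
  unfolding ns_bilinear_def advection_linear(1)[OF assms assms(3)] leray_linear by simp

lemma ns_bilinear_add_right:
  assumes "v \<in> smooth_space" "w \<in> smooth_space" "w' \<in> smooth_space"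
  shows "ns_bilinear v (w + w') = ns_bilinear v w + ns_bilinear v w'"
  unfolding ns_bilinear_def advection_linear(2)[OF assms(1) assms] leray_linear by simp

lemma ns_bilinear_scaleR:
  assumes "v \<in> smooth_space" "w \<in> smooth_space"
  shows "ns_bilinear (c *\<^sub>R v) w = c *\<^sub>R ns_bilinear v w" "ns_bilinear v (c *\<^sub>R w) = c *\<^sub>R ns_bilinear v w"
  unfolding ns_bilinear_def advection_linear(3,4)[OF assms(1) assms(1) assms(2) assms(2)] leray_linear
  by simp_all

lemma ns_bilinear_diff_left:
  assumes "v \<in> smooth_space" "v' \<in> smooth_space" "w \<in> smooth_space"
  shows "ns_bilinear (v - v') w = ns_bilinear v w - ns_bilinear v' w"
  using ns_bilinear_add_left[OF smooth_space_intros(2)[OF assms(1,2)] assms(2,3)] by (simp add: algebra_simps)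

lemma ns_bilinear_diff_right:
  assumes "v \<in> smooth_space" "w \<in> smooth_space" "w' \<in> smooth_space"
  shows "ns_bilinear v (w - w') = ns_bilinear v w - ns_bilinear v w'"
  using ns_bilinear_add_right[OF assms(1) smooth_space_intros(2)[OF assms(2,3)] assms(3)] by (simp add: algebra_simps)

lemma ns_bilinear_sum_left:
  assumes "\<And>i. i \<in> A \<Longrightarrow> f i \<in> smooth_space" "w \<in> smooth_space"
  shows "ns_bilinear (\<Sum>i\<in>A. f i) w = (\<Sum>i\<in>A. ns_bilinear (f i) w)"
  using assms(1)
proof (induction A rule: infinite_finite_induct)
  case (insert i A)
  then show ?case by (simp add: ns_bilinear_add_left smooth_space_sum assms(2))
qed (use ns_bilinear_scaleR(1)[OF assms(2) assms(2), of 0] in simp_all)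

lemma ns_bilinear_sum_right:
  assumes "\<And>i. i \<in> A \<Longrightarrow> f i \<in> smooth_space" "v \<in> smooth_space"
  shows "ns_bilinear v (\<Sum>i\<in>A. f i) = (\<Sum>i\<in>A. ns_bilinear v (f i))"
  using assms(1)
proof (induction A rule: infinite_finite_induct)
  case (insert i A)
  then show ?case by (simp add: ns_bilinear_add_right smooth_space_sum assms(2))
qed (use ns_bilinear_scaleR(2)[OF assms(2) assms(2), of 0] in simp_all)

text \<open>The orders \<open>a\<close> and \<open>b\<close> are far from optimal, but continuity in the smooth topology only asks
for some orders.\<close>

lemma ns_bilinear_bounded:
  "\<exists>a b C. 0 \<le> C \<and> (\<forall>v \<in> smooth_space. \<forall>w \<in> smooth_space :: 'd::finite tdist set.
    sobolev_norm n (ns_bilinear v w) \<le> C * (sobolev_norm a v * sobolev_norm b w))"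
proof -
  obtain N where N: "n \<le> real N" using real_arch_simple by blast
  define m where "m = N + CARD('d)"
  let ?Z = "lattice_sum TYPE('d)"
  define C where "C = torus_factor TYPE('d) * (2 * (2 ^ (m + 2 * CARD('d)) * 2 ^ Suc m * ?Z)) * sqrt ?Z"
  have "sobolev_norm n (ns_bilinear v w) \<le>
      C * (sobolev_norm (real (m + 2 * CARD('d))) v * sobolev_norm (real (Suc m)) w)"
    if v: "v \<in> smooth_space" and w: "w \<in> smooth_space" for v w :: "'d tdist"
  proof -
    have "decays m (2 * (2 ^ (m + 2 * CARD('d)) * sobolev_norm (real (m + 2 * CARD('d))) v *
        (2 ^ Suc m * sobolev_norm (real (Suc m)) w) * ?Z)) (ns_bilinear v w)"
      by (intro decays_ns_bilinear decays_sobolev smooth_sobolev v w)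
    from sobolev_decays[OF smooth_solenoidal[OF ns_bilinear_smooth[OF v w]] this[unfolded m_def] N]
    show ?thesis unfolding C_def m_def by (simp only: mult_ac)
  qed
  moreover have "0 \<le> C"
    unfolding C_def using lattice_sum_nonneg[where 'd = 'd]
    by (intro mult_nonneg_nonneg) auto
  ultimately show ?thesis by blast
qed

text \<open>Joint continuity, from \<open>P(f,g) - P(v,w) = P(f - v, g) + P(v, g - w)\<close>.\<close>

lemma limitin_ns_bilinear:
  fixes f g :: "'a \<Rightarrow> 'd::finite tdist"
  assumes f: "limitin smooth_topology f v F" and g: "limitin smooth_topology g w F"
  shows "limitin smooth_topology (\<lambda>x. ns_bilinear (f x) (g x)) (ns_bilinear v w) F"
proof (rule limitin_smoothI)
  note fD = limitin_smoothD[OF f] and gD = limitin_smoothD[OF g]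
  show "ns_bilinear v w \<in> smooth_space" by (intro ns_bilinear_smooth fD(1) gD(1))
  show "\<forall>\<^sub>F x in F. ns_bilinear (f x) (g x) \<in> smooth_space"
    using fD(2) gD(2) by eventually_elim (rule ns_bilinear_smooth)
  fix n
  obtain a b C where C: "0 \<le> C" and bound_all: "\<forall>v \<in> smooth_space. \<forall>w \<in> smooth_space :: 'd tdist set.
      sobolev_norm n (ns_bilinear v w) \<le> C * (sobolev_norm a v * sobolev_norm b w)"
    using ns_bilinear_bounded[of n] by blast
  note bound = bound_all[rule_format]
  define h where "h x = C * (sobolev_norm a (f x - v) * (sobolev_norm b (g x - w) + sobolev_norm b w))
    + C * (sobolev_norm a v * sobolev_norm b (g x - w))" for x
  have "(h \<longlongrightarrow> C * (0 * (0 + sobolev_norm b w)) + C * (sobolev_norm a v * 0)) F"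
    unfolding h_def by (intro tendsto_intros fD(3) gD(3))
  moreover have "\<forall>\<^sub>F x in F. sobolev_norm n (ns_bilinear (f x) (g x) - ns_bilinear v w) \<le> h x"
    using fD(2) gD(2)
  proof eventually_elim
    case (elim x)
    have d: "f x - v \<in> smooth_space" "g x - w \<in> smooth_space"
      using elim fD(1) gD(1) by (simp_all add: smooth_space_intros(2))
    have eq: "ns_bilinear (f x) (g x) - ns_bilinear v w = ns_bilinear (f x - v) (g x) + ns_bilinear v (g x - w)"
      using elim fD(1) gD(1) by (simp add: ns_bilinear_diff_left ns_bilinear_diff_right)
    have "sobolev_norm n (ns_bilinear (f x) (g x) - ns_bilinear v w) \<le>
        sobolev_norm n (ns_bilinear (f x - v) (g x)) + sobolev_norm n (ns_bilinear v (g x - w))"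
      unfolding eq by (intro sobolev_norm_triangle[THEN conjunct2] smooth_sobolev ns_bilinear_smooth d elim fD(1))
    also have "\<dots> \<le> C * (sobolev_norm a (f x - v) * sobolev_norm b (g x)) + C * (sobolev_norm a v * sobolev_norm b (g x - w))"
      by (intro add_mono bound d elim fD(1))
    also have "\<dots> \<le> h x"
    proof -
      have "sobolev_norm b ((g x - w) + w) \<le> sobolev_norm b (g x - w) + sobolev_norm b w"
        by (intro sobolev_norm_triangle[THEN conjunct2] smooth_sobolev d(2) gD(1))
      then show ?thesis
        unfolding h_def diff_add_cancel
        by (intro add_mono mult_left_mono order_refl C sobolev_norm_nonneg smooth_sobolev d(1))
    qed
    finally show ?case .
  qed
  ultimately show "\<exists>h. (\<forall>\<^sub>F x in F. sobolev_norm n (ns_bilinear (f x) (g x) - ns_bilinear v w) \<le> h x) \<and> (h \<longlongrightarrow> 0) F"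
    by (intro exI[of _ h]) simp
qed

section \<open>The Laplacian\<close>

lemma fcoeff_laplacian: "fcoeff (laplacian v) k = - ((norm (freq k))\<^sup>2 *\<^sub>R fcoeff v k)"
  by (simp add: laplacian.rep_eq)

lemma laplacian_linear:
  "laplacian (v + w) = laplacian v + laplacian w"
  "laplacian (v - w) = laplacian v - laplacian w"
  "laplacian (c *\<^sub>R v) = c *\<^sub>R laplacian v"
  by (rule tdist_eqI, simp add: fcoeff_laplacian scaleR_add_right scaleR_diff_right mult.commute)+

lemma laplacian_sum: "laplacian (\<Sum>i\<in>A. f i) = (\<Sum>i\<in>A. laplacian (f i))"
proof (induction A rule: infinite_finite_induct)
  case (insert i A)
  then show ?case by (simp add: laplacian_linear)
qed (use laplacian_linear(3)[of 0] in simp_all)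

lemma decays_laplacian:
  assumes "decays (m + 2) M v" shows "decays m M (laplacian v)"
  unfolding decays_def
proof
  fix k
  have "norm (fcoeff (laplacian v) k) * weight k ^ m = norm (freq k) ^ 2 * (norm (fcoeff v k) * weight k ^ m)"
    by (simp add: fcoeff_laplacian)
  also have "\<dots> \<le> weight k ^ 2 * (norm (fcoeff v k) * weight k ^ m)"
    by (intro mult_right_mono power_mono) (auto simp: weight_def)
  also have "\<dots> = norm (fcoeff v k) * weight k ^ (m + 2)" by (simp add: power2_eq_square mult_ac)
  also have "\<dots> \<le> M" using assms by (simp only: decays_def)
  finally show "norm (fcoeff (laplacian v) k) * weight k ^ m \<le> M" .
qed

lemma laplacian_smooth: "v \<in> smooth_space \<Longrightarrow> laplacian v \<in> smooth_space"
  unfolding smooth_space_iff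
proof (intro conjI allI; elim conjE)
  show "solenoidal v \<Longrightarrow> solenoidal (laplacian v)"
    by (simp add: solenoidal_def fcoeff_laplacian cdot_linear)
  show "\<forall>m. \<exists>M. decays m M v \<Longrightarrow> \<exists>M. decays m M (laplacian v)" for m
    using decays_laplacian by blast
qed

lemma sobolev_norm_laplacian:
  assumes "v \<in> smooth_space"
  shows "sobolev_norm n (laplacian v) = sobolev_norm (n + 2) v"
proof -
  have "sobolev_coeff n (laplacian v) k = sobolev_coeff (n + 2) v k" if "k \<in> - {0}" for k
  proof -
    have "norm (freq k) powr 2 = (norm (freq k))\<^sup>2"
      using norm_freq_ge_1[of k] that by (subst powr_numeral) auto
    then show ?thesis by (simp add: sobolev_coeff_def fcoeff_laplacian powr_add)
  qed
  then have "(\<Sum>\<^sub>\<infinity>k\<in>- {0}. (sobolev_coeff n (laplacian v) k)\<^sup>2) = (\<Sum>\<^sub>\<infinity>k\<in>- {0}. (sobolev_coeff (n + 2) v k)\<^sup>2)"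
    by (intro infsum_cong) simp
  then show ?thesis
    using assms by (simp add: sobolev_norm_eq smooth_sobolev laplacian_smooth)
qed

lemma limitin_laplacian:
  assumes f: "limitin smooth_topology f v F"
  shows "limitin smooth_topology (\<lambda>x. laplacian (f x)) (laplacian v) F"
proof (rule limitin_smoothI)
  note fD = limitin_smoothD[OF f]
  show "laplacian v \<in> smooth_space" by (intro laplacian_smooth fD(1))
  show "\<forall>\<^sub>F x in F. laplacian (f x) \<in> smooth_space"
    using fD(2) by eventually_elim (rule laplacian_smooth)
  fix n
  have "\<forall>\<^sub>F x in F. sobolev_norm n (laplacian (f x) - laplacian v) \<le> sobolev_norm (n + 2) (f x - v)"
    using fD(2)
    by eventually_elim
      (simp add: laplacian_linear(2)[symmetric] sobolev_norm_laplacian smooth_space_intros(2) fD(1))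
  then show "\<exists>h. (\<forall>\<^sub>F x in F. sobolev_norm n (laplacian (f x) - laplacian v) \<le> h x) \<and> (h \<longlongrightarrow> 0) F"
    by (intro exI[of _ "\<lambda>x. sobolev_norm (n + 2) (f x - v)"] conjI fD(3))
qed

section \<open>Derivatives of curves\<close>

text \<open>The filter of the derivative at time \<open>t\<close> on the half line: two-sided for \<open>t > 0\<close> and
one-sided at \<open>0\<close>.\<close>

abbreviation forward :: "real \<Rightarrow> real filter" where
  "forward t \<equiv> at t within {0..}"

lemma forward_not_bot: "0 \<le> t \<Longrightarrow> forward t \<noteq> bot"
proof
  assume t: "0 \<le> t" and bot: "forward t = bot"
  have "at_right t \<le> forward t" using t by (intro at_le) auto
  then show False using bot trivial_limit_at_right_real[of t] by (simp add: bot.extremum_unique)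
qed

lemma time_deriv_eq: "0 \<le> t \<Longrightarrow> has_time_deriv u u' t \<Longrightarrow> time_deriv u t = u'"
  unfolding time_deriv_def has_time_deriv_def
  by (rule the_equality) (auto intro: limitin_smooth_unique[OF forward_not_bot])

lemma has_time_deriv_cong:
  assumes "has_time_deriv u u' t" "0 \<le> t" "\<And>s. 0 \<le> s \<Longrightarrow> u s = w s"
  shows "has_time_deriv w u' t"
  using assms unfolding has_time_deriv_def
  by (elim limitin_smooth_cong) (auto simp: eventually_at_filter)

lemma has_time_deriv_add:
  assumes "has_time_deriv u u' t" "has_time_deriv w w' t"
  shows "has_time_deriv (\<lambda>t. u t + w t) (u' + w') t"
  using limitin_smooth_add[OF assms[unfolded has_time_deriv_def]]
  unfolding has_time_deriv_def by (simp add: algebra_simps)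

lemma has_time_deriv_scaleR:
  assumes "has_time_deriv u u' t"
  shows "has_time_deriv (\<lambda>t. c *\<^sub>R u t) (c *\<^sub>R u') t"
  using limitin_smooth_scaleR[OF tendsto_const assms[unfolded has_time_deriv_def], of c]
  unfolding has_time_deriv_def by (simp add: scaleR_diff_right mult.commute)

lemma has_time_deriv_const: "has_time_deriv (\<lambda>t. 0) 0 t"
  unfolding has_time_deriv_def by (simp add: topspace_smooth_topology smooth_space_intros(5))

lemma has_time_deriv_sum:
  assumes "\<And>i. i \<in> A \<Longrightarrow> has_time_deriv (u i) (u' i) t"
  shows "has_time_deriv (\<lambda>t. \<Sum>i\<in>A. u i t) (\<Sum>i\<in>A. u' i) t"
  using assms
  by (induction A rule: infinite_finite_induct) (simp_all add: has_time_deriv_add has_time_deriv_const)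

lemma has_time_deriv_laplacian:
  assumes "has_time_deriv u u' t"
  shows "has_time_deriv (\<lambda>t. laplacian (u t)) (laplacian u') t"
  using limitin_laplacian[OF assms[unfolded has_time_deriv_def]]
  unfolding has_time_deriv_def by (simp add: laplacian_linear)

lemma has_time_deriv_continuous:
  assumes "has_time_deriv u u' t" "u t \<in> smooth_space"
  shows "limitin smooth_topology u (u t) (forward t)"
proof -
  have "((\<lambda>s. s - t) \<longlongrightarrow> t - t) (forward t)" by (intro tendsto_intros)
  then have "((\<lambda>s. s - t) \<longlongrightarrow> 0) (forward t)" by simp
  from limitin_smooth_add[OF limitin_smooth_const[OF assms(2)]
      limitin_smooth_scaleR[OF this assms(1)[unfolded has_time_deriv_def]]]
  have "limitin smooth_topology (\<lambda>s. u t + (s - t) *\<^sub>R (1 / (s - t)) *\<^sub>R (u s - u t)) (u t) (forward t)"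
    by simp
  then show ?thesis
    by (rule limitin_smooth_cong) (auto simp: eventually_at_filter)
qed

text \<open>The difference quotient of the product is \<open>P(q, w(s)) + P(u(t), q')\<close> with the difference
quotients \<open>q\<close> and \<open>q'\<close> of the factors; joint continuity allows the passage to the limit.\<close>

lemma has_time_deriv_ns_bilinear:
  assumes u: "has_time_deriv u u' t" "\<And>t. 0 \<le> t \<Longrightarrow> u t \<in> smooth_space"
    and w: "has_time_deriv w w' t" "\<And>t. 0 \<le> t \<Longrightarrow> w t \<in> smooth_space" and t: "0 \<le> t"
  shows "has_time_deriv (\<lambda>t. ns_bilinear (u t) (w t)) (ns_bilinear u' (w t) + ns_bilinear (u t) w') t"
proof -
  have "limitin smooth_topology
      (\<lambda>s. ns_bilinear ((1 / (s - t)) *\<^sub>R (u s - u t)) (w s) + ns_bilinear (u t) ((1 / (s - t)) *\<^sub>R (w s - w t)))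
      (ns_bilinear u' (w t) + ns_bilinear (u t) w') (forward t)"
    by (intro limitin_smooth_add limitin_ns_bilinear limitin_smooth_const
        u(1)[unfolded has_time_deriv_def] w(1)[unfolded has_time_deriv_def]
        has_time_deriv_continuous[OF w(1)] u(2) w(2) t)
  moreover have "\<forall>\<^sub>F s in forward t.
      ns_bilinear ((1 / (s - t)) *\<^sub>R (u s - u t)) (w s) + ns_bilinear (u t) ((1 / (s - t)) *\<^sub>R (w s - w t))
      = (1 / (s - t)) *\<^sub>R (ns_bilinear (u s) (w s) - ns_bilinear (u t) (w t))"
  proof -
    have "ns_bilinear ((1 / (s - t)) *\<^sub>R (u s - u t)) (w s) + ns_bilinear (u t) ((1 / (s - t)) *\<^sub>R (w s - w t))
      = (1 / (s - t)) *\<^sub>R (ns_bilinear (u s) (w s) - ns_bilinear (u t) (w t))" if "0 \<le> s" for s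
      using u(2)[OF that] u(2)[OF t] w(2)[OF that] w(2)[OF t]
      by (simp add: ns_bilinear_scaleR ns_bilinear_diff_left ns_bilinear_diff_right smooth_space_intros(2)
          flip: scaleR_add_right)
    then show ?thesis by (auto simp: eventually_at_filter)
  qed
  ultimately show ?thesis unfolding has_time_deriv_def by (rule limitin_smooth_cong)
qed

definition locally_bounded :: "(real \<Rightarrow> 'd::finite tdist) \<Rightarrow> bool" where
  "locally_bounded u \<longleftrightarrow> (\<forall>T m. \<exists>M. \<forall>t\<in>{0..T}. decays m M (u t))"

lemma locally_bounded_of_continuous:
  assumes u: "\<And>t. 0 \<le> t \<Longrightarrow> limitin smooth_topology u (u t) (forward t)"
  shows "locally_bounded u"
  unfolding locally_bounded_def
proof (intro allI)
  fix T :: real and m :: nat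
  let ?N = "sobolev_norm (real m)"
  have sm: "u t \<in> smooth_space" if "0 \<le> t" for t using limitin_smoothD(1)[OF u[OF that]] .
  have "continuous_on {0..} (\<lambda>t. ?N (u t))"
    unfolding continuous_on_def
  proof
    fix t :: real assume "t \<in> {0..}"
    then have t: "0 \<le> t" by simp
    have "\<forall>\<^sub>F s in forward t. norm (?N (u s) - ?N (u t)) \<le> ?N (u s - u t)"
    proof -
      have "norm (?N (u s) - ?N (u t)) \<le> ?N (u s - u t)" if s: "0 \<le> s" for s
      proof -
        note st = smooth_sobolev[OF sm[OF s], of "real m"] smooth_sobolev[OF sm[OF t], of "real m"]
        have d: "u s - u t \<in> sobolev_space (real m)"
          by (intro smooth_sobolev smooth_space_intros sm s t)
        show ?thesis
          using sobolev_norm_triangle[OF d st(2)] sobolev_norm_triangle[OF sobolev_norm_uminus[OF d, THEN conjunct1] st(1)]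
            sobolev_norm_uminus[OF d] by (auto simp: abs_le_iff)
      qed
      then show ?thesis by (auto simp: eventually_at_filter)
    qed
    then have "((\<lambda>s. ?N (u s) - ?N (u t)) \<longlongrightarrow> 0) (forward t)"
      by (rule Lim_null_comparison) (rule limitin_smoothD(3)[OF u[OF t]])
    then show "((\<lambda>s. ?N (u s)) \<longlongrightarrow> ?N (u t)) (forward t)" by (simp add: LIM_zero_iff)
  qed
  then have "bounded ((\<lambda>t. ?N (u t)) ` {0..T})"
    by (intro compact_imp_bounded compact_continuous_image) (auto elim: continuous_on_subset)
  then obtain B where "\<forall>x\<in>(\<lambda>t. ?N (u t)) ` {0..T}. norm x \<le> B"
    unfolding bounded_iff by blast
  then have B: "?N (u t) \<le> B" if "t \<in> {0..T}" for t
    using that by (metis abs_le_D1 imageI real_norm_def)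
  have "decays m (2 ^ m * B) (u t)" if "t \<in> {0..T}" for t
    using that B[OF that] by (intro decays_mono[OF decays_sobolev] smooth_sobolev sm) auto
  then show "\<exists>M. \<forall>t\<in>{0..T}. decays m M (u t)" by blast
qed

lemma continuous_on_fcoeff:
  assumes "\<And>t. 0 \<le> t \<Longrightarrow> limitin smooth_topology u (u t) (forward t)"
  shows "continuous_on {0..} (\<lambda>t. fcoeff (u t) k)"
  unfolding continuous_on_def using assms by (auto intro: limitin_fcoeff)

lemma has_vector_derivative_quotient:
  assumes "(g has_vector_derivative D) (at t within S)"
  shows "((\<lambda>s. (1 / (s - t)) *\<^sub>R (g s - g t)) \<longlongrightarrow> D) (at t within S)"
proof -
  have "((\<lambda>s. norm ((g s - g t) - (s - t) *\<^sub>R D) / norm (s - t)) \<longlongrightarrow> 0) (at t within S)"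
    using assms by (simp add: has_vector_derivative_def has_derivative_iff_norm)
  moreover have "\<forall>\<^sub>F s in at t within S. norm ((g s - g t) - (s - t) *\<^sub>R D) / norm (s - t)
      = norm ((1 / (s - t)) *\<^sub>R (g s - g t) - D)"
  proof -
    have "norm ((g s - g t) - (s - t) *\<^sub>R D) / norm (s - t) = norm ((1 / (s - t)) *\<^sub>R (g s - g t) - D)"
      if "s \<noteq> t" for s
    proof -
      have "(1 / (s - t)) *\<^sub>R (g s - g t) - D = (1 / (s - t)) *\<^sub>R ((g s - g t) - (s - t) *\<^sub>R D)"
        using that by (simp add: scaleR_diff_right)
      then show ?thesis by (simp add: divide_inverse)
    qed
    then show ?thesis by (auto simp: eventually_at_filter)
  qed
  ultimately have "((\<lambda>s. norm ((1 / (s - t)) *\<^sub>R (g s - g t) - D)) \<longlongrightarrow> 0) (at t within S)"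
    by (rule Lim_transform_eventually)
  then show ?thesis by (simp add: tendsto_norm_zero_iff LIM_zero_iff)
qed

text \<open>By the mean value theorem a bound for \<open>u'\<close> near \<open>t\<close> bounds the difference quotients of all
coefficients, with the same weights; so the property of Montel turns the derivatives of the
coefficients into a derivative in the smooth topology.\<close>

lemma has_time_deriv_of_fcoeff:
  assumes u: "\<And>t. 0 \<le> t \<Longrightarrow> u t \<in> smooth_space" and bdd: "locally_bounded u'"
    and deriv: "\<And>k t. 0 \<le> t \<Longrightarrow> ((\<lambda>t. fcoeff (u t) k) has_vector_derivative fcoeff (u' t) k) (forward t)"
    and t: "0 \<le> t"
  shows "has_time_deriv u (u' t) t"
proof -
  let ?q = "\<lambda>s. (1 / (s - t)) *\<^sub>R (u s - u t)"
  have near: "\<forall>\<^sub>F s in forward t. s \<in> {0..t + 1} \<and> s \<noteq> t"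
  proof -
    have "\<forall>\<^sub>F s in forward t. s < t + 1"
      by (rule order_tendstoD(2)[where y = t]) (auto intro!: tendsto_intros)
    moreover have "\<forall>\<^sub>F s in forward t. 0 \<le> s \<and> s \<noteq> t" by (auto simp: eventually_at_filter)
    ultimately show ?thesis by eventually_elim auto
  qed
  obtain v where v: "\<And>k. fcoeff v k = fcoeff (u' t) k" "limitin smooth_topology ?q v (forward t)"
  proof (rule limitin_smooth_of_fcoeff_bounded[OF forward_not_bot[OF t], of ?q "fcoeff (u' t)"])
    show "\<forall>\<^sub>F s in forward t. ?q s \<in> smooth_space"
      using near by eventually_elim (intro smooth_space_intros u t, simp)
    show "((\<lambda>s. fcoeff (?q s) k) \<longlongrightarrow> fcoeff (u' t) k) (forward t)" for k
      using has_vector_derivative_quotient[OF deriv[OF t]] by simp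
    fix m
    obtain M where M: "\<And>s. s \<in> {0..t + 1} \<Longrightarrow> decays m M (u' s)"
      using bdd unfolding locally_bounded_def by blast
    have "decays m M (?q s)" if s: "s \<in> {0..t + 1}" "s \<noteq> t" for s
      unfolding decays_def
    proof
      fix k
      have "norm (fcoeff (u s) k - fcoeff (u t) k) \<le> (M * inverse (weight k ^ m)) * norm (s - t)"
      proof (rule differentiable_bound[where f' = "\<lambda>x h. h *\<^sub>R fcoeff (u' x) k"])
        fix x assume x: "x \<in> {0..t + 1}"
        show "((\<lambda>t. fcoeff (u t) k) has_derivative (\<lambda>h. h *\<^sub>R fcoeff (u' x) k)) (at x within {0..t + 1})"
          using deriv[of x k] x unfolding has_vector_derivative_def
          by (auto elim: has_derivative_subset)
        show "onorm (\<lambda>h. h *\<^sub>R fcoeff (u' x) k) \<le> M * inverse (weight k ^ m)"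
        proof (rule onorm_le)
          show "norm (h *\<^sub>R fcoeff (u' x) k) \<le> M * inverse (weight k ^ m) * norm h" for h
            using norm_fcoeff_le_decays[OF M[OF x], of k] by (simp add: mult.commute[of "\<bar>h\<bar>"] mult_right_mono)
        qed
      qed (use s t in auto)
      then have "norm (fcoeff (u s) k - fcoeff (u t) k) / \<bar>s - t\<bar> \<le> M * inverse (weight k ^ m)"
        using s by (simp add: field_simps)
      from mult_right_mono[OF this, of "weight k ^ m"] show "norm (fcoeff (?q s) k) * weight k ^ m \<le> M"
        by (simp add: mult.assoc)
    qed
    then show "\<exists>M. \<forall>\<^sub>F s in forward t. decays m M (?q s)"
      using near by (intro exI[of _ M]) (auto elim: eventually_mono)
  qed blast
  then have "v = u' t" by (intro tdist_eqI)
  then show ?thesis using v by (simp add: has_time_deriv_def)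
qed

section \<open>Smooth curves\<close>

definition has_deriv_curve :: "(real \<Rightarrow> 'd::finite tdist) \<Rightarrow> (real \<Rightarrow> 'd tdist) \<Rightarrow> bool" where
  "has_deriv_curve u u' \<longleftrightarrow> (\<forall>t\<ge>0. u t \<in> smooth_space \<and> has_time_deriv u (u' t) t)"

text \<open>Iterating a choice of derivatives inside the class yields the derivatives of all orders.\<close>

lemma smooth_curve_coinduct:
  assumes "X u" and step: "\<And>u. X u \<Longrightarrow> \<exists>u'. X u' \<and> has_deriv_curve u u'"
  shows "smooth_curve u"
proof -
  have "\<forall>u. \<exists>u'. X u \<longrightarrow> X u' \<and> has_deriv_curve u u'" using step by blast
  then obtain successor where "\<forall>u. X u \<longrightarrow> X (successor u) \<and> has_deriv_curve u (successor u)"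
    by (rule choice[THEN exE])
  then have nxt: "\<And>u. X u \<Longrightarrow> X (successor u)" "\<And>u. X u \<Longrightarrow> has_deriv_curve u (successor u)"
    by blast+
  define D where "D m = (successor ^^ m) u" for m
  have "X (D m)" for m by (induction m) (simp_all add: D_def assms(1) nxt(1))
  then have "has_deriv_curve (D m) (D (Suc m))" for m using nxt(2)[of "D m"] by (simp add: D_def)
  then show ?thesis
    unfolding smooth_curve_def has_deriv_curve_def by (intro exI[of _ D]) (simp add: D_def)
qed

lemma smooth_curve_deriv:
  assumes "smooth_curve u"
  obtains u' where "smooth_curve u'" "has_deriv_curve u u'"
proof -
  from assms obtain D where D0: "\<forall>t\<ge>0. D 0 t = u t"
    and D: "\<forall>m. \<forall>t\<ge>0. D m t \<in> smooth_space \<and> has_time_deriv (D m) (D (Suc m) t) t"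
    unfolding smooth_curve_def by (elim exE conjE)
  have "smooth_curve (D (Suc 0))"
    unfolding smooth_curve_def
  proof (intro exI conjI)
    show "\<forall>t\<ge>0. D (Suc 0) t = D (Suc 0) t" by blast
    show "\<forall>m. \<forall>t\<ge>0. D (Suc m) t \<in> smooth_space \<and> has_time_deriv (D (Suc m)) (D (Suc (Suc m)) t) t"
      using D by blast
  qed
  moreover have "has_deriv_curve u (D (Suc 0))"
    unfolding has_deriv_curve_def
  proof (intro allI impI conjI)
    fix t :: real assume t: "0 \<le> t"
    show "u t \<in> smooth_space" using D D0 t by metis
    have "has_time_deriv (D 0) (D (Suc 0) t) t" using D t by blast
    then show "has_time_deriv u (D (Suc 0) t) t"
      by (rule has_time_deriv_cong[OF _ t]) (use D0 in blast)
  qed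
  ultimately show thesis by (rule that)
qed

text \<open>The curves generated by \<open>B\<close>. The three operations are those in the equation
\<open>u' = \<Delta>u + P(v,w)\<close>, and their derivatives are expressed by the same operations.\<close>

inductive curve_algebra :: "(real \<Rightarrow> 'd::finite tdist) set \<Rightarrow> (real \<Rightarrow> 'd tdist) \<Rightarrow> bool" for B where
  base: "u \<in> B \<Longrightarrow> curve_algebra B u"
| add: "curve_algebra B u \<Longrightarrow> curve_algebra B w \<Longrightarrow> curve_algebra B (\<lambda>t. u t + w t)"
| laplacian: "curve_algebra B u \<Longrightarrow> curve_algebra B (\<lambda>t. laplacian (u t))"
| bilinear: "curve_algebra B u \<Longrightarrow> curve_algebra B w \<Longrightarrow> curve_algebra B (\<lambda>t. ns_bilinear (u t) (w t))"

text \<open>The product rule and the linearity of the derivative extend the hypothesis on the generators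
to the generated class, which is therefore closed under differentiation.\<close>

lemma smooth_curve_algebra:
  assumes base: "\<And>u. u \<in> B \<Longrightarrow> \<exists>u'. curve_algebra B u' \<and> has_deriv_curve u u'"
    and u: "curve_algebra B u"
  shows "smooth_curve u"
proof (rule smooth_curve_coinduct[of "curve_algebra B", OF u])
  fix u assume "curve_algebra B u"
  then show "\<exists>u'. curve_algebra B u' \<and> has_deriv_curve u u'"
  proof induction
    case (base u)
    then show ?case by (rule assms(1))
  next
    case (add u w)
    then obtain u' w' where "curve_algebra B u'" "has_deriv_curve u u'" "curve_algebra B w'" "has_deriv_curve w w'"
      by blast
    then show ?case
      by (intro exI[of _ "\<lambda>t. u' t + w' t"])
        (simp add: has_deriv_curve_def curve_algebra.add has_time_deriv_add smooth_space_intros(1))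
  next
    case (laplacian u)
    then obtain u' where "curve_algebra B u'" "has_deriv_curve u u'" by blast
    then show ?case
      by (intro exI[of _ "\<lambda>t. laplacian (u' t)"])
        (simp add: has_deriv_curve_def curve_algebra.laplacian has_time_deriv_laplacian laplacian_smooth)
  next
    case (bilinear u w)
    then obtain u' w' where "curve_algebra B u'" "has_deriv_curve u u'" "curve_algebra B w'" "has_deriv_curve w w'"
      by blast
    then show ?case using bilinear.hyps
      by (intro exI[of _ "\<lambda>t. ns_bilinear (u' t) (w t) + ns_bilinear (u t) (w' t)"])
        (simp add: has_deriv_curve_def curve_algebra.add curve_algebra.bilinear
          has_time_deriv_ns_bilinear ns_bilinear_smooth)
  qed
qed

lemma smooth_curve_base: "smooth_curve u \<Longrightarrow> \<exists>u'. curve_algebra (Collect smooth_curve) u' \<and> has_deriv_curve u u'"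
proof -
  assume "smooth_curve u"
  then obtain u' where "smooth_curve u'" "has_deriv_curve u u'" by (rule smooth_curve_deriv)
  then show ?thesis by (intro exI[of _ u'] conjI curve_algebra.base) simp_all
qed

lemma smooth_curve_intros:
  "smooth_curve u \<Longrightarrow> smooth_curve w \<Longrightarrow> smooth_curve (\<lambda>t. u t + w t)"
  "smooth_curve u \<Longrightarrow> smooth_curve w \<Longrightarrow> smooth_curve (\<lambda>t. ns_bilinear (u t) (w t))"
proof -
  let ?B = "Collect smooth_curve"
  have base: "curve_algebra ?B u" if "smooth_curve u" for u :: "real \<Rightarrow> 'a tdist"
    using that by (intro curve_algebra.base) simp
  have closed: "smooth_curve u" if "curve_algebra ?B u" for u :: "real \<Rightarrow> 'a tdist"
    by (rule smooth_curve_algebra[OF smooth_curve_base that]) simp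
  show "smooth_curve (\<lambda>t. u t + w t)" "smooth_curve (\<lambda>t. ns_bilinear (u t) (w t))"
    if "smooth_curve u" "smooth_curve w" for u w :: "real \<Rightarrow> 'a tdist"
    by (rule closed, rule curve_algebra.intros; rule base; fact)+
qed

lemma smooth_curve_0: "smooth_curve (\<lambda>t. 0)"
  by (rule smooth_curve_coinduct[of "\<lambda>u. u = (\<lambda>t. 0)"])
    (auto simp: has_deriv_curve_def has_time_deriv_const)

lemma smooth_curve_sum:
  assumes "\<And>i. i \<in> A \<Longrightarrow> smooth_curve (u i)"
  shows "smooth_curve (\<lambda>t. \<Sum>i\<in>A. u i t)"
  using assms
proof (induction A rule: infinite_finite_induct)
  case (insert i A)
  then have "smooth_curve (\<lambda>t. u i t + (\<Sum>i\<in>A. u i t))" by (intro smooth_curve_intros(1)) simp_all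
  with insert show ?case by simp
qed (simp_all add: smooth_curve_0)

lemma smooth_curve_smooth: "smooth_curve u \<Longrightarrow> 0 \<le> t \<Longrightarrow> u t \<in> smooth_space"
  by (erule smooth_curve_deriv) (simp add: has_deriv_curve_def)

lemma smooth_curve_time_deriv: "smooth_curve u \<Longrightarrow> 0 \<le> t \<Longrightarrow> has_time_deriv u (time_deriv u t) t"
  by (erule smooth_curve_deriv) (auto simp: has_deriv_curve_def time_deriv_eq)

lemma smooth_curve_continuous:
  assumes "smooth_curve u" "0 \<le> t"
  shows "limitin smooth_topology u (u t) (forward t)"
  using assms by (intro has_time_deriv_continuous[OF smooth_curve_time_deriv] smooth_curve_smooth)

section \<open>The heat equation and Duhamel's formula\<close>

text \<open>The equation is assumed for the coefficients only. It carries over to the curve because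
\<open>\<Delta>u + f\<close> is locally bounded when \<open>u\<close> and \<open>f\<close> are; and since it expresses the derivative of \<open>u\<close> by
\<open>u\<close> and \<open>f\<close>, it propagates smoothness to all orders.\<close>

lemma smooth_curve_heat_equation:
  fixes u f :: "real \<Rightarrow> 'd::finite tdist"
  assumes u: "\<And>t. 0 \<le> t \<Longrightarrow> u t \<in> smooth_space" and bdd: "locally_bounded u"
    and f: "smooth_curve f"
    and deriv: "\<And>k t. 0 \<le> t \<Longrightarrow> ((\<lambda>t. fcoeff (u t) k) has_vector_derivative
      - ((norm (freq k))\<^sup>2 *\<^sub>R fcoeff (u t) k) + fcoeff (f t) k) (forward t)"
  shows "has_deriv_curve u (\<lambda>t. laplacian (u t) + f t)" and "smooth_curve u"
proof -
  have "locally_bounded f"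
    by (intro locally_bounded_of_continuous smooth_curve_continuous f)
  then have bdd': "locally_bounded (\<lambda>t. laplacian (u t) + f t)"
    using bdd unfolding locally_bounded_def by (meson decays_add decays_laplacian)
  show *: "has_deriv_curve u (\<lambda>t. laplacian (u t) + f t)"
    unfolding has_deriv_curve_def
  proof (intro allI impI conjI u)
    fix t :: real assume t: "0 \<le> t"
    show "has_time_deriv u (laplacian (u t) + f t) t"
      by (rule has_time_deriv_of_fcoeff[OF u bdd' _ t], assumption,
          unfold fcoeff_simps fcoeff_laplacian, rule deriv)
  qed
  \<comment> \<open>The derivative \<open>\<Delta>u + f\<close> lies in the class generated by \<open>u\<close> together with all smooth curves.\<close>
  let ?B = "insert u (Collect smooth_curve)"
  show "smooth_curve u"
  proof (rule smooth_curve_algebra[of ?B])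
    show "curve_algebra ?B u" by (intro curve_algebra.base) simp
    fix w assume "w \<in> ?B"
    then consider "w = u" | "smooth_curve w" by blast
    then show "\<exists>w'. curve_algebra ?B w' \<and> has_deriv_curve w w'"
    proof cases
      case 1
      have "curve_algebra ?B (\<lambda>t. laplacian (u t) + f t)"
        by (intro curve_algebra.add curve_algebra.laplacian; rule curve_algebra.base) (simp_all add: f)
      with * 1 show ?thesis by blast
    next
      case 2
      then obtain w' where "smooth_curve w'" "has_deriv_curve w w'" by (rule smooth_curve_deriv)
      then show ?thesis by (intro exI[of _ w'] conjI curve_algebra.base) simp_all
    qed
  qed
qed

lemma fcoeff_heat:
  assumes "0 \<le> t"
  shows "fcoeff (heat t v) k = exp (- t * (norm (freq k))\<^sup>2) *\<^sub>R fcoeff v k"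
proof -
  let ?h = "\<lambda>k. exp (- t * (norm (freq k))\<^sup>2) *\<^sub>R fcoeff v k"
  have "slow_growth ?h"
    using fcoeff[of v] assms
    by (intro slow_growth_dominated[of "fcoeff v" ?h 1 0]) (auto intro!: mult_left_le_one_le)
  moreover have "?h (- k) = vcnj (?h k)" for k
    by (simp add: freq_uminus fcoeff_uminus_freq vcnj_def vec_eq_iff)
  ultimately have "fcoeff (Tdist ?h) = ?h" by (intro Tdist_inverse) blast
  then show ?thesis by (simp add: heat_def)
qed

lemma decays_heat:
  assumes "decays m M v" "0 \<le> t" shows "decays m M (heat t v)"
  unfolding decays_def
proof
  fix k
  have "norm (fcoeff (heat t v) k) \<le> norm (fcoeff v k)"
    using assms(2) by (simp add: fcoeff_heat mult_left_le_one_le)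
  then have "norm (fcoeff (heat t v) k) * weight k ^ m \<le> norm (fcoeff v k) * weight k ^ m"
    by (rule mult_right_mono) simp
  then show "norm (fcoeff (heat t v) k) * weight k ^ m \<le> M"
    using assms(1) unfolding decays_def by (meson order_trans)
qed

lemma heat_smooth: "v \<in> smooth_space \<Longrightarrow> 0 \<le> t \<Longrightarrow> heat t v \<in> smooth_space"
  unfolding smooth_space_iff solenoidal_def
  by (auto simp: fcoeff_heat cdot_linear) (meson decays_heat)

lemma heat_curve:
  assumes v: "v \<in> smooth_space"
  shows "has_deriv_curve (\<lambda>t. heat t v) (\<lambda>t. laplacian (heat t v) + 0)" and "smooth_curve (\<lambda>t. heat t v)"
proof -
  have "locally_bounded (\<lambda>t. heat t v)"
    using v unfolding locally_bounded_def smooth_space_iff by (meson atLeastAtMost_iff decays_heat)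
  moreover have "((\<lambda>t. fcoeff (heat t v) k) has_vector_derivative
      - ((norm (freq k))\<^sup>2 *\<^sub>R fcoeff (heat t v) k) + fcoeff 0 k) (forward t)" if t: "0 \<le> t" for k t
  proof -
    have "((\<lambda>t. exp (- t * (norm (freq k))\<^sup>2) *\<^sub>R fcoeff v k) has_vector_derivative
        - ((norm (freq k))\<^sup>2 *\<^sub>R (exp (- t * (norm (freq k))\<^sup>2) *\<^sub>R fcoeff v k))) (forward t)"
      by (auto intro!: derivative_eq_intros simp: has_vector_derivative_def mult_ac)
    then have "((\<lambda>t. fcoeff (heat t v) k) has_vector_derivative
        - ((norm (freq k))\<^sup>2 *\<^sub>R (exp (- t * (norm (freq k))\<^sup>2) *\<^sub>R fcoeff v k))) (forward t)"
      by (rule has_vector_derivative_transform[rotated 2]) (use t in \<open>auto simp: fcoeff_heat\<close>)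
    then show ?thesis using t by (simp add: fcoeff_heat)
  qed
  ultimately show "has_deriv_curve (\<lambda>t. heat t v) (\<lambda>t. laplacian (heat t v) + 0)" "smooth_curve (\<lambda>t. heat t v)"
    using smooth_curve_heat_equation[of "\<lambda>t. heat t v" "\<lambda>t. 0"] heat_smooth[OF v] smooth_curve_0 by blast+
qed

lemma fcoeff_sum: "fcoeff (\<Sum>i\<in>A. f i) k = (\<Sum>i\<in>A. fcoeff (f i) k)"
  by (induction A rule: infinite_finite_induct) simp_all

lemma decays_sum:
  "(\<And>i. i \<in> A \<Longrightarrow> decays m (M i) (f i)) \<Longrightarrow> decays m (\<Sum>i\<in>A. M i) (\<Sum>i\<in>A. f i)"
  by (induction A rule: infinite_finite_induct) (simp_all add: decays_add, simp_all add: decays_def)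

text \<open>The coefficients of the Riemann sums are Riemann sums of the coefficients, which converge to
an ordinary integral. A bound \<open>M\<close> for the curve gives the bound \<open>t * M\<close> for every Riemann sum, so
the property of Montel applies along the filter of tagged divisions.\<close>

lemma has_time_integral_of_bounded:
  fixes g :: "real \<Rightarrow> 'd::finite tdist"
  assumes t: "0 \<le> t"
    and sm: "\<And>s. s \<in> {0..t} \<Longrightarrow> g s \<in> smooth_space"
    and bdd: "\<And>m. \<exists>M. \<forall>s\<in>{0..t}. decays m M (g s)"
    and cont: "\<And>k. continuous_on {0..t} (\<lambda>s. fcoeff (g s) k)"
  obtains I where "I \<in> smooth_space" "has_time_integral g I 0 t"
    "\<And>k. fcoeff I k = integral {0..t} (\<lambda>s. fcoeff (g s) k)"
proof -
  let ?F = "division_filter {0..t}"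
  let ?S = "\<lambda>p. \<Sum>(s, J)\<in>p. measure lborel J *\<^sub>R g s"
  have nb: "?F \<noteq> bot" using division_filter_not_empty[of 0 t] by simp
  have div: "\<forall>\<^sub>F p in ?F. p tagged_division_of {0..t}"
    by (rule eventually_division_filter_tagged_division)
  have tags: "s \<in> {0..t}" if "p tagged_division_of {0..t}" "(s, J) \<in> p" for p s J
    using that by (rule tag_in_interval)
  show thesis
  proof (rule limitin_smooth_of_fcoeff_bounded[OF nb, of ?S "\<lambda>k. integral {0..t} (\<lambda>s. fcoeff (g s) k)"])
    show "\<forall>\<^sub>F p in ?F. ?S p \<in> smooth_space"
      using div by eventually_elim (auto intro!: smooth_space_sum smooth_space_intros(4) sm dest: tags)
    show "((\<lambda>p. fcoeff (?S p) k) \<longlongrightarrow> integral {0..t} (\<lambda>s. fcoeff (g s) k)) ?F" for k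
    proof -
      have "((\<lambda>s. fcoeff (g s) k) has_integral integral {0..t} (\<lambda>s. fcoeff (g s) k)) (cbox 0 t)"
        using integrable_integral[OF integrable_continuous_real[OF cont]] by simp
      then show ?thesis
        unfolding has_integral_cbox by (simp add: fcoeff_sum case_prod_unfold)
    qed
    fix m
    obtain M where M: "\<And>s. s \<in> {0..t} \<Longrightarrow> decays m M (g s)" using bdd by blast
    have "decays m (t * M) (?S p)" if p: "p tagged_division_of {0..t}" for p
    proof -
      have "decays m (\<Sum>(s, J)\<in>p. measure lborel J * M) (?S p)"
        unfolding case_prod_unfold
      proof (rule decays_sum)
        fix x assume "x \<in> p"
        then have "fst x \<in> {0..t}" using tags[OF p, of "fst x" "snd x"] by simp
        from decays_scaleR[OF M[OF this], of "measure lborel (snd x)"]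
        show "decays m (measure lborel (snd x) * M) (measure lborel (snd x) *\<^sub>R g (fst x))" by simp
      qed
      also have "(\<Sum>(s, J)\<in>p. measure lborel J * M) = t * M"
        using additive_content_tagged_division[of p 0 t] p t
        by (simp add: case_prod_unfold flip: sum_distrib_right)
      finally show ?thesis .
    qed
    then show "\<exists>M. \<forall>\<^sub>F p in ?F. decays m M (?S p)"
      using div by (intro exI[of _ "t * M"]) (auto elim: eventually_mono)
  next
    fix I assume "I \<in> smooth_space" "\<And>k. fcoeff I k = integral {0..t} (\<lambda>s. fcoeff (g s) k)"
      "limitin smooth_topology ?S I ?F"
    then show thesis using that by (simp add: has_time_integral_def)
  qed
qed

lemma time_integral_eq:
  assumes "0 \<le> t" "has_time_integral g I 0 t" shows "time_integral 0 t g = I"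
  unfolding time_integral_def
proof (rule the_equality)
  show "has_time_integral g I 0 t" by (rule assms(2))
  fix J assume "has_time_integral g J 0 t"
  then show "J = I"
    using assms(2) limitin_smooth_unique[OF division_filter_not_empty[of 0 t]] unfolding has_time_integral_def by simp
qed

text \<open>Each coefficient of \<open>u\<close> is an ordinary integral depending on \<open>t\<close>. Writing it as \<open>e\<^bsup>-t\<bar>k\<bar>\<^sup>2\<^esup>\<close>
times the integral of \<open>e\<^bsup>s\<bar>k\<bar>\<^sup>2\<^esup> f\<^sub>k(s)\<close> puts the dependence on \<open>t\<close> into a factor and an upper
limit, so that the fundamental theorem of calculus yields \<open>u\<^sub>k' = - \<bar>k\<bar>\<^sup>2 u\<^sub>k + f\<^sub>k\<close>.\<close>

lemma duhamel:
  fixes f :: "real \<Rightarrow> 'd::finite tdist"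
  assumes f: "smooth_curve f"
  defines "u \<equiv> \<lambda>t. time_integral 0 t (\<lambda>s. heat (t - s) (f s))"
  shows "0 \<le> t \<Longrightarrow> \<exists>I. has_time_integral (\<lambda>s. heat (t - s) (f s)) I 0 t"
    and "has_deriv_curve u (\<lambda>t. laplacian (u t) + f t)" and "smooth_curve u" and "u 0 = 0"
proof -
  have bdd: "locally_bounded f"
    by (intro locally_bounded_of_continuous smooth_curve_continuous f)
  have cont: "continuous_on {0..} (\<lambda>s. fcoeff (f s) k)" for k
    by (intro continuous_on_fcoeff smooth_curve_continuous f)
  have ex: "\<exists>I. I \<in> smooth_space \<and> has_time_integral (\<lambda>s. heat (t - s) (f s)) I 0 t \<and>
      (\<forall>k. fcoeff I k = integral {0..t} (\<lambda>s. exp (- (t - s) * (norm (freq k))\<^sup>2) *\<^sub>R fcoeff (f s) k))"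
    if t: "0 \<le> t" for t
  proof -
    have coeff: "fcoeff (heat (t - s) (f s)) k = exp (- (t - s) * (norm (freq k))\<^sup>2) *\<^sub>R fcoeff (f s) k"
      if "s \<in> {0..t}" for s k using that by (simp add: fcoeff_heat)
    obtain I where I: "I \<in> smooth_space" "has_time_integral (\<lambda>s. heat (t - s) (f s)) I 0 t"
      "\<And>k. fcoeff I k = integral {0..t} (\<lambda>s. fcoeff (heat (t - s) (f s)) k)"
    proof (rule has_time_integral_of_bounded[OF t])
      show "heat (t - s) (f s) \<in> smooth_space" if "s \<in> {0..t}" for s
        using that by (intro heat_smooth smooth_curve_smooth f) auto
      show "\<exists>M. \<forall>s\<in>{0..t}. decays m M (heat (t - s) (f s))" for m
        using bdd unfolding locally_bounded_def
        by (metis atLeastAtMost_iff decays_heat diff_ge_0_iff_ge)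
      have "continuous_on {0..t} (\<lambda>s. exp (- (t - s) * (norm (freq k))\<^sup>2) *\<^sub>R fcoeff (f s) k)" for k
        by (intro continuous_intros continuous_on_subset[OF cont]) auto
      then show "continuous_on {0..t} (\<lambda>s. fcoeff (heat (t - s) (f s)) k)" for k
        by (rule continuous_on_eq) (simp add: coeff)
    qed blast
    moreover have "integral {0..t} (\<lambda>s. fcoeff (heat (t - s) (f s)) k) =
        integral {0..t} (\<lambda>s. exp (- (t - s) * (norm (freq k))\<^sup>2) *\<^sub>R fcoeff (f s) k)" for k
      by (intro integral_cong coeff)
    ultimately show ?thesis by auto
  qed
  then show "0 \<le> t \<Longrightarrow> \<exists>I. has_time_integral (\<lambda>s. heat (t - s) (f s)) I 0 t" by blast
  have u: "u t \<in> smooth_space"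
    and coeff: "fcoeff (u t) k = exp (- t * (norm (freq k))\<^sup>2) *\<^sub>R
      integral {0..t} (\<lambda>s. exp (s * (norm (freq k))\<^sup>2) *\<^sub>R fcoeff (f s) k)" if t: "0 \<le> t" for t k
  proof -
    obtain I where I: "I \<in> smooth_space" "has_time_integral (\<lambda>s. heat (t - s) (f s)) I 0 t"
      "fcoeff I k = integral {0..t} (\<lambda>s. exp (- (t - s) * (norm (freq k))\<^sup>2) *\<^sub>R fcoeff (f s) k)"
      using ex[OF t] by blast
    have uI: "u t = I" unfolding u_def by (rule time_integral_eq[OF t I(2)])
    show "u t \<in> smooth_space" using I uI by simp
    have "exp (- (t - s) * (norm (freq k))\<^sup>2) = exp (- t * (norm (freq k))\<^sup>2) * exp (s * (norm (freq k))\<^sup>2)" for s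
      by (simp add: algebra_simps flip: exp_add)
    then show "fcoeff (u t) k = exp (- t * (norm (freq k))\<^sup>2) *\<^sub>R
      integral {0..t} (\<lambda>s. exp (s * (norm (freq k))\<^sup>2) *\<^sub>R fcoeff (f s) k)"
      unfolding uI I(3) by (simp flip: scaleR_scaleR)
  qed
  have "locally_bounded u"
    unfolding locally_bounded_def
  proof (intro allI)
    fix T m
    obtain M where M: "\<And>s. s \<in> {0..T} \<Longrightarrow> decays m M (f s)"
      using bdd unfolding locally_bounded_def by blast
    have "decays m (T * M) (u t)" if t: "t \<in> {0..T}" for t
      unfolding decays_def
    proof
      fix k
      obtain I where I: "has_time_integral (\<lambda>s. heat (t - s) (f s)) I 0 t"
        "fcoeff I k = integral {0..t} (\<lambda>s. exp (- (t - s) * (norm (freq k))\<^sup>2) *\<^sub>R fcoeff (f s) k)"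
        using ex[of t] t by auto
      have uI: "u t = I" unfolding u_def by (rule time_integral_eq[OF _ I(1)]) (use t in simp)
      have M0: "0 \<le> M" using M[of t] t decays_nonneg by blast
      have "norm (fcoeff I k) \<le> M * inverse (weight k ^ m) * (t - 0)"
        unfolding I(2)
      proof (rule integral_bound)
        show "continuous_on {0..t} (\<lambda>s. exp (- (t - s) * (norm (freq k))\<^sup>2) *\<^sub>R fcoeff (f s) k)"
          by (intro continuous_intros continuous_on_subset[OF cont]) auto
        fix s assume s: "s \<in> {0..t}"
        have "norm (exp (- (t - s) * (norm (freq k))\<^sup>2) *\<^sub>R fcoeff (f s) k) \<le> norm (fcoeff (f s) k)"
          using s by (simp add: mult_left_le_one_le mult_nonpos_nonneg)
        also have "\<dots> \<le> M * inverse (weight k ^ m)" using s t by (intro norm_fcoeff_le_decays M) auto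
        finally show "norm (exp (- (t - s) * (norm (freq k))\<^sup>2) *\<^sub>R fcoeff (f s) k) \<le> M * inverse (weight k ^ m)" .
      qed (use t in auto)
      from mult_right_mono[OF this, of "weight k ^ m"]
      have "norm (fcoeff I k) * weight k ^ m \<le> t * M" by (simp add: mult_ac)
      also have "\<dots> \<le> T * M" using t M0 by (intro mult_right_mono) auto
      finally show "norm (fcoeff (u t) k) * weight k ^ m \<le> T * M" by (simp add: uI)
    qed
    then show "\<exists>M. \<forall>t\<in>{0..T}. decays m M (u t)" by blast
  qed
  moreover have "((\<lambda>t. fcoeff (u t) k) has_vector_derivative
      - ((norm (freq k))\<^sup>2 *\<^sub>R fcoeff (u t) k) + fcoeff (f t) k) (forward t)" if t: "0 \<le> t" for k t
  proof -
    define a where "a = (norm (freq k))\<^sup>2"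
    define J where "J = (\<lambda>t. integral {0..t} (\<lambda>s. exp (s * a) *\<^sub>R fcoeff (f s) k))"
    have "(J has_vector_derivative exp (t * a) *\<^sub>R fcoeff (f t) k) (at t within {0..t + 1})"
      unfolding J_def using t
      by (intro integral_has_vector_derivative continuous_intros continuous_on_subset[OF cont]) auto
    moreover have "forward t = at t within {0..t + 1}"
      by (rule at_within_nhd[of t "{t - 1<..<t + 1}"]) auto
    ultimately have "(J has_vector_derivative exp (t * a) *\<^sub>R fcoeff (f t) k) (forward t)" by simp
    moreover have "((\<lambda>t. exp (- t * a)) has_real_derivative - a * exp (- t * a)) (forward t)"
      by (auto intro!: derivative_eq_intros)
    ultimately have "((\<lambda>t. exp (- t * a) *\<^sub>R J t) has_vector_derivative
        exp (- t * a) *\<^sub>R (exp (t * a) *\<^sub>R fcoeff (f t) k) + (- a * exp (- t * a)) *\<^sub>R J t) (forward t)"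
      by (intro has_vector_derivative_scaleR)
    moreover have "exp (- t * a) *\<^sub>R (exp (t * a) *\<^sub>R fcoeff (f t) k) + (- a * exp (- t * a)) *\<^sub>R J t
        = - (a *\<^sub>R fcoeff (u t) k) + fcoeff (f t) k"
      using t by (simp add: coeff a_def J_def flip: exp_add)
    ultimately have "((\<lambda>t. exp (- t * a) *\<^sub>R J t) has_vector_derivative
        - (a *\<^sub>R fcoeff (u t) k) + fcoeff (f t) k) (forward t)" by simp
    then show ?thesis
      unfolding a_def[symmetric]
      by (rule has_vector_derivative_transform[rotated 2]) (use t in \<open>auto simp: coeff a_def J_def\<close>)
  qed
  ultimately show "has_deriv_curve u (\<lambda>t. laplacian (u t) + f t)" "smooth_curve u"
    using smooth_curve_heat_equation[of u f] u f by blast+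
  show "u 0 = 0" by (rule tdist_eqI) (simp add: coeff)
qed

section \<open>Expansion of the residual in powers of the Reynolds number\<close>

text \<open>With \<open>j = l + i + 1\<close> the square of index pairs is cut into antidiagonals. Up to \<open>j = N\<close> they
are complete, and from \<open>j = N + 1\<close> on the condition \<open>i \<le> N\<close> removes the indices \<open>l < j - N - 1\<close>.\<close>

lemma sum_square_by_antidiagonals:
  fixes F :: "nat \<Rightarrow> nat \<Rightarrow> 'a :: comm_monoid_add"
  shows "(\<Sum>l=0..N. \<Sum>i=0..N. F l i) =
    (\<Sum>j=1..N. \<Sum>l=0..j-1. F l (j - l - 1)) + (\<Sum>j=N+1..2*N+1. \<Sum>l=j-N-1..N. F l (j - l - 1))"
proof -
  have row: "(\<Sum>i=0..N. F l i) = (\<Sum>j\<in>{j \<in> {1..2*N+1}. l < j \<and> j \<le> l + N + 1}. F l (j - l - 1))"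
    if "l \<in> {0..N}" for l
    by (rule sum.reindex_bij_witness[of _ "\<lambda>j. j - l - 1" "\<lambda>i. i + l + 1"]) (use that in auto)
  have "(\<Sum>l=0..N. \<Sum>i=0..N. F l i)
      = (\<Sum>l=0..N. \<Sum>j\<in>{j \<in> {1..2*N+1}. l < j \<and> j \<le> l + N + 1}. F l (j - l - 1))"
    by (intro sum.cong row) auto
  also have "\<dots> = (\<Sum>j=1..2*N+1. \<Sum>l\<in>{l \<in> {0..N}. l < j \<and> j \<le> l + N + 1}. F l (j - l - 1))"
    by (rule sum.swap_restrict) auto
  also have "{1..2*N+1} = {1..N} \<union> {N+1..2*N+1}" by auto
  also have "(\<Sum>j\<in>{1..N} \<union> {N+1..2*N+1}. \<Sum>l\<in>{l \<in> {0..N}. l < j \<and> j \<le> l + N + 1}. F l (j - l - 1))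
    = (\<Sum>j=1..N. \<Sum>l\<in>{l \<in> {0..N}. l < j \<and> j \<le> l + N + 1}. F l (j - l - 1))
      + (\<Sum>j=N+1..2*N+1. \<Sum>l\<in>{l \<in> {0..N}. l < j \<and> j \<le> l + N + 1}. F l (j - l - 1))"
    by (rule sum.union_disjoint) auto
  also have "(\<Sum>j=1..N. \<Sum>l\<in>{l \<in> {0..N}. l < j \<and> j \<le> l + N + 1}. F l (j - l - 1))
    = (\<Sum>j=1..N. \<Sum>l=0..j-1. F l (j - l - 1))"
  proof (rule sum.cong[OF refl])
    fix j assume "j \<in> {1..N}"
    then have "{l \<in> {0..N}. l < j \<and> j \<le> l + N + 1} = {0..j-1}" by auto
    then show "(\<Sum>l\<in>{l \<in> {0..N}. l < j \<and> j \<le> l + N + 1}. F l (j - l - 1)) = (\<Sum>l=0..j-1. F l (j - l - 1))"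
      by (rule sum.cong) simp
  qed
  also have "(\<Sum>j=N+1..2*N+1. \<Sum>l\<in>{l \<in> {0..N}. l < j \<and> j \<le> l + N + 1}. F l (j - l - 1))
    = (\<Sum>j=N+1..2*N+1. \<Sum>l=j-N-1..N. F l (j - l - 1))"
  proof (rule sum.cong[OF refl])
    fix j assume "j \<in> {N+1..2*N+1}"
    then have "{l \<in> {0..N}. l < j \<and> j \<le> l + N + 1} = {j-N-1..N}" by auto
    then show "(\<Sum>l\<in>{l \<in> {0..N}. l < j \<and> j \<le> l + N + 1}. F l (j - l - 1)) = (\<Sum>l=j-N-1..N. F l (j - l - 1))"
      by (rule sum.cong) simp
  qed
  finally show ?thesis .
qed

lemma ns_bilinear_approx_sol:
  fixes u :: "nat \<Rightarrow> real \<Rightarrow> 'd::finite tdist"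
  assumes u: "\<And>j. j \<le> N \<Longrightarrow> u j t \<in> smooth_space"
  shows "R *\<^sub>R ns_bilinear (approx_sol R N u t) (approx_sol R N u t) =
    (\<Sum>j=1..N. R ^ j *\<^sub>R (\<Sum>l=0..j-1. ns_bilinear (u l t) (u (j - l - 1) t)))
    + (\<Sum>j=N+1..2*N+1. R ^ j *\<^sub>R (\<Sum>l=j-N-1..N. ns_bilinear (u l t) (u (j - l - 1) t)))"
proof -
  let ?F = "\<lambda>l i. R ^ (l + i + 1) *\<^sub>R ns_bilinear (u l t) (u i t)"
  have "R *\<^sub>R ns_bilinear (approx_sol R N u t) (approx_sol R N u t)
      = R *\<^sub>R (\<Sum>l=0..N. ns_bilinear (R ^ l *\<^sub>R u l t) (\<Sum>i=0..N. R ^ i *\<^sub>R u i t))"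
    unfolding approx_sol_def
    by (subst ns_bilinear_sum_left) (auto intro!: smooth_space_sum smooth_space_intros(4) u)
  also have "\<dots> = R *\<^sub>R (\<Sum>l=0..N. \<Sum>i=0..N. ns_bilinear (R ^ l *\<^sub>R u l t) (R ^ i *\<^sub>R u i t))"
    by (intro arg_cong[where f = "scaleR R"] sum.cong ns_bilinear_sum_right refl)
      (auto intro!: smooth_space_intros(4) u)
  also have "\<dots> = (\<Sum>l=0..N. \<Sum>i=0..N. ?F l i)"
    unfolding scaleR_sum_right
    by (intro sum.cong refl)
      (simp add: ns_bilinear_scaleR smooth_space_intros(4) u power_add)
  also have "\<dots> = (\<Sum>j=1..N. \<Sum>l=0..j-1. ?F l (j - l - 1)) + (\<Sum>j=N+1..2*N+1. \<Sum>l=j-N-1..N. ?F l (j - l - 1))"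
    by (rule sum_square_by_antidiagonals)
  also have "(\<Sum>j=1..N. \<Sum>l=0..j-1. ?F l (j - l - 1))
      = (\<Sum>j=1..N. R ^ j *\<^sub>R (\<Sum>l=0..j-1. ns_bilinear (u l t) (u (j - l - 1) t)))"
    unfolding scaleR_sum_right
  proof (intro sum.cong refl)
    fix j l assume "j \<in> {1..N}" "l \<in> {0..j-1}"
    then have "l + (j - l - 1) + 1 = j" by auto
    then show "?F l (j - l - 1) = R ^ j *\<^sub>R ns_bilinear (u l t) (u (j - l - 1) t)" by metis
  qed
  also have "(\<Sum>j=N+1..2*N+1. \<Sum>l=j-N-1..N. ?F l (j - l - 1))
      = (\<Sum>j=N+1..2*N+1. R ^ j *\<^sub>R (\<Sum>l=j-N-1..N. ns_bilinear (u l t) (u (j - l - 1) t)))"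
    unfolding scaleR_sum_right
  proof (intro sum.cong refl)
    fix j l assume "j \<in> {N+1..2*N+1}" "l \<in> {j-N-1..N}"
    then have "l + (j - l - 1) + 1 = j" by auto
    then show "?F l (j - l - 1) = R ^ j *\<^sub>R ns_bilinear (u l t) (u (j - l - 1) t)" by metis
  qed
  finally show ?thesis .
qed

lemma ns_residual_expansion:
  fixes u :: "nat \<Rightarrow> real \<Rightarrow> 'd::finite tdist"
  assumes u: "\<And>j. j \<le> N \<Longrightarrow> smooth_curve (u j)" and t: "0 \<le> t"
  shows "ns_residual R (approx_sol R N u) t =
      (time_deriv (u 0) t - laplacian (u 0 t))
      + (\<Sum>j=1..N. R ^ j *\<^sub>R (time_deriv (u j) t - laplacian (u j t)
           - (\<Sum>l=0..j-1. ns_bilinear (u l t) (u (j - l - 1) t))))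
      - (\<Sum>j=N+1..2*N+1. R ^ j *\<^sub>R (\<Sum>l=j-N-1..N. ns_bilinear (u l t) (u (j - l - 1) t)))"
proof -
  let ?heat = "\<lambda>j. time_deriv (u j) t - laplacian (u j t)"
  have "has_time_deriv (approx_sol R N u) (\<Sum>j=0..N. R ^ j *\<^sub>R time_deriv (u j) t) t"
    unfolding approx_sol_def
    by (intro has_time_deriv_sum has_time_deriv_scaleR smooth_curve_time_deriv u t) auto
  then have "time_deriv (approx_sol R N u) t = (\<Sum>j=0..N. R ^ j *\<^sub>R time_deriv (u j) t)"
    by (rule time_deriv_eq[OF t])
  moreover have "laplacian (approx_sol R N u t) = (\<Sum>j=0..N. R ^ j *\<^sub>R laplacian (u j t))"
    by (simp add: approx_sol_def laplacian_sum laplacian_linear)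
  ultimately have "time_deriv (approx_sol R N u) t - laplacian (approx_sol R N u t)
      = (\<Sum>j=0..N. R ^ j *\<^sub>R ?heat j)"
    by (simp add: sum_subtractf scaleR_diff_right)
  moreover have "(\<Sum>j=0..N. R ^ j *\<^sub>R ?heat j) = ?heat 0 + (\<Sum>j=1..N. R ^ j *\<^sub>R ?heat j)"
    by (simp add: sum.atLeast_Suc_atMost)
  moreover have "u j t \<in> smooth_space" if "j \<le> N" for j
    by (intro smooth_curve_smooth u that t)
  note bilinear = ns_bilinear_approx_sol[of N u t R, OF this]
  ultimately show ?thesis
    unfolding ns_residual_def bilinear
    by (simp add: scaleR_diff_right sum_subtractf)
qed

section \<open>The recursion for the expansion\<close>

lemma smooth_curve_cong:
  assumes "smooth_curve w" and eq: "\<And>t. 0 \<le> t \<Longrightarrow> u t = w t" shows "smooth_curve u"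
proof -
  from assms(1) obtain D where D0: "\<forall>t\<ge>0. D 0 t = w t"
    and D: "\<forall>m. \<forall>t\<ge>0. D m t \<in> smooth_space \<and> has_time_deriv (D m) (D (Suc m) t) t"
    unfolding smooth_curve_def by (elim exE conjE)
  show ?thesis
    unfolding smooth_curve_def
  proof (intro exI conjI)
    show "\<forall>t\<ge>0. D 0 t = u t" using D0 eq by auto
  qed (rule D)
qed

lemma has_deriv_curve_cong:
  assumes "has_deriv_curve w w'" and eq: "\<And>t. 0 \<le> t \<Longrightarrow> u t = w t"
    and eq': "\<And>t. 0 \<le> t \<Longrightarrow> u' t = w' t"
  shows "has_deriv_curve u u'"
  unfolding has_deriv_curve_def
proof (intro allI impI conjI)
  fix t :: real assume t: "0 \<le> t"
  then have "w t \<in> smooth_space" "has_time_deriv w (w' t) t"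
    using assms(1) unfolding has_deriv_curve_def by blast+
  then show "u t \<in> smooth_space" "has_time_deriv u (u' t) t"
    using eq[OF t] eq'[OF t] by (auto intro: has_time_deriv_cong[OF _ t] simp: eq)
qed

lemma reynolds_source_integrable:
  fixes u :: "nat \<Rightarrow> real \<Rightarrow> 'd::finite tdist"
  assumes "smooth_curve (u l)" "smooth_curve (u (j - l - 1))"
  defines "f \<equiv> \<lambda>t. ns_bilinear (u l t) (u (j - l - 1) t)"
    and "w \<equiv> \<lambda>t. time_integral 0 t (reynolds_integrand u j l t)"
  shows "0 \<le> t \<Longrightarrow> \<exists>I. has_time_integral (reynolds_integrand u j l t) I 0 t"
    and "has_deriv_curve w (\<lambda>t. laplacian (w t) + f t)" and "smooth_curve w" and "w 0 = 0"
proof -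
  have f: "smooth_curve f" unfolding f_def by (intro smooth_curve_intros assms)
  have eq: "reynolds_integrand u j l t = (\<lambda>s. heat (t - s) (f s))" for t
    by (simp add: reynolds_integrand_def f_def fun_eq_iff)
  show "0 \<le> t \<Longrightarrow> \<exists>I. has_time_integral (reynolds_integrand u j l t) I 0 t"
    "has_deriv_curve w (\<lambda>t. laplacian (w t) + f t)" "smooth_curve w" "w 0 = 0"
    using duhamel[OF f] unfolding w_def eq by blast+
qed

text \<open>Strong induction along the recursion: the source terms of \<open>u\<^sub>j\<close> are smooth by the induction
hypothesis, and each of them contributes a Duhamel integral. At \<open>j = 0\<close> there is no source and the
initial value is \<open>ustar\<close>; the case is separated because the index range \<open>{0..j-1}\<close> is not empty
for \<open>j = 0\<close>.\<close>

lemma reynolds_recursion_solution: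
  fixes u :: "nat \<Rightarrow> real \<Rightarrow> 'd::finite tdist"
  assumes rec: "reynolds_recursion ustar N u" and ustar: "ustar \<in> smooth_space" and "j \<le> N"
  shows "smooth_curve (u j) \<and> has_deriv_curve (u j)
      (\<lambda>t. laplacian (u j t) + (if j = 0 then 0 else \<Sum>l=0..j-1. ns_bilinear (u l t) (u (j - l - 1) t))) \<and>
    (0 < j \<longrightarrow> u j 0 = 0)"
  using \<open>j \<le> N\<close>
proof (induction j rule: less_induct)
  case (less j)
  show ?case
  proof (cases "j = 0")
    case True
    have "u 0 t = heat t ustar" if "0 \<le> t" for t using rec that by (simp add: reynolds_recursion_def)
    then have "smooth_curve (u 0)" "has_deriv_curve (u 0) (\<lambda>t. laplacian (u 0 t) + 0)"
      using smooth_curve_cong[OF heat_curve(2)[OF ustar], of "u 0"]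
        has_deriv_curve_cong[OF heat_curve(1)[OF ustar], of "u 0" "\<lambda>t. laplacian (u 0 t) + 0"] by simp_all
    with True show ?thesis by simp
  next
    case False
    define w where "w = (\<lambda>l t. time_integral 0 t (reynolds_integrand u j l t))"
    define f where "f = (\<lambda>l t. ns_bilinear (u l t) (u (j - l - 1) t))"
    have uj: "u j t = (\<Sum>l=0..j-1. w l t)" if "0 \<le> t" for t
      using rec that False less.prems by (simp add: reynolds_recursion_def w_def)
    have smooth: "smooth_curve (u l)" "smooth_curve (u (j - l - 1))" if "l \<in> {0..j-1}" for l
      using less.IH[of l] less.IH[of "j - l - 1"] less.prems that False by auto
    have w: "has_deriv_curve (w l) (\<lambda>t. laplacian (w l t) + f l t)" "smooth_curve (w l)" "w l 0 = 0"
      if "l \<in> {0..j-1}" for l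
      using reynolds_source_integrable(2-4)[of u l j, OF smooth[OF that]] unfolding w_def f_def by blast+
    have "smooth_curve (u j)"
      by (rule smooth_curve_cong[OF smooth_curve_sum[of "{0..j-1}" w, OF w(2)] uj])
    moreover have "has_deriv_curve (\<lambda>t. \<Sum>l=0..j-1. w l t) (\<lambda>t. \<Sum>l=0..j-1. laplacian (w l t) + f l t)"
      using w(1) unfolding has_deriv_curve_def
      by (intro allI impI conjI smooth_space_sum has_time_deriv_sum) auto
    then have "has_deriv_curve (u j) (\<lambda>t. laplacian (u j t) + (\<Sum>l=0..j-1. f l t))"
      by (rule has_deriv_curve_cong) (simp_all add: uj sum.distrib laplacian_sum)
    moreover have "u j 0 = 0" using w(3) by (simp add: uj)
    ultimately show ?thesis using False by (simp add: f_def)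
  qed
qed

function reynolds_terms :: "'d::finite tdist \<Rightarrow> nat \<Rightarrow> real \<Rightarrow> 'd tdist" where
  "reynolds_terms v 0 t = heat t v"
| "reynolds_terms v (Suc j) t = (\<Sum>l=0..j. time_integral 0 t
     (\<lambda>s. heat (t - s) (ns_bilinear (reynolds_terms v l s) (reynolds_terms v (j - l) s))))"
  by pat_completeness auto
termination
  by (relation "Wellfounded.measure (\<lambda>(_, j, _). j)") auto

lemma reynolds_recursion_terms: "reynolds_recursion v N (reynolds_terms v)"
  unfolding reynolds_recursion_def
proof (intro conjI allI impI ballI)
  fix j t assume "j \<in> {1..N}"
  then obtain i where "j = Suc i" by (cases j) auto
  then show "reynolds_terms v j t = (\<Sum>l=0..j-1. time_integral 0 t (reynolds_integrand (reynolds_terms v) j l t))"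
    by (simp add: reynolds_integrand_def[abs_def])
qed simp

section \<open>Estimates for the residual\<close>

lemma ns_residual_reynolds:
  fixes u :: "nat \<Rightarrow> real \<Rightarrow> 'd::finite tdist"
  assumes rec: "reynolds_recursion ustar N u" and ustar: "ustar \<in> smooth_space" and t: "0 \<le> t"
  shows "time_deriv (u 0) t - laplacian (u 0 t) = 0"
    and "j \<in> {1..N} \<Longrightarrow> time_deriv (u j) t - laplacian (u j t)
           - (\<Sum>l=0..j-1. ns_bilinear (u l t) (u (j - l - 1) t)) = 0"
    and "ns_residual R (approx_sol R N u) t =
      - (\<Sum>j=N+1..2*N+1. R ^ j *\<^sub>R (\<Sum>l=j-N-1..N. ns_bilinear (u l t) (u (j - l - 1) t)))"
proof -
  note sol = reynolds_recursion_solution[OF rec ustar]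
  have td: "time_deriv (u j) t =
      laplacian (u j t) + (if j = 0 then 0 else \<Sum>l=0..j-1. ns_bilinear (u l t) (u (j - l - 1) t))"
    if "j \<le> N" for j
    using sol[OF that] t by (intro time_deriv_eq) (auto simp only: has_deriv_curve_def)
  show 0: "time_deriv (u 0) t - laplacian (u 0 t) = 0" by (simp add: td)
  show 1: "time_deriv (u j) t - laplacian (u j t)
      - (\<Sum>l=0..j-1. ns_bilinear (u l t) (u (j - l - 1) t)) = 0" if "j \<in> {1..N}" for j
    using that by (simp add: td)
  have "ns_residual R (approx_sol R N u) t = 0 + (\<Sum>j=1..N. R ^ j *\<^sub>R 0)
      - (\<Sum>j=N+1..2*N+1. R ^ j *\<^sub>R (\<Sum>l=j-N-1..N. ns_bilinear (u l t) (u (j - l - 1) t)))"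
    using sol t by (subst ns_residual_expansion) (simp_all only: 0 1 cong: sum.cong)
  then show "ns_residual R (approx_sol R N u) t =
      - (\<Sum>j=N+1..2*N+1. R ^ j *\<^sub>R (\<Sum>l=j-N-1..N. ns_bilinear (u l t) (u (j - l - 1) t)))"
    by simp
qed

text \<open>Only finitely many powers of \<open>R\<close> are left in the residual, so the triangle inequality
suffices. The function \<open>B\<close> is a parameter so that both inequalities for the bilinear map, the
basic one and the tame one, are covered.\<close>

lemma sobolev_norm_residual_le:
  fixes u :: "nat \<Rightarrow> real \<Rightarrow> 'd::finite tdist"
  assumes rec: "reynolds_recursion ustar N u" and ustar: "ustar \<in> smooth_space" and t: "0 \<le> t" and R: "0 < R"
    and bound: "\<And>v w :: 'd tdist. v \<in> smooth_space \<Longrightarrow> w \<in> smooth_space \<Longrightarrow>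
      sobolev_norm p (ns_bilinear v w) \<le> K * B v w"
  shows "sobolev_norm p (ns_residual R (approx_sol R N u) t) \<le>
    K * (\<Sum>j=N+1..2*N+1. R ^ j * (\<Sum>l=j-N-1..N. B (u l t) (u (j - l - 1) t)))"
proof -
  let ?P = "\<lambda>j l. ns_bilinear (u l t) (u (j - l - 1) t)"
  let ?J = "{N+1..2*N+1}" and ?L = "\<lambda>j. {j-N-1..N}"
  have u: "u j t \<in> smooth_space" if "j \<le> N" for j
    using reynolds_recursion_solution[OF rec ustar that] t by (auto intro: smooth_curve_smooth)
  have sm: "u l t \<in> smooth_space" "u (j - l - 1) t \<in> smooth_space" if "j \<in> ?J" "l \<in> ?L j" for j l
    using that by (auto intro!: u)
  have P: "?P j l \<in> sobolev_space p" if "j \<in> ?J" "l \<in> ?L j" for j l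
    by (intro smooth_sobolev ns_bilinear_smooth sm(1)[OF that] sm(2)[OF that])
  have S: "(\<Sum>l\<in>?L j. ?P j l) \<in> sobolev_space p"
    "sobolev_norm p (\<Sum>l\<in>?L j. ?P j l) \<le> (\<Sum>l\<in>?L j. sobolev_norm p (?P j l))" if "j \<in> ?J" for j
    using sobolev_norm_sum[of "?L j" "?P j" p] P[OF that] by blast+
  have RS: "R ^ j *\<^sub>R (\<Sum>l\<in>?L j. ?P j l) \<in> sobolev_space p"
    "sobolev_norm p (R ^ j *\<^sub>R (\<Sum>l\<in>?L j. ?P j l)) \<le> \<bar>R ^ j\<bar> * sobolev_norm p (\<Sum>l\<in>?L j. ?P j l)" if "j \<in> ?J" for j
    using sobolev_norm_scaleR[OF S(1)[OF that]] by blast+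
  note T = sobolev_norm_sum[of ?J "\<lambda>j. R ^ j *\<^sub>R (\<Sum>l\<in>?L j. ?P j l)" p, OF RS(1)]
  have "sobolev_norm p (ns_residual R (approx_sol R N u) t)
      \<le> sobolev_norm p (\<Sum>j\<in>?J. R ^ j *\<^sub>R (\<Sum>l\<in>?L j. ?P j l))"
    unfolding ns_residual_reynolds(3)[OF rec ustar t] using T sobolev_norm_uminus by blast
  also have "\<dots> \<le> (\<Sum>j\<in>?J. sobolev_norm p (R ^ j *\<^sub>R (\<Sum>l\<in>?L j. ?P j l)))"
    using T by blast
  also have "\<dots> \<le> (\<Sum>j\<in>?J. R ^ j * (\<Sum>l\<in>?L j. K * B (u l t) (u (j - l - 1) t)))"
  proof (rule sum_mono)
    fix j assume j: "j \<in> ?J"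
    have "(\<Sum>l\<in>?L j. sobolev_norm p (?P j l)) \<le> (\<Sum>l\<in>?L j. K * B (u l t) (u (j - l - 1) t))"
      by (intro sum_mono bound sm(1)[OF j] sm(2)[OF j])
    with S(2)[OF j] have "sobolev_norm p (\<Sum>l\<in>?L j. ?P j l) \<le> (\<Sum>l\<in>?L j. K * B (u l t) (u (j - l - 1) t))"
      by (rule order_trans)
    from mult_left_mono[OF this, of "\<bar>R ^ j\<bar>"]
    have "\<bar>R ^ j\<bar> * sobolev_norm p (\<Sum>l\<in>?L j. ?P j l) \<le> \<bar>R ^ j\<bar> * (\<Sum>l\<in>?L j. K * B (u l t) (u (j - l - 1) t))"
      by (simp only: abs_ge_zero)
    with RS(2)[OF j] have le: "sobolev_norm p (R ^ j *\<^sub>R (\<Sum>l\<in>?L j. ?P j l))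
        \<le> \<bar>R ^ j\<bar> * (\<Sum>l\<in>?L j. K * B (u l t) (u (j - l - 1) t))"
      by (rule order_trans)
    have "\<bar>R ^ j\<bar> = R ^ j" using R by simp
    with le show "sobolev_norm p (R ^ j *\<^sub>R (\<Sum>l\<in>?L j. ?P j l)) \<le> R ^ j * (\<Sum>l\<in>?L j. K * B (u l t) (u (j - l - 1) t))"
      by (simp only:)
  qed
  also have "\<dots> = K * (\<Sum>j\<in>?J. R ^ j * (\<Sum>l\<in>?L j. B (u l t) (u (j - l - 1) t)))"
    by (simp only: sum_distrib_left mult.left_commute)
  finally show ?thesis .
qed

theorem proposition2p1:
  fixes R :: real and ustar :: "'d::finite tdist" and N :: nat
  assumes dim: "CARD('d) \<ge> 2"
    and R: "R > 0"
    and ustar: "ustar \<in> smooth_space"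
  shows
    "(\<forall>u :: nat \<Rightarrow> real \<Rightarrow> 'd tdist. (\<forall>j\<le>N. smooth_curve (u j)) \<longrightarrow>
       (\<forall>t\<ge>0. ns_residual R (approx_sol R N u) t =
          (time_deriv (u 0) t - laplacian (u 0 t))
          + (\<Sum>j=1..N. R ^ j *\<^sub>R (time_deriv (u j) t - laplacian (u j t)
               - (\<Sum>l=0..j-1. ns_bilinear (u l t) (u (j - l - 1) t))))
          - (\<Sum>j=N+1..2*N+1. R ^ j *\<^sub>R (\<Sum>l=j-N-1..N. ns_bilinear (u l t) (u (j - l - 1) t)))))
    \<and>
    (\<exists>u :: nat \<Rightarrow> real \<Rightarrow> 'd tdist. (\<forall>j\<le>N. smooth_curve (u j)) \<and> reynolds_recursion ustar N u)
    \<and>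
    (\<forall>u :: nat \<Rightarrow> real \<Rightarrow> 'd tdist. reynolds_recursion ustar N u \<longrightarrow>
       (\<forall>j\<le>N. smooth_curve (u j)) \<and>
       (\<forall>j\<in>{1..N}. \<forall>l\<in>{0..j-1}. \<forall>t\<ge>0. \<exists>I. has_time_integral (reynolds_integrand u j l t) I 0 t) \<and>
       u 0 0 = ustar \<and> (\<forall>j\<in>{1..N}. u j 0 = 0) \<and>
       (\<forall>t\<ge>0. time_deriv (u 0) t - laplacian (u 0 t) = 0) \<and>
       (\<forall>j\<in>{1..N}. \<forall>t\<ge>0. time_deriv (u j) t - laplacian (u j t)
           - (\<Sum>l=0..j-1. ns_bilinear (u l t) (u (j - l - 1) t)) = 0) \<and>
       approx_sol R N u 0 = ustar \<and>
       (\<forall>t\<ge>0. ns_residual R (approx_sol R N u) t =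
          - (\<Sum>j=N+1..2*N+1. R ^ j *\<^sub>R (\<Sum>l=j-N-1..N. ns_bilinear (u l t) (u (j - l - 1) t)))))
    \<and>
    (\<forall>u :: nat \<Rightarrow> real \<Rightarrow> 'd tdist. reynolds_recursion ustar N u \<longrightarrow>
       (\<forall>n K. n > CARD('d) / 2 \<and> bilinear_const TYPE('d) n K \<longrightarrow>
         (\<forall>t\<ge>0. sobolev_norm n (ns_residual R (approx_sol R N u) t) \<le>
            K * (\<Sum>j=N+1..2*N+1. R ^ j * (\<Sum>l=j-N-1..N.
               sobolev_norm n (u l t) * sobolev_norm (n + 1) (u (j - l - 1) t))))))
    \<and>
    (\<forall>u :: nat \<Rightarrow> real \<Rightarrow> 'd tdist. reynolds_recursion ustar N u \<longrightarrow>
       (\<forall>p n K. p \<ge> n \<and> n > CARD('d) / 2 \<and> tame_const TYPE('d) p n K \<longrightarrow>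
         (\<forall>t\<ge>0. sobolev_norm p (ns_residual R (approx_sol R N u) t) \<le>
            1 / 2 * K * (\<Sum>j=N+1..2*N+1. R ^ j * (\<Sum>l=j-N-1..N.
               sobolev_norm p (u l t) * sobolev_norm (n + 1) (u (j - l - 1) t)
               + sobolev_norm n (u l t) * sobolev_norm (p + 1) (u (j - l - 1) t))))))"
proof (intro conjI; (intro allI impI)?)
  fix u :: "nat \<Rightarrow> real \<Rightarrow> 'd tdist" and t :: real
  assume "\<forall>j\<le>N. smooth_curve (u j)" "0 \<le> t"
  then show "ns_residual R (approx_sol R N u) t =
      (time_deriv (u 0) t - laplacian (u 0 t))
      + (\<Sum>j=1..N. R ^ j *\<^sub>R (time_deriv (u j) t - laplacian (u j t)
           - (\<Sum>l=0..j-1. ns_bilinear (u l t) (u (j - l - 1) t))))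
      - (\<Sum>j=N+1..2*N+1. R ^ j *\<^sub>R (\<Sum>l=j-N-1..N. ns_bilinear (u l t) (u (j - l - 1) t)))"
    by (intro ns_residual_expansion) auto
next
  show "\<exists>u :: nat \<Rightarrow> real \<Rightarrow> 'd tdist. (\<forall>j\<le>N. smooth_curve (u j)) \<and> reynolds_recursion ustar N u"
    using reynolds_recursion_terms reynolds_recursion_solution[OF reynolds_recursion_terms ustar] by blast
next
  fix u :: "nat \<Rightarrow> real \<Rightarrow> 'd tdist"
  assume rec: "reynolds_recursion ustar N u"
  note sol = reynolds_recursion_solution[OF rec ustar]
  have u0: "u 0 0 = ustar"
    using rec by (auto intro!: tdist_eqI simp: reynolds_recursion_def fcoeff_heat)
  have uj: "u j 0 = 0" if "j \<in> {1..N}" for j using sol[of j] that by simp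
  have "\<exists>I. has_time_integral (reynolds_integrand u j l t) I 0 t"
    if "j \<in> {1..N}" "l \<in> {0..j-1}" "0 \<le> t" for j l t
    by (rule reynolds_source_integrable(1)) (use sol[of l] sol[of "j - l - 1"] that in auto)
  moreover have "approx_sol R N u 0 = ustar"
  proof -
    have "(\<Sum>j=0..N. R ^ j *\<^sub>R u j 0) = u 0 0 + (\<Sum>j=1..N. R ^ j *\<^sub>R u j 0)"
      by (simp add: sum.atLeast_Suc_atMost)
    then show ?thesis by (simp add: approx_sol_def u0 uj)
  qed
  ultimately show "(\<forall>j\<le>N. smooth_curve (u j)) \<and>
       (\<forall>j\<in>{1..N}. \<forall>l\<in>{0..j-1}. \<forall>t\<ge>0. \<exists>I. has_time_integral (reynolds_integrand u j l t) I 0 t) \<and>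
       u 0 0 = ustar \<and> (\<forall>j\<in>{1..N}. u j 0 = 0) \<and>
       (\<forall>t\<ge>0. time_deriv (u 0) t - laplacian (u 0 t) = 0) \<and>
       (\<forall>j\<in>{1..N}. \<forall>t\<ge>0. time_deriv (u j) t - laplacian (u j t)
           - (\<Sum>l=0..j-1. ns_bilinear (u l t) (u (j - l - 1) t)) = 0) \<and>
       approx_sol R N u 0 = ustar \<and>
       (\<forall>t\<ge>0. ns_residual R (approx_sol R N u) t =
          - (\<Sum>j=N+1..2*N+1. R ^ j *\<^sub>R (\<Sum>l=j-N-1..N. ns_bilinear (u l t) (u (j - l - 1) t))))"
    using sol u0 uj ns_residual_reynolds[OF rec ustar] by blast
next
  fix u :: "nat \<Rightarrow> real \<Rightarrow> 'd tdist" and n K t :: real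
  assume rec: "reynolds_recursion ustar N u" and t: "0 \<le> t" and "n > CARD('d) / 2 \<and> bilinear_const TYPE('d) n K"
  then have K: "bilinear_const TYPE('d) n K" by blast
  have "sobolev_norm n (ns_bilinear v w) \<le> K * (sobolev_norm n v * sobolev_norm (n + 1) w)"
    if "v \<in> smooth_space" "w \<in> smooth_space" for v w :: "'d tdist"
    using K that unfolding bilinear_const_def by (simp add: smooth_sobolev mult.assoc)
  then show "sobolev_norm n (ns_residual R (approx_sol R N u) t) \<le>
      K * (\<Sum>j=N+1..2*N+1. R ^ j * (\<Sum>l=j-N-1..N.
        sobolev_norm n (u l t) * sobolev_norm (n + 1) (u (j - l - 1) t)))"
    by (rule sobolev_norm_residual_le[OF rec ustar t R])
next
  fix u :: "nat \<Rightarrow> real \<Rightarrow> 'd tdist" and p n K t :: real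
  assume rec: "reynolds_recursion ustar N u" and t: "0 \<le> t" and "p \<ge> n \<and> n > CARD('d) / 2 \<and> tame_const TYPE('d) p n K"
  then have K: "tame_const TYPE('d) p n K" by blast
  have "sobolev_norm p (ns_bilinear v w) \<le> 1 / 2 * K *
      (sobolev_norm p v * sobolev_norm (n + 1) w + sobolev_norm n v * sobolev_norm (p + 1) w)"
    if "v \<in> smooth_space" "w \<in> smooth_space" for v w :: "'d tdist"
    using K that unfolding tame_const_def by (simp add: smooth_sobolev)
  then show "sobolev_norm p (ns_residual R (approx_sol R N u) t) \<le>
      1 / 2 * K * (\<Sum>j=N+1..2*N+1. R ^ j * (\<Sum>l=j-N-1..N.
        sobolev_norm p (u l t) * sobolev_norm (n + 1) (u (j - l - 1) t)
        + sobolev_norm n (u l t) * sobolev_norm (p + 1) (u (j - l - 1) t)))"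
    by (rule sobolev_norm_residual_le[OF rec ustar t R])
qed

end
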